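(* For $m\ge 1$ let $R_m$ be the $(m+1)\times m$ rectangle in $\mathbb{Z}^2$, let $E_m$ be its set of edges, and let $\mathcal{C}_m\subset\{0,1\}^{E_m}$ be the left-right crossing event. Then the events $\mathcal{C}_m$ are asymptotically noise sensitive; that is, $\phi(\mathcal{C}_m,\epsilon)\to 0$ as $m\to\infty$, for every $\epsilon\in(0,1/2)$.
   Context: Rectangle and crossing: $R_m$ is the subgraph of the square grid $\mathbb{Z}^2$ induced on the vertices $\{0,\dots,m\}\times\{1,\dots,m\}$ (so $|E_m|=2m^2-1$); its left boundary is the set of vertices with first coordinate $0$ and its right boundary the set of vertices with first coordinate $m$. A configuration is an element $\omega\in\{0,1\}^{E_m}$. The event $\mathcal{C}_m$ is the set of configurations $\omega$ for which there is a path in $R_m$ joining the left boundary to the right boundary and consisting entirely of edges $e$ with $\omega(e)=1$. We identify $\{0,1\}^{E_m}$ with $\Omega_{n}=\{0,1\}^{n}$, $n=|E_m|$. Noise: $\Omega_n=\{0,1\}^n$ carries the uniform probability measure $\mathbf{P}$. For $x\in\Omega_n$ and $\epsilon\in(0,1)$, $N_\epsilon(x)$ is the random element of $\Omega_n$ whose coordinates are, independently, $x_j$ with probability $1-\epsilon$ and $1-x_j$ with probability $\epsilon$. Sensitivity gauge: for an event $\mathcal{A}\subset\Omega_n$ and $\delta>0$, let $$\gamma(\mathcal{A},\epsilon,\delta)=\mathbf{P}\Bigl\{x\in\Omega_n:\bigl|\mathbf{P}(N_\epsilon(x)\in\mathcal{A}\mid x)-\mathbf{P}(\mathcal{A})\bigr|>\delta\Bigr\},\qquad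 \phi(\mathcal{A},\epsilon)=\inf\{\delta>0:\gamma(\mathcal{A},\epsilon,\delta)<\delta\}.$$ A sequence of events $\mathcal{A}_m\subset\Omega_{n_m}$ is asymptotically noise sensitive if $\lim_{m\to\infty}\phi(\mathcal{A}_m,\epsilon)=0$ for every $\epsilon\in(0,1/2)$. *)

theory Defs
  imports "HOL-Probability.Probability"
begin

section \<open>Noise sensitivity on the discrete cube\<close>

text \<open>
  The cube is indexed by an arbitrary finite set \<open>I\<close> rather than by an initial segment of the
  naturals, so that configurations on the edges of a graph need no enumeration of the edges.
  Points of the cube are functions that take the value \<open>False\<close> outside \<open>I\<close>, which is the
  convention of \<^const>\<open>Pi_pmf\<close>.
\<close>

definition cube :: "'i set \<Rightarrow> ('i \<Rightarrow> bool) set" where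
  "cube I = PiE_dflt I False (\<lambda>_. UNIV)"

definition uniform_cube :: "'i set \<Rightarrow> ('i \<Rightarrow> bool) pmf" where
  "uniform_cube I = pmf_of_set (cube I)"

definition noise :: "'i set \<Rightarrow> real \<Rightarrow> ('i \<Rightarrow> bool) \<Rightarrow> ('i \<Rightarrow> bool) pmf" where
  "noise I \<epsilon> x =
     Pi_pmf I False (\<lambda>j. map_pmf (\<lambda>flip. if flip then \<not> x j else x j) (bernoulli_pmf \<epsilon>))"

definition sensitivity_gauge :: "'i set \<Rightarrow> ('i \<Rightarrow> bool) set \<Rightarrow> real \<Rightarrow> real \<Rightarrow> real" where
  "sensitivity_gauge I A \<epsilon> \<delta> =
     measure_pmf.prob (uniform_cube I)
       {x \<in> cube I. \<bar>measure_pmf.prob (noise I \<epsilon> x) A - measure_pmf.prob (uniform_cube I) A\<bar> > \<delta>}"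

definition noise_phi :: "'i set \<Rightarrow> ('i \<Rightarrow> bool) set \<Rightarrow> real \<Rightarrow> real" where
  "noise_phi I A \<epsilon> = Inf {\<delta>. \<delta> > 0 \<and> sensitivity_gauge I A \<epsilon> \<delta> < \<delta>}"

text \<open>The infimum is taken over a nonempty set that is bounded below, so \<^const>\<open>Inf\<close> on the reals
  is the true infimum.\<close>

lemma noise_phi_set_wf:
  "2 \<in> {\<delta>. \<delta> > 0 \<and> sensitivity_gauge I A \<epsilon> \<delta> < \<delta>}"
  "bdd_below {\<delta>. \<delta> > 0 \<and> sensitivity_gauge I A \<epsilon> \<delta> < \<delta>}"
proof -
  have "sensitivity_gauge I A \<epsilon> 2 \<le> 1"
    unfolding sensitivity_gauge_def by (rule measure_pmf.prob_le_1)
  then show "2 \<in> {\<delta>. \<delta> > 0 \<and> sensitivity_gauge I A \<epsilon> \<delta> < \<delta>}" by simp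
  show "bdd_below {\<delta>. \<delta> > 0 \<and> sensitivity_gauge I A \<epsilon> \<delta> < \<delta>}"
    by (rule bdd_belowI[of _ 0]) simp
qed

text \<open>Intended for finite \<open>I m\<close> and events \<open>A m \<subseteq> cube (I m)\<close>.\<close>

definition asymptotically_noise_sensitive ::
    "(nat \<Rightarrow> 'i set) \<Rightarrow> (nat \<Rightarrow> ('i \<Rightarrow> bool) set) \<Rightarrow> bool" where
  "asymptotically_noise_sensitive I A \<longleftrightarrow>
     (\<forall>\<epsilon>. 0 < \<epsilon> \<and> \<epsilon> < 1/2 \<longrightarrow> (\<lambda>m. noise_phi (I m) (A m) \<epsilon>) \<longlonglongrightarrow> 0)"


section \<open>Left-right crossings of a rectangle\<close>

type_synonym vertex = "int \<times> int"

definition grid_adj :: "vertex \<Rightarrow> vertex \<Rightarrow> bool" where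
  "grid_adj u v \<longleftrightarrow> \<bar>fst u - fst v\<bar> + \<bar>snd u - snd v\<bar> = 1"

definition rect_verts :: "nat \<Rightarrow> vertex set" where
  "rect_verts m = {0..int m} \<times> {1..int m}"

definition rect_edges :: "nat \<Rightarrow> vertex set set" where
  "rect_edges m = {{u, v} | u v. u \<in> rect_verts m \<and> v \<in> rect_verts m \<and> grid_adj u v}"

definition rect_path :: "nat \<Rightarrow> vertex list \<Rightarrow> bool" where
  "rect_path m p \<longleftrightarrow> p \<noteq> [] \<and> distinct p \<and> set p \<subseteq> rect_verts m \<and>
     successively (\<lambda>u v. {u, v} \<in> rect_edges m) p"

definition crossing_event :: "nat \<Rightarrow> (vertex set \<Rightarrow> bool) set" where
  "crossing_event m = {\<omega> \<in> cube (rect_edges m). \<exists>p. rect_path m p \<and>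
     fst (hd p) = 0 \<and> fst (last p) = int m \<and> successively (\<lambda>u v. \<omega> {u, v}) p}"

lemma card_rect_edges: "finite (rect_edges m)" "m \<ge> 1 \<Longrightarrow> card (rect_edges m) = 2 * m\<^sup>2 - 1"
proof -
  define H where "H = (\<lambda>(a, b). {(a, b), (a + 1, b :: int)}) ` ({0..int m - 1} \<times> {1..int m})"
  define V where "V = (\<lambda>(a, b). {(a, b), (a :: int, b + 1)}) ` ({0..int m} \<times> {1..int m - 1})"
  have "rect_edges m \<subseteq> H \<union> V"
  proof
    fix e assume "e \<in> rect_edges m"
    then obtain a b c d where e: "e = {(a, b), (c, d)}" and
      r: "a \<in> {0..int m}" "c \<in> {0..int m}" "b \<in> {1..int m}" "d \<in> {1..int m}"
      and "\<bar>a - c\<bar> + \<bar>b - d\<bar> = 1"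
      unfolding rect_edges_def rect_verts_def grid_adj_def by auto
    then consider "c = a + 1" "d = b" | "a = c + 1" "d = b" | "c = a" "d = b + 1" | "c = a" "b = d + 1"
      by linarith
    then show "e \<in> H \<union> V"
    proof cases
      case 1 then show ?thesis using e r unfolding H_def by (auto intro!: image_eqI[of _ _ "(a, b)"])
    next
      case 2 then show ?thesis using e r unfolding H_def by (auto intro!: image_eqI[of _ _ "(c, d)"])
    next
      case 3 then show ?thesis using e r unfolding V_def by (auto intro!: image_eqI[of _ _ "(a, b)"])
    next
      case 4 then show ?thesis using e r unfolding V_def by (auto intro!: image_eqI[of _ _ "(c, d)"])
    qed
  qed
  moreover have "H \<union> V \<subseteq> rect_edges m"
    unfolding H_def V_def rect_edges_def rect_verts_def grid_adj_def by fastforce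
  ultimately have eq: "rect_edges m = H \<union> V" by blast
  have fin: "finite H" "finite V" unfolding H_def V_def by auto
  then show "finite (rect_edges m)" using eq by simp
  assume m: "m \<ge> 1"
  have dis: "H \<inter> V = {}" unfolding H_def V_def by (auto simp: doubleton_eq_iff)
  have "card H = m * m"
    unfolding H_def by (subst card_image) (auto simp: inj_on_def doubleton_eq_iff)
  moreover have "card V = (m + 1) * (m - 1)"
    unfolding V_def using m by (subst card_image) (auto simp: inj_on_def doubleton_eq_iff nat_diff_distrib nat_add_distrib)
  moreover have "m * m + (m + 1) * (m - 1) = 2 * m\<^sup>2 - 1"
    using m by (cases m) (auto simp: power2_eq_square)
  ultimately show "card (rect_edges m) = 2 * m\<^sup>2 - 1"
    using eq card_Un_disjoint[OF fin dis] by simp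
qed

end

theory Submission
  imports Defs
begin

text \<open>
  Schramm-Steif: if a stopping set \<open>J\<close> determines \<open>f\<close> and meets each coordinate with probability at most \<open>\<delta>\<close>, then
  the Fourier weight of \<open>f\<close> at level \<open>k\<close> is at most \<open>k \<delta>\<close>; hence the variance of the noised \<open>f\<close> is
  \<open>O(\<delta>)\<close>. For the crossing event, explore all open clusters that meet a vertical line \<open>x = a\<close>. Averaged
  over \<open>a\<close>, an edge is examined with probability at most a Cesaro mean of one-arm probabilities.

  These tend to \<open>0\<close>: by self-duality the square is crossed with probability at most \<open>1/2\<close>, a
  Russo-Seymour-Welsh argument bounds the easy-way crossing probability of a \<open>1 : 3\<close> rectangle away from \<open>1\<close>,
  so each annulus of ratio \<open>3\<close> independently blocks the arm with probability bounded below.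
\<close>

section \<open>Probability on finite cubes\<close>

text \<open>No single line \<open>x = a\<close> suffices, because the edges at the line are always
  examined. The Schramm-Steif bound is therefore kept in a form whose left side, the squared weight
  of a level, does not depend on \<open>a\<close>. It is summed over all \<open>a\<close>, and only
  then divided by the weight; deterministic explorations so do the work of a randomised algorithm.
  Cesaro means tend to \<open>0\<close> as soon as the one-arm probabilities do, so no rate is asked
  of percolation and constants such as \<open>1 / 2 ^ 63\<close> may be wasteful.

  Planarity enters through one fact, \<open>lattice_crossing\<close>: a left-right and a bottom-top
  lattice path in the same box share a vertex. In the doubled lattice it makes a crossing and a dual
  crossing exclude each other, which gives \<open>1/2\<close>; in the primal lattice it is applied
  to paths prolonged through an explored cluster and its mirror image. Dual crossings are expressed
  as missing primal crossings, so the events to which Harris' inequality is applied are decreasing,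
  hence \<open>antimono\<close>.\<close>

definition avg :: "'e set \<Rightarrow> ('e set \<Rightarrow> real) \<Rightarrow> real" where
  "avg E f = (\<Sum>\<omega>\<in>Pow E. f \<omega>) / 2 ^ card E"

definition Pr :: "'e set \<Rightarrow> ('e set \<Rightarrow> bool) \<Rightarrow> real" where
  "Pr E A = avg E (\<lambda>\<omega>. of_bool (A \<omega>))"

text \<open>The quantifier ranges over all \<open>\<omega>\<close>, not over subsets of one edge
  set, so that an event can be measured in edge sets of different sizes
  (\<open>Pr_restrict\<close>).\<close>

definition depends_on :: "('e set \<Rightarrow> bool) \<Rightarrow> 'e set \<Rightarrow> bool" where
  "depends_on A F \<longleftrightarrow> (\<forall>\<omega>. A (\<omega> \<inter> F) = A \<omega>)"

lemma avg_cong: "(\<And>\<omega>. \<omega> \<subseteq> E \<Longrightarrow> f \<omega> = g \<omega>) \<Longrightarrow> avg E f = avg E g"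
  unfolding avg_def by (metis (no_types, lifting) PowD sum.cong)

lemma avg_mono: "(\<And>\<omega>. \<omega> \<subseteq> E \<Longrightarrow> f \<omega> \<le> g \<omega>) \<Longrightarrow> avg E f \<le> avg E g"
  unfolding avg_def by (intro divide_right_mono sum_mono) auto

lemma avg_add: "avg E (\<lambda>\<omega>. f \<omega> + g \<omega>) = avg E f + avg E g"
  unfolding avg_def by (simp add: sum.distrib add_divide_distrib)

lemma avg_diff: "avg E (\<lambda>\<omega>. f \<omega> - g \<omega>) = avg E f - avg E g"
  unfolding avg_def by (simp add: sum_subtractf diff_divide_distrib)

lemma avg_cmult: "avg E (\<lambda>\<omega>. c * f \<omega>) = c * avg E f"
  unfolding avg_def by (simp add: sum_distrib_left)

lemma avg_sum: "avg E (\<lambda>\<omega>. \<Sum>i\<in>I. f i \<omega>) = (\<Sum>i\<in>I. avg E (f i))"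
  unfolding avg_def by (subst sum.swap) (simp add: sum_divide_distrib)

lemma avg_const: "finite E \<Longrightarrow> avg E (\<lambda>_. c) = c"
  unfolding avg_def by (simp add: card_Pow)

lemma avg_nonneg: "(\<And>\<omega>. \<omega> \<subseteq> E \<Longrightarrow> 0 \<le> f \<omega>) \<Longrightarrow> 0 \<le> avg E f"
  unfolding avg_def by (auto intro!: divide_nonneg_nonneg sum_nonneg)

lemma avg_Cauchy_Schwarz: "(avg E (\<lambda>\<omega>. f \<omega> * g \<omega>))\<^sup>2 \<le> avg E (\<lambda>\<omega>. (f \<omega>)\<^sup>2) * avg E (\<lambda>\<omega>. (g \<omega>)\<^sup>2)"
proof -
  have "(\<Sum>\<omega>\<in>Pow E. f \<omega> * g \<omega>)\<^sup>2 / (2 ^ card E * 2 ^ card E)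
      \<le> (\<Sum>\<omega>\<in>Pow E. (f \<omega>)\<^sup>2) * (\<Sum>\<omega>\<in>Pow E. (g \<omega>)\<^sup>2) / (2 ^ card E * 2 ^ card E)"
    by (intro divide_right_mono Cauchy_Schwarz_ineq_sum) auto
  then show ?thesis
    unfolding avg_def by (simp add: power_divide power2_eq_square)
qed

lemma Pr_nonneg: "0 \<le> Pr E A"
  unfolding Pr_def by (rule avg_nonneg) auto

lemma Pr_mono: "(\<And>\<omega>. \<omega> \<subseteq> E \<Longrightarrow> A \<omega> \<Longrightarrow> B \<omega>) \<Longrightarrow> Pr E A \<le> Pr E B"
  unfolding Pr_def by (rule avg_mono) (auto simp: of_bool_def)

lemma Pr_cong: "(\<And>\<omega>. \<omega> \<subseteq> E \<Longrightarrow> A \<omega> = B \<omega>) \<Longrightarrow> Pr E A = Pr E B"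
  by (intro antisym Pr_mono) auto

lemma Pr_le_1: "finite E \<Longrightarrow> Pr E A \<le> 1"
  unfolding Pr_def using avg_mono[of E "\<lambda>\<omega>. of_bool (A \<omega>)" "\<lambda>_. 1"] by (simp add: avg_const)

lemma Pr_not: "finite E \<Longrightarrow> Pr E (\<lambda>\<omega>. \<not> A \<omega>) = 1 - Pr E A"
  unfolding Pr_def by (subst avg_const[symmetric, of E 1], simp, subst avg_diff[symmetric])
    (auto intro!: avg_cong)

lemma Pr_disj_le: "Pr E (\<lambda>\<omega>. A \<omega> \<or> B \<omega>) \<le> Pr E A + Pr E B"
  unfolding Pr_def avg_add[symmetric] by (rule avg_mono) auto

lemma Pr_bij:
  assumes "bij_betw f E E'"
  shows "Pr E' A = Pr E (\<lambda>\<omega>. A (f ` \<omega>))"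
proof -
  have "bij_betw ((`) f) (Pow E) (Pow E')" by (rule bij_betw_Pow[OF assms])
  from sum.reindex_bij_betw[OF this, of "\<lambda>\<omega>. of_bool (A \<omega>) :: real"] show ?thesis
    unfolding Pr_def avg_def using bij_betw_same_card[OF assms] by simp
qed

lemma Pr_compl: "Pr E (\<lambda>\<omega>. A (E - \<omega>)) = Pr E A"
proof -
  have "(\<Sum>\<omega>\<in>Pow E. of_bool (A (E - \<omega>)) :: real) = (\<Sum>\<omega>\<in>Pow E. of_bool (A \<omega>))"
    by (rule sum.reindex_bij_witness[of _ "\<lambda>\<omega>. E - \<omega>" "\<lambda>\<omega>. E - \<omega>"]) (auto simp: double_diff)
  then show ?thesis unfolding Pr_def avg_def by simp
qed

text \<open>Fubini for the uniform measure: a subset of \<open>E\<close> is a free choice of its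
  parts in \<open>F\<close> and in \<open>E - F\<close>.\<close>

lemma avg_mult_disjoint:
  assumes "finite E" "F \<subseteq> E"
  shows "avg E (\<lambda>\<omega>. f (\<omega> \<inter> F) * g (\<omega> - F)) = avg F f * avg (E - F) g"
proof -
  have "(\<Sum>\<omega>\<in>Pow E. f (\<omega> \<inter> F) * g (\<omega> - F)) = (\<Sum>(a, b)\<in>Pow F \<times> Pow (E - F). f a * g b)"
    by (rule sum.reindex_bij_witness[of _ "\<lambda>(a, b). a \<union> b" "\<lambda>\<omega>. (\<omega> \<inter> F, \<omega> - F)"])
      (use assms in \<open>auto intro!: arg_cong2[where f = "(*)"] arg_cong[of _ _ f] arg_cong[of _ _ g]\<close>)
  also have "\<dots> = (\<Sum>a\<in>Pow F. f a) * (\<Sum>b\<in>Pow (E - F). g b)"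
    by (simp add: sum_product sum.cartesian_product)
  finally have "(\<Sum>\<omega>\<in>Pow E. f (\<omega> \<inter> F) * g (\<omega> - F)) = (\<Sum>a\<in>Pow F. f a) * (\<Sum>b\<in>Pow (E - F). g b)" .
  moreover have "card E = card F + card (E - F)"
    using assms by (metis card_Un_disjoint Diff_disjoint Diff_partition finite_Diff finite_subset)
  ultimately show ?thesis unfolding avg_def by (simp add: power_add)
qed

lemma Pr_restrict:
  assumes "finite E" "F \<subseteq> E" "depends_on A F"
  shows "Pr E A = Pr F A"
proof -
  have "Pr E A = avg E (\<lambda>\<omega>. of_bool (A (\<omega> \<inter> F)) * 1)"
    using assms unfolding Pr_def depends_on_def by simp
  also have "\<dots> = Pr F A"
    using assms(1,2) unfolding Pr_def
    by (subst avg_mult_disjoint) (auto simp: avg_const)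
  finally show ?thesis .
qed

lemma Pr_indep:
  assumes fin: "finite E" and A: "depends_on A F" and B: "depends_on B G" and FG: "F \<inter> G = {}"
  shows "Pr E (\<lambda>\<omega>. A \<omega> \<and> B \<omega>) = Pr E A * Pr E B"
proof -
  \<comment> \<open>\<open>F\<close> and \<open>G\<close> need not lie in \<open>E\<close>. Removing
    \<open>F \<inter> E\<close> from a configuration in \<open>E\<close> removes nothing from
    \<open>G\<close>.\<close>
  define F' where "F' = F \<inter> E"
  have A1: "A \<omega> = A (\<omega> \<inter> F')" and B1: "B \<omega> = B (\<omega> - F')" if "\<omega> \<subseteq> E" for \<omega>
  proof -
    have "\<omega> \<inter> F' = \<omega> \<inter> F" "(\<omega> - F') \<inter> G = \<omega> \<inter> G" using that FG unfolding F'_def by auto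
    then show "A \<omega> = A (\<omega> \<inter> F')" "B \<omega> = B (\<omega> - F')" using A B unfolding depends_on_def by metis+
  qed
  have F': "F' \<subseteq> E" unfolding F'_def by auto
  have "Pr E (\<lambda>\<omega>. A \<omega> \<and> B \<omega>) = avg E (\<lambda>\<omega>. of_bool (A (\<omega> \<inter> F')) * of_bool (B (\<omega> - F')))"
    unfolding Pr_def using A1 B1 by (intro avg_cong) auto
  also have "\<dots> = avg F' (\<lambda>\<omega>. of_bool (A \<omega>)) * avg (E - F') (\<lambda>\<omega>. of_bool (B \<omega>))"
    by (rule avg_mult_disjoint[OF fin F'])
  also have "avg F' (\<lambda>\<omega>. of_bool (A \<omega>)) = Pr E A"
    using avg_mult_disjoint[OF fin F', of "\<lambda>\<omega>. of_bool (A \<omega>)" "\<lambda>_. 1"] A1 fin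
    unfolding Pr_def by (simp add: avg_const cong: avg_cong)
  also have "avg (E - F') (\<lambda>\<omega>. of_bool (B \<omega>)) = Pr E B"
    using avg_mult_disjoint[OF fin F', of "\<lambda>_. 1" "\<lambda>\<omega>. of_bool (B \<omega>)"] B1 fin F' finite_subset[OF F' fin]
    unfolding Pr_def by (simp add: avg_const cong: avg_cong)
  finally show ?thesis .
qed

lemma sum_Pow_insert:
  assumes "finite E" "e \<notin> E"
  shows "(\<Sum>\<omega>\<in>Pow (insert e E). f \<omega>) = (\<Sum>\<omega>\<in>Pow E. f \<omega>) + (\<Sum>\<omega>\<in>Pow E. f (insert e \<omega>))"
proof -
  have "inj_on (insert e) (Pow E)" using assms by (auto simp: inj_on_def)
  then show ?thesis
    unfolding Pow_insert using assms
    by (subst sum.union_disjoint) (auto simp: sum.reindex)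
qed

text \<open>Induction on the coordinates. \<open>f0\<close>, \<open>f1\<close> and
  \<open>g0\<close>, \<open>g1\<close> are the sums over the two halves of the cube; the new
  coordinate is handled by Chebyshev's inequality \<open>0 \<le> (f0 - f1) * (g0 - g1)\<close>, each
  half by the induction hypothesis.\<close>

lemma Harris_sum:
  fixes f g :: "'e set \<Rightarrow> real"
  assumes "finite E" "antimono f" "antimono g"
  shows "(\<Sum>\<omega>\<in>Pow E. f \<omega>) * (\<Sum>\<omega>\<in>Pow E. g \<omega>) \<le> 2 ^ card E * (\<Sum>\<omega>\<in>Pow E. f \<omega> * g \<omega>)"
  using assms
proof (induction E arbitrary: f g rule: finite_induct)
  case (insert e E)
  define f0 f1 g0 g1 where "f0 = (\<Sum>\<omega>\<in>Pow E. f \<omega>)" "f1 = (\<Sum>\<omega>\<in>Pow E. f (insert e \<omega>))"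
    "g0 = (\<Sum>\<omega>\<in>Pow E. g \<omega>)" "g1 = (\<Sum>\<omega>\<in>Pow E. g (insert e \<omega>))"
  note d = this
  have am: "antimono (\<lambda>\<omega>. f (insert e \<omega>))" "antimono (\<lambda>\<omega>. g (insert e \<omega>))"
    using insert.prems by (auto intro!: antimonoI antimonoD[of f] antimonoD[of g] insert_mono)
  have "f1 \<le> f0" "g1 \<le> g0"
    unfolding d by (intro sum_mono antimonoD[OF insert.prems(1)] antimonoD[OF insert.prems(2)] subset_insertI)+
  then have "0 \<le> (f0 - f1) * (g0 - g1)" by simp
  then have "(f0 + f1) * (g0 + g1) \<le> 2 * (f0 * g0 + f1 * g1)" by (simp add: algebra_simps)
  also have "\<dots> \<le> 2 * (2 ^ card E * (\<Sum>\<omega>\<in>Pow E. f \<omega> * g \<omega>)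
      + 2 ^ card E * (\<Sum>\<omega>\<in>Pow E. f (insert e \<omega>) * g (insert e \<omega>)))"
    using insert.IH[OF insert.prems] insert.IH[OF am] unfolding d by simp
  finally show ?case
    using insert.hyps unfolding d by (simp add: sum_Pow_insert algebra_simps)
qed simp

lemma Harris:
  assumes "finite E" "antimono A" "antimono B"
  shows "Pr E A * Pr E B \<le> Pr E (\<lambda>\<omega>. A \<omega> \<and> B \<omega>)"
proof -
  have "antimono (\<lambda>\<omega>. of_bool (A \<omega>) :: real)" "antimono (\<lambda>\<omega>. of_bool (B \<omega>) :: real)"
    using assms(2,3) unfolding antimono_def by auto
  from Harris_sum[OF assms(1) this] show ?thesis
    unfolding Pr_def avg_def by (simp add: field_simps of_bool_conj)
qed

text \<open>Stands in for conditional probability: \<open>X\<close> will be an explored cluster, and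
  a bound valid given each admissible value \<open>k\<close> is summed over the values.\<close>

lemma Pr_partition_ge:
  assumes fin: "finite E" and c: "0 \<le> c"
    and le: "\<And>k. G k \<Longrightarrow> c * Pr E (\<lambda>\<omega>. X \<omega> = k) \<le> Pr E (\<lambda>\<omega>. X \<omega> = k \<and> Q k \<omega>)"
  shows "c * Pr E (\<lambda>\<omega>. G (X \<omega>)) \<le> Pr E (\<lambda>\<omega>. G (X \<omega>) \<and> Q (X \<omega>) \<omega>)"
proof -
  define I where "I = {k \<in> X ` Pow E. G k}"
  have finI: "finite I" unfolding I_def using fin by auto
  have s: "avg E (\<lambda>\<omega>. of_bool (G (X \<omega>) \<and> P (X \<omega>) \<omega>)) = (\<Sum>k\<in>I. avg E (\<lambda>\<omega>. of_bool (X \<omega> = k \<and> P k \<omega>)))" for P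
  proof -
    have "(of_bool (G (X \<omega>) \<and> P (X \<omega>) \<omega>) :: real) = (\<Sum>k\<in>I. of_bool (X \<omega> = k \<and> P k \<omega>))" if "\<omega> \<subseteq> E" for \<omega>
    proof (cases "G (X \<omega>)")
      case True
      have "(\<Sum>k\<in>I. of_bool (X \<omega> = k \<and> P k \<omega>)) = (\<Sum>k\<in>{X \<omega>}. of_bool (X \<omega> = k \<and> P k \<omega>) :: real)"
        using True that finI by (intro sum.mono_neutral_right) (auto simp: I_def)
      then show ?thesis using True by simp
    next
      case False
      then have "(\<Sum>k\<in>I. of_bool (X \<omega> = k \<and> P k \<omega>)) = (0 :: real)"
        by (intro sum.neutral) (auto simp: I_def)
      then show ?thesis using False by simp
    qed
    then show ?thesis by (simp add: avg_sum[symmetric] cong: avg_cong)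
  qed
  show ?thesis
    using s[of "\<lambda>_ _. True"] s[of Q] le unfolding Pr_def
    by (auto simp: sum_distrib_left I_def intro!: sum_mono)
qed

section \<open>Fourier analysis\<close>

definition chi :: "'e set \<Rightarrow> 'e set \<Rightarrow> real" where
  "chi S \<omega> = (- 1) ^ card (S \<inter> \<omega>)"

definition coef :: "'e set \<Rightarrow> ('e set \<Rightarrow> real) \<Rightarrow> 'e set \<Rightarrow> real" where
  "coef E f S = avg E (\<lambda>\<omega>. f \<omega> * chi S \<omega>)"

lemma chi_empty [simp]: "chi {} \<omega> = 1" unfolding chi_def by simp

text \<open>Frequencies and configurations are both subsets of \<open>E\<close>, so orthogonality in
  one argument is orthogonality in the other; \<open>fourier_inversion\<close> rests on
  this.\<close>

lemma chi_commute: "chi S \<omega> = chi \<omega> S" unfolding chi_def by (simp add: Int_commute)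

lemma chi_flip:
  assumes "finite S" "i \<in> S"
  shows "chi S (sym_diff \<omega> {i}) = - chi S \<omega>"
proof (cases "i \<in> \<omega>")
  case True
  then have "S \<inter> \<omega> = insert i (S \<inter> sym_diff \<omega> {i})" "i \<notin> S \<inter> sym_diff \<omega> {i}" using assms by auto
  then have "card (S \<inter> \<omega>) = Suc (card (S \<inter> sym_diff \<omega> {i}))" using assms by (metis card_insert_disjoint finite_Int)
  then show ?thesis unfolding chi_def by simp
next
  case False
  then have "S \<inter> sym_diff \<omega> {i} = insert i (S \<inter> \<omega>)" using assms by auto
  then have "card (S \<inter> sym_diff \<omega> {i}) = Suc (card (S \<inter> \<omega>))" using assms False by simp
  then show ?thesis unfolding chi_def by simp
qed

lemma chi_mult:
  assumes "finite S" "finite T"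
  shows "chi S \<omega> * chi T \<omega> = chi (sym_diff S T) \<omega>"
proof -
  have "card (S \<inter> \<omega>) = card ((S - T) \<inter> \<omega>) + card (S \<inter> T \<inter> \<omega>)"
    using assms by (subst card_Un_disjoint[symmetric]) (auto intro!: arg_cong[of _ _ card])
  moreover have "card (T \<inter> \<omega>) = card ((T - S) \<inter> \<omega>) + card (S \<inter> T \<inter> \<omega>)"
    using assms by (subst card_Un_disjoint[symmetric]) (auto intro!: arg_cong[of _ _ card])
  moreover have "card (sym_diff S T \<inter> \<omega>) = card ((S - T) \<inter> \<omega>) + card ((T - S) \<inter> \<omega>)"
    using assms by (subst card_Un_disjoint[symmetric]) (auto intro!: arg_cong[of _ _ card])
  ultimately have "card (S \<inter> \<omega>) + card (T \<inter> \<omega>) = card (sym_diff S T \<inter> \<omega>) + 2 * card (S \<inter> T \<inter> \<omega>)" by simp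
  then have "(- 1 :: real) ^ (card (S \<inter> \<omega>) + card (T \<inter> \<omega>)) = (- 1) ^ (card (sym_diff S T \<inter> \<omega>) + 2 * card (S \<inter> T \<inter> \<omega>))"
    by simp
  then show ?thesis unfolding chi_def power_add by simp
qed

definition determined :: "'e set \<Rightarrow> ('e set \<Rightarrow> 'e set) \<Rightarrow> ('e set \<Rightarrow> 'b) \<Rightarrow> bool" where
  "determined E J u \<longleftrightarrow> (\<forall>\<omega> \<omega>'. \<omega> \<subseteq> E \<longrightarrow> \<omega>' \<subseteq> E \<longrightarrow> \<omega> \<inter> J \<omega> = \<omega>' \<inter> J \<omega> \<longrightarrow> u \<omega>' = u \<omega>)"

text \<open>\<open>determined E J J\<close> says that \<open>J\<close> is a stopping set: it can be explored without looking at
  any coordinate outside it.\<close>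

lemma avg_chi_not_subset:
  assumes fin: "finite E" and S: "S \<subseteq> E" and J: "determined E J J" and u: "determined E J u"
  shows "avg E (\<lambda>\<omega>. of_bool (\<not> S \<subseteq> J \<omega>) * u \<omega> * chi S \<omega>) = 0"
proof -
  define h where "h \<omega> = of_bool (\<not> S \<subseteq> J \<omega>) * u \<omega> * chi S \<omega>" for \<omega>
  \<comment> \<open>Flip some unexplored coordinate of \<open>S\<close>. \<open>J\<close> and
    \<open>u\<close> do not change, so the same coordinate is chosen again and \<open>\<phi>\<close>
    is an involution. The character changes sign, so the sum equals its own negative.\<close>
  define \<phi> where "\<phi> \<omega> = (if S \<subseteq> J \<omega> then \<omega> else sym_diff \<omega> {SOME i. i \<in> S - J \<omega>})" for \<omega>
  have *: "\<phi> \<omega> \<subseteq> E \<and> J (\<phi> \<omega>) = J \<omega> \<and> \<phi> (\<phi> \<omega>) = \<omega> \<and> h (\<phi> \<omega>) = - h \<omega>" if \<omega>: "\<omega> \<subseteq> E" for \<omega>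
  proof (cases "S \<subseteq> J \<omega>")
    case True
    then show ?thesis using \<omega> unfolding \<phi>_def h_def by simp
  next
    case False
    define i where "i = (SOME i. i \<in> S - J \<omega>)"
    have "\<exists>i. i \<in> S - J \<omega>" using False by auto
    then have i: "i \<in> S - J \<omega>" unfolding i_def by (rule someI_ex)
    have \<phi>: "\<phi> \<omega> = sym_diff \<omega> {i}" unfolding \<phi>_def i_def using False by simp
    have sub: "\<phi> \<omega> \<subseteq> E" unfolding \<phi> using i S \<omega> by auto
    have "\<omega> \<inter> J \<omega> = \<phi> \<omega> \<inter> J \<omega>" unfolding \<phi> using i by auto
    then have J': "J (\<phi> \<omega>) = J \<omega>" and u': "u (\<phi> \<omega>) = u \<omega>"
      using J u \<omega> sub unfolding determined_def by blast+
    have "\<phi> (\<phi> \<omega>) = sym_diff (\<phi> \<omega>) {i}" using False J' unfolding \<phi>_def[of "\<phi> \<omega>"] i_def by simp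
    also have "\<dots> = \<omega>" unfolding \<phi> by auto
    finally have "\<phi> (\<phi> \<omega>) = \<omega>" .
    moreover have "chi S (\<phi> \<omega>) = - chi S \<omega>"
      unfolding \<phi> using i S fin by (intro chi_flip) (auto intro: finite_subset)
    ultimately show ?thesis using sub J' u' unfolding h_def by simp
  qed
  have "(\<Sum>\<omega>\<in>Pow E. h \<omega>) = (\<Sum>\<omega>\<in>Pow E. - h \<omega>)"
    by (rule sum.reindex_bij_witness[of _ \<phi> \<phi>]) (use * in auto)
  then have "(\<Sum>\<omega>\<in>Pow E. h \<omega>) = 0" by (simp add: sum_negf)
  then show ?thesis unfolding avg_def h_def by simp
qed

text \<open>Configurations in which \<open>sym_diff S T\<close> is not fully explored contribute
  nothing, by \<open>avg_chi_not_subset\<close>. Scalar products are evaluated below by exchanging a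
  coefficient \<open>P\<close> for a \<open>Q\<close> that agrees with it on the other
  configurations. An empty \<open>J\<close> gives plain orthogonality.\<close>

lemma avg_chi_chi_cong:
  assumes fin: "finite E" and S: "S \<subseteq> E" "T \<subseteq> E" and J: "determined E J J"
    and P: "determined E J P" and Q: "determined E J Q"
    and eq: "\<And>\<omega>. \<omega> \<subseteq> E \<Longrightarrow> sym_diff S T \<subseteq> J \<omega> \<Longrightarrow> P \<omega> = Q \<omega>"
  shows "avg E (\<lambda>\<omega>. P \<omega> * (chi S \<omega> * chi T \<omega>)) = avg E (\<lambda>\<omega>. Q \<omega> * (chi S \<omega> * chi T \<omega>))"
proof -
  have d: "determined E J (\<lambda>\<omega>. P \<omega> - Q \<omega>)"
    using P Q unfolding determined_def by metis
  have "avg E (\<lambda>\<omega>. P \<omega> * (chi S \<omega> * chi T \<omega>)) - avg E (\<lambda>\<omega>. Q \<omega> * (chi S \<omega> * chi T \<omega>))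
      = avg E (\<lambda>\<omega>. of_bool (\<not> sym_diff S T \<subseteq> J \<omega>) * (P \<omega> - Q \<omega>) * chi (sym_diff S T) \<omega>)"
    unfolding avg_diff[symmetric]
  proof (rule avg_cong)
    fix \<omega> assume "\<omega> \<subseteq> E"
    have c: "chi (sym_diff S T) \<omega> = chi S \<omega> * chi T \<omega>"
      using S fin by (intro chi_mult[symmetric]) (auto intro: finite_subset)
    show "P \<omega> * (chi S \<omega> * chi T \<omega>) - Q \<omega> * (chi S \<omega> * chi T \<omega>) =
      of_bool (\<not> sym_diff S T \<subseteq> J \<omega>) * (P \<omega> - Q \<omega>) * chi (sym_diff S T) \<omega>"
      unfolding c using eq[OF \<open>\<omega> \<subseteq> E\<close>] by (cases "sym_diff S T \<subseteq> J \<omega>") (auto simp: algebra_simps)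
  qed
  also have "\<dots> = 0" using S by (intro avg_chi_not_subset[OF fin _ J d]) auto
  finally show ?thesis by simp
qed

lemma avg_chi_chi:
  assumes fin: "finite E" and S: "S \<subseteq> E" "T \<subseteq> E"
  shows "avg E (\<lambda>\<omega>. chi S \<omega> * chi T \<omega>) = of_bool (S = T)"
proof (cases "S = T")
  case True
  then show ?thesis unfolding chi_def using fin by (simp add: avg_const power_add[symmetric] mult_2[symmetric])
next
  case False
  have d: "determined E (\<lambda>_. {}) (\<lambda>_. c)" for c :: real unfolding determined_def by simp
  have J: "determined E (\<lambda>_. {}) (\<lambda>_. {})" unfolding determined_def by simp
  have "avg E (\<lambda>\<omega>. 1 * (chi S \<omega> * chi T \<omega>)) = avg E (\<lambda>\<omega>. 0 * (chi S \<omega> * chi T \<omega>))"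
    by (rule avg_chi_chi_cong[OF fin S J d d]) (use False in auto)
  then show ?thesis using False fin by (simp add: avg_const)
qed

lemma avg_sum_mult_sum:
  "avg E (\<lambda>\<omega>. (\<Sum>S\<in>L. P S \<omega> * c S * chi S \<omega>) * (\<Sum>T\<in>L. Q T \<omega> * c T * chi T \<omega>)) =
    (\<Sum>S\<in>L. \<Sum>T\<in>L. c S * c T * avg E (\<lambda>\<omega>. (P S \<omega> * Q T \<omega>) * (chi S \<omega> * chi T \<omega>)))"
  unfolding sum_product avg_sum avg_cmult[symmetric]
  by (intro sum.cong avg_cong refl) (simp add: algebra_simps)

text \<open>The inequality of Schramm and Steif. Conditioning on the explored coordinates turns the
  level-\<open>k\<close> part \<open>g\<close> of \<open>f\<close> into \<open>h1\<close>, and the part \<open>h2\<close> of \<open>g\<close> living off \<open>J\<close> is orthogonal to \<open>h1\<close>.\<close>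

lemma level_weight_le:
  assumes fin: "finite E" and k: "k \<ge> 1" and J: "determined E J J" and f: "determined E J f"
    and f1: "\<And>\<omega>. \<omega> \<subseteq> E \<Longrightarrow> \<bar>f \<omega>\<bar> \<le> 1"
  defines "L \<equiv> {S. S \<subseteq> E \<and> card S = k}"
  shows "(\<Sum>S\<in>L. (coef E f S)\<^sup>2)\<^sup>2 \<le> (\<Sum>S\<in>L. (coef E f S)\<^sup>2 * Pr E (\<lambda>\<omega>. S \<inter> J \<omega> \<noteq> {}))"
proof -
  define c where "c = coef E f"
  define W where "W = (\<Sum>S\<in>L. (c S)\<^sup>2)"
  define g where "g \<omega> = (\<Sum>S\<in>L. 1 * c S * chi S \<omega>)" for \<omega>
  define h1 where "h1 \<omega> = (\<Sum>S\<in>L. of_bool (S \<subseteq> J \<omega>) * c S * chi S \<omega>)" for \<omega>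
  define h2 where "h2 \<omega> = (\<Sum>S\<in>L. of_bool (S \<inter> J \<omega> = {}) * c S * chi S \<omega>)" for \<omega>
  have LE: "S \<subseteq> E" "card S = k" "finite S" "S \<noteq> {}" if "S \<in> L" for S
    using that fin k unfolding L_def by (auto intro: finite_subset)
  have finL: "finite L" unfolding L_def using fin by auto
  have det: "determined E J (\<lambda>\<omega>. F (J \<omega>))" for F :: "_ \<Rightarrow> real"
    using J unfolding determined_def by metis
  define w2 where "w2 = (\<Sum>S\<in>L. (c S)\<^sup>2 * Pr E (\<lambda>\<omega>. S \<inter> J \<omega> = {}))"
  have diag: "(\<Sum>S\<in>L. \<Sum>T\<in>L. c S * c T * avg E (\<lambda>\<omega>. of_bool (S = T \<and> S \<inter> J \<omega> = {}) * (chi S \<omega> * chi T \<omega>))) = w2"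
  proof -
    have "c S * c T * avg E (\<lambda>\<omega>. of_bool (S = T \<and> S \<inter> J \<omega> = {}) * (chi S \<omega> * chi T \<omega>))
       = (if S = T then (c S)\<^sup>2 * Pr E (\<lambda>\<omega>. S \<inter> J \<omega> = {}) else 0)" if "S \<in> L" "T \<in> L" for S T
    proof (cases "S = T")
      case True
      have "chi S \<omega> * chi S \<omega> = 1" for \<omega> unfolding chi_def by (simp add: power_add[symmetric] mult_2[symmetric])
      then show ?thesis using True unfolding Pr_def by (simp add: power2_eq_square)
    next
      case False
      then show ?thesis using fin by (simp add: avg_const)
    qed
    then show ?thesis unfolding w2_def using finL by simp
  qed
  have gg: "avg E (\<lambda>\<omega>. g \<omega> * g \<omega>) = W"
  proof -
    have "avg E (\<lambda>\<omega>. g \<omega> * g \<omega>) = (\<Sum>S\<in>L. \<Sum>T\<in>L. c S * c T * of_bool (S = T))"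
      unfolding g_def avg_sum_mult_sum using LE by (auto intro!: sum.cong simp: avg_chi_chi[OF fin])
    also have "\<dots> = (\<Sum>S\<in>L. \<Sum>T\<in>L. if S = T then (c S)\<^sup>2 else 0)"
      by (intro sum.cong) (auto simp: power2_eq_square)
    finally show ?thesis unfolding W_def using finL by simp
  qed
  have key: "avg E (\<lambda>\<omega>. P (J \<omega>) * (chi S \<omega> * chi T \<omega>)) = avg E (\<lambda>\<omega>. Q (J \<omega>) * (chi S \<omega> * chi T \<omega>))"
    if "S \<in> L" "T \<in> L" "\<And>X. sym_diff S T \<subseteq> X \<Longrightarrow> P X = Q X" for S T and P Q :: "_ \<Rightarrow> real"
    using LE that by (intro avg_chi_chi_cong[OF fin _ _ J det det]) simp_all
  \<comment> \<open>If \<open>sym_diff S T\<close> and \<open>T\<close> are explored then so is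
    \<open>S\<close>: \<open>h1\<close> behaves like an orthogonal projection of
    \<open>g\<close>.\<close>
  have gh1: "avg E (\<lambda>\<omega>. g \<omega> * h1 \<omega>) = avg E (\<lambda>\<omega>. h1 \<omega> * h1 \<omega>)"
    unfolding g_def h1_def avg_sum_mult_sum
  proof (intro sum.cong refl arg_cong2[where f = "(*)"])
    fix S T assume ST: "S \<in> L" "T \<in> L"
    have "S \<subseteq> X" if "sym_diff S T \<subseteq> X" "T \<subseteq> X" for X using that by blast
    then show "avg E (\<lambda>\<omega>. 1 * of_bool (T \<subseteq> J \<omega>) * (chi S \<omega> * chi T \<omega>))
      = avg E (\<lambda>\<omega>. of_bool (S \<subseteq> J \<omega>) * of_bool (T \<subseteq> J \<omega>) * (chi S \<omega> * chi T \<omega>))"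
      by (intro key[OF ST, of "\<lambda>X. 1 * of_bool (T \<subseteq> X)" "\<lambda>X. of_bool (S \<subseteq> X) * of_bool (T \<subseteq> X)"]) auto
  qed
  have gh2: "avg E (\<lambda>\<omega>. g \<omega> * h2 \<omega>) = w2"
    unfolding g_def h2_def avg_sum_mult_sum diag[symmetric]
  proof (intro sum.cong refl arg_cong2[where f = "(*)"])
    fix S T assume ST: "S \<in> L" "T \<in> L"
    have "S = T" if "sym_diff S T \<subseteq> X" "T \<inter> X = {}" for X
    proof -
      \<comment> \<open>A point of \<open>T\<close> outside \<open>S\<close> would lie in
        \<open>X\<close>. Equality follows since all sets in \<open>L\<close> have size
        \<open>k\<close>; this is why one level is treated at a time.\<close>
      have "T \<subseteq> S" using that by blast
      then show ?thesis using card_subset_eq[of S T] LE[OF ST(1)] LE[OF ST(2)] by simp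
    qed
    then show "avg E (\<lambda>\<omega>. 1 * of_bool (T \<inter> J \<omega> = {}) * (chi S \<omega> * chi T \<omega>))
      = avg E (\<lambda>\<omega>. of_bool (S = T \<and> S \<inter> J \<omega> = {}) * (chi S \<omega> * chi T \<omega>))"
      by (intro key[OF ST, of "\<lambda>X. 1 * of_bool (T \<inter> X = {})" "\<lambda>X. of_bool (S = T \<and> S \<inter> X = {})"]) auto
  qed
  have h22: "avg E (\<lambda>\<omega>. h2 \<omega> * h2 \<omega>) = w2"
    unfolding h2_def avg_sum_mult_sum diag[symmetric]
  proof (intro sum.cong refl arg_cong2[where f = "(*)"])
    fix S T assume ST: "S \<in> L" "T \<in> L"
    have "S = T" if "sym_diff S T \<subseteq> X" "S \<inter> X = {}" "T \<inter> X = {}" for X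
      using that by blast
    then show "avg E (\<lambda>\<omega>. of_bool (S \<inter> J \<omega> = {}) * of_bool (T \<inter> J \<omega> = {}) * (chi S \<omega> * chi T \<omega>))
      = avg E (\<lambda>\<omega>. of_bool (S = T \<and> S \<inter> J \<omega> = {}) * (chi S \<omega> * chi T \<omega>))"
      by (intro key[OF ST, of "\<lambda>X. of_bool (S \<inter> X = {}) * of_bool (T \<inter> X = {})" "\<lambda>X. of_bool (S = T \<and> S \<inter> X = {})"]) auto
  qed
  have h12: "avg E (\<lambda>\<omega>. h1 \<omega> * h2 \<omega>) = 0"
  proof -
    have "avg E (\<lambda>\<omega>. h1 \<omega> * h2 \<omega>) = (\<Sum>S\<in>L. \<Sum>T\<in>L. c S * c T * avg E (\<lambda>\<omega>. 0 * (chi S \<omega> * chi T \<omega>)))"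
      unfolding h1_def h2_def avg_sum_mult_sum
    proof (intro sum.cong refl arg_cong2[where f = "(*)"])
      fix S T assume ST: "S \<in> L" "T \<in> L"
      \<comment> \<open>\<open>T\<close> would lie both inside and outside \<open>X\<close>, hence
        be empty, which \<open>k \<ge> 1\<close> excludes.\<close>
      have "False" if "sym_diff S T \<subseteq> X" "S \<subseteq> X" "T \<inter> X = {}" for X
        using that LE(4)[OF ST(2)] by blast
      then show "avg E (\<lambda>\<omega>. of_bool (S \<subseteq> J \<omega>) * of_bool (T \<inter> J \<omega> = {}) * (chi S \<omega> * chi T \<omega>))
        = avg E (\<lambda>\<omega>. 0 * (chi S \<omega> * chi T \<omega>))"
        by (intro key[OF ST, of "\<lambda>X. of_bool (S \<subseteq> X) * of_bool (T \<inter> X = {})" "\<lambda>_. 0"]) auto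
    qed
    then show ?thesis using fin by (simp add: avg_const)
  qed
  have fg: "avg E (\<lambda>\<omega>. f \<omega> * g \<omega>) = W"
    unfolding g_def W_def sum_distrib_left avg_sum
    by (intro sum.cong refl)
      (simp add: c_def coef_def power2_eq_square avg_cmult[symmetric] algebra_simps)
  \<comment> \<open>\<open>f\<close> is known from \<open>J\<close>, so it sees \<open>g\<close>
    only through the fully explored frequencies.\<close>
  have fh1: "avg E (\<lambda>\<omega>. f \<omega> * h1 \<omega>) = W"
    unfolding fg[symmetric] g_def h1_def sum_distrib_left avg_sum
  proof (intro sum.cong refl)
    fix S assume S: "S \<in> L"
    have d: "determined E J (\<lambda>\<omega>. f \<omega> * c S * of_bool (S \<subseteq> J \<omega>))" "determined E J (\<lambda>\<omega>. f \<omega> * c S)"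
      using J f unfolding determined_def by metis+
    have "avg E (\<lambda>\<omega>. (f \<omega> * c S * of_bool (S \<subseteq> J \<omega>)) * (chi S \<omega> * chi {} \<omega>)) = avg E (\<lambda>\<omega>. (f \<omega> * c S) * (chi S \<omega> * chi {} \<omega>))"
      by (rule avg_chi_chi_cong[OF fin _ _ J d]) (use LE[OF S] in auto)
    then show "avg E (\<lambda>\<omega>. f \<omega> * (of_bool (S \<subseteq> J \<omega>) * c S * chi S \<omega>)) = avg E (\<lambda>\<omega>. f \<omega> * (1 * c S * chi S \<omega>))"
      by (simp add: algebra_simps)
  qed
  \<comment> \<open>Expanding this square bounds the squared norm of \<open>h1\<close> by
    \<open>W - w2\<close>. Without subtracting \<open>h2\<close> the bound would be
    \<open>W\<close>, and Cauchy-Schwarz would only give \<open>W \<le> 1\<close>.\<close>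
  have "0 \<le> avg E (\<lambda>\<omega>. (g \<omega> - h1 \<omega> - h2 \<omega>)\<^sup>2)" by (rule avg_nonneg) simp
  also have "\<dots> = avg E (\<lambda>\<omega>. g \<omega> * g \<omega> + h1 \<omega> * h1 \<omega> + h2 \<omega> * h2 \<omega> + 2 * (h1 \<omega> * h2 \<omega>)
      - 2 * (g \<omega> * h1 \<omega>) - 2 * (g \<omega> * h2 \<omega>))"
    by (rule avg_cong) (simp add: power2_eq_square algebra_simps)
  also have "\<dots> = W - avg E (\<lambda>\<omega>. h1 \<omega> * h1 \<omega>) - w2"
    by (simp add: avg_add avg_diff avg_cmult gg gh1 gh2 h22 h12)
  finally have h1W: "avg E (\<lambda>\<omega>. (h1 \<omega>)\<^sup>2) \<le> W - w2" by (simp add: power2_eq_square)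
  have "W\<^sup>2 \<le> avg E (\<lambda>\<omega>. (f \<omega>)\<^sup>2) * avg E (\<lambda>\<omega>. (h1 \<omega>)\<^sup>2)"
    using avg_Cauchy_Schwarz[of E f h1] fh1 by simp
  also have "\<dots> \<le> 1 * avg E (\<lambda>\<omega>. (h1 \<omega>)\<^sup>2)"
  proof (rule mult_right_mono)
    show "avg E (\<lambda>\<omega>. (f \<omega>)\<^sup>2) \<le> 1"
      using avg_mono[of E "\<lambda>\<omega>. (f \<omega>)\<^sup>2" "\<lambda>_. 1"] f1 fin by (simp add: avg_const abs_square_le_1)
  qed (simp add: avg_nonneg)
  also have "\<dots> \<le> W - w2" using h1W by simp
  also have "\<dots> = (\<Sum>S\<in>L. (c S)\<^sup>2 * Pr E (\<lambda>\<omega>. S \<inter> J \<omega> \<noteq> {}))"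
    unfolding W_def w2_def sum_subtractf[symmetric]
    by (intro sum.cong refl) (simp add: Pr_not[OF fin] algebra_simps)
  finally show ?thesis unfolding W_def c_def .
qed

section \<open>The noise operator in the Fourier basis\<close>

definition noise_op :: "'e set \<Rightarrow> real \<Rightarrow> ('e set \<Rightarrow> real) \<Rightarrow> 'e set \<Rightarrow> real" where
  "noise_op E \<epsilon> f \<omega> = (\<Sum>\<eta>\<in>Pow E. (\<Prod>e\<in>E. if (e \<in> \<omega>) = (e \<in> \<eta>) then 1 - \<epsilon> else \<epsilon>) * f \<eta>)"

lemma chi_prod: "finite E \<Longrightarrow> S \<subseteq> E \<Longrightarrow> chi S \<omega> = (\<Prod>e\<in>E. if e \<in> S \<and> e \<in> \<omega> then - 1 else 1)"
proof -
  assume a: "finite E" "S \<subseteq> E"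
  have "(\<Prod>e\<in>E. if e \<in> S \<and> e \<in> \<omega> then - 1 else (1::real)) = (\<Prod>e\<in>S \<inter> \<omega>. - 1)"
    by (rule prod.mono_neutral_cong_right) (use a in auto)
  then show ?thesis unfolding chi_def by simp
qed

text \<open>Transition weight and character are both products over coordinates, so the sum over
  \<open>\<eta>\<close> factorises by \<open>prod_add\<close>.\<close>

lemma noise_op_chi:
  assumes fin: "finite E" and S: "S \<subseteq> E"
  shows "noise_op E \<epsilon> (chi S) \<omega> = (1 - 2 * \<epsilon>) ^ card S * chi S \<omega>"
proof -
  \<comment> \<open>\<open>a e\<close> and \<open>b e\<close> are the factors of a coordinate that
    is open, respectively closed, in \<open>\<eta>\<close>.\<close>
  define a where "a e = (if e \<in> \<omega> then 1 - \<epsilon> else \<epsilon>) * (if e \<in> S then - 1 else 1)" for e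
  define b where "b e = (if e \<in> \<omega> then \<epsilon> else 1 - \<epsilon>)" for e
  have "noise_op E \<epsilon> (chi S) \<omega> = (\<Sum>\<eta>\<in>Pow E. (\<Prod>e\<in>\<eta>. a e) * (\<Prod>e\<in>E-\<eta>. b e))"
    unfolding noise_op_def
  proof (rule sum.cong[OF refl])
    fix \<eta> assume "\<eta> \<in> Pow E"
    then have \<eta>: "E = \<eta> \<union> (E - \<eta>)" "finite \<eta>" using fin by (auto intro: finite_subset)
    have "(\<Prod>e\<in>E. if (e \<in> \<omega>) = (e \<in> \<eta>) then 1 - \<epsilon> else \<epsilon>) * chi S \<eta>
      = (\<Prod>e\<in>E. (if (e \<in> \<omega>) = (e \<in> \<eta>) then 1 - \<epsilon> else \<epsilon>) * (if e \<in> S \<and> e \<in> \<eta> then - 1 else 1))"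
      unfolding chi_prod[OF fin S] by (simp add: prod.distrib)
    also have "\<dots> = (\<Prod>e\<in>E. if e \<in> \<eta> then a e else b e)"
      by (intro prod.cong) (auto simp: a_def b_def)
    also have "\<dots> = (\<Prod>e\<in>\<eta> \<union> (E - \<eta>). if e \<in> \<eta> then a e else b e)" using \<eta> by simp
    also have "\<dots> = (\<Prod>e\<in>\<eta>. a e) * (\<Prod>e\<in>E-\<eta>. b e)"
      using \<eta> fin by (subst prod.union_disjoint) (auto intro!: arg_cong2[where f = "(*)"] prod.cong)
    finally show "(\<Prod>e\<in>E. if (e \<in> \<omega>) = (e \<in> \<eta>) then 1 - \<epsilon> else \<epsilon>) * chi S \<eta> = (\<Prod>e\<in>\<eta>. a e) * (\<Prod>e\<in>E-\<eta>. b e)" .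
  qed
  also have "\<dots> = (\<Prod>e\<in>E. a e + b e)" by (rule prod_add[OF fin, symmetric])
  also have "\<dots> = (\<Prod>e\<in>E. (if e \<in> S then 1 - 2 * \<epsilon> else 1) * (if e \<in> S \<and> e \<in> \<omega> then - 1 else 1))"
    by (intro prod.cong) (auto simp: a_def b_def)
  also have "\<dots> = (\<Prod>e\<in>E. if e \<in> S then 1 - 2 * \<epsilon> else 1) * chi S \<omega>"
    unfolding chi_prod[OF fin S] by (simp add: prod.distrib)
  also have "(\<Prod>e\<in>E. if e \<in> S then 1 - 2 * \<epsilon> else 1) = (\<Prod>e\<in>S. 1 - 2 * \<epsilon>)"
    by (rule prod.mono_neutral_cong_right) (use fin S in auto)
  finally show ?thesis by simp
qed

lemma fourier_inversion:
  assumes fin: "finite E" and \<omega>: "\<omega> \<subseteq> E"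
  shows "f \<omega> = (\<Sum>S\<in>Pow E. coef E f S * chi S \<omega>)"
proof -
  have "(\<Sum>S\<in>Pow E. coef E f S * chi S \<omega>) = avg E (\<lambda>\<eta>. f \<eta> * (\<Sum>S\<in>Pow E. chi S \<eta> * chi S \<omega>))"
    unfolding coef_def sum_distrib_left avg_sum
    by (intro sum.cong refl) (simp add: avg_cmult[symmetric] mult_ac)
  also have "\<dots> = avg E (\<lambda>\<eta>. f \<eta> * (2 ^ card E * of_bool (\<eta> = \<omega>)))"
  proof (rule avg_cong)
    fix \<eta> assume "\<eta> \<subseteq> E"
    from avg_chi_chi[OF fin this \<omega>]
    have "(\<Sum>S\<in>Pow E. chi S \<eta> * chi S \<omega>) = 2 ^ card E * of_bool (\<eta> = \<omega>)"
      unfolding avg_def chi_commute[of \<eta>] chi_commute[of \<omega>] by (simp add: field_simps)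
    then show "f \<eta> * (\<Sum>S\<in>Pow E. chi S \<eta> * chi S \<omega>) = f \<eta> * (2 ^ card E * of_bool (\<eta> = \<omega>))" by simp
  qed
  also have "\<dots> = (\<Sum>\<eta>\<in>Pow E. if \<eta> = \<omega> then f \<eta> else 0)"
    unfolding avg_def sum_divide_distrib by (intro sum.cong) auto
  also have "\<dots> = f \<omega>" using fin \<omega> by simp
  finally show ?thesis by simp
qed

lemma noise_op_fourier:
  assumes fin: "finite E"
  shows "noise_op E \<epsilon> f \<omega> = (\<Sum>S\<in>Pow E. (1 - 2 * \<epsilon>) ^ card S * coef E f S * chi S \<omega>)"
proof -
  have "noise_op E \<epsilon> f \<omega> = noise_op E \<epsilon> (\<lambda>\<eta>. \<Sum>S\<in>Pow E. coef E f S * chi S \<eta>) \<omega>"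
    unfolding noise_op_def by (intro sum.cong arg_cong2[where f = "(*)"] fourier_inversion fin) auto
  also have "\<dots> = (\<Sum>S\<in>Pow E. coef E f S * noise_op E \<epsilon> (chi S) \<omega>)"
    unfolding noise_op_def sum_distrib_left
    by (subst sum.swap) (intro sum.cong refl, simp add: mult_ac)
  also have "\<dots> = (\<Sum>S\<in>Pow E. (1 - 2 * \<epsilon>) ^ card S * coef E f S * chi S \<omega>)"
    by (intro sum.cong refl) (simp add: noise_op_chi[OF fin] mult_ac)
  finally show ?thesis .
qed

lemma noise_variance_fourier:
  assumes fin: "finite E"
  shows "avg E (\<lambda>\<omega>. (noise_op E \<epsilon> f \<omega> - avg E f)\<^sup>2) =
    (\<Sum>S\<in>Pow E - {{}}. ((1 - 2 * \<epsilon>)\<^sup>2) ^ card S * (coef E f S)\<^sup>2)"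
proof -
  define c where "c S = (1 - 2 * \<epsilon>) ^ card S * coef E f S" for S
  define L where "L = Pow E - {{}}"
  have finL: "finite L" unfolding L_def using fin by simp
  have "noise_op E \<epsilon> f \<omega> - avg E f = (\<Sum>S\<in>L. 1 * c S * chi S \<omega>)" for \<omega>
  proof -
    have "Pow E = insert {} L" "{} \<notin> L" unfolding L_def by auto
    then show ?thesis
      unfolding noise_op_fourier[OF fin] c_def using finL by (simp add: coef_def)
  qed
  then have "avg E (\<lambda>\<omega>. (noise_op E \<epsilon> f \<omega> - avg E f)\<^sup>2)
    = (\<Sum>S\<in>L. \<Sum>T\<in>L. c S * c T * avg E (\<lambda>\<omega>. (1 * 1) * (chi S \<omega> * chi T \<omega>)))"
    unfolding power2_eq_square by (simp only: avg_sum_mult_sum)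
  also have "\<dots> = (\<Sum>S\<in>L. \<Sum>T\<in>L. if S = T then (c S)\<^sup>2 else 0)"
    by (intro sum.cong refl) (auto simp: L_def avg_chi_chi[OF fin] power2_eq_square)
  also have "\<dots> = (\<Sum>S\<in>L. (c S)\<^sup>2)" using finL by simp
  also have "\<dots> = (\<Sum>S\<in>L. ((1 - 2 * \<epsilon>)\<^sup>2) ^ card S * (coef E f S)\<^sup>2)"
    by (intro sum.cong refl) (simp add: c_def power_mult_distrib power_mult[symmetric] mult.commute)
  finally show ?thesis unfolding L_def .
qed

text \<open>Noise damps level \<open>k\<close> geometrically, which beats the linear growth in
  \<open>lev\<close>. The constant is the value of the series of \<open>(k + 1) * r ^ k\<close>, the
  derivative of the geometric series.\<close>

lemma noise_variance_le:
  assumes fin: "finite E" and \<epsilon>: "0 < \<epsilon>" "\<epsilon> < 1/2" and \<delta>: "0 \<le> \<delta>"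
    and lev: "\<And>k. k \<ge> 1 \<Longrightarrow> (\<Sum>S\<in>{S. S \<subseteq> E \<and> card S = k}. (coef E f S)\<^sup>2) \<le> real k * \<delta>"
  shows "avg E (\<lambda>\<omega>. (noise_op E \<epsilon> f \<omega> - avg E f)\<^sup>2) \<le> \<delta> / (1 - (1 - 2 * \<epsilon>)\<^sup>2)\<^sup>2"
proof -
  define r where "r = (1 - 2 * \<epsilon>)\<^sup>2"
  have r: "0 \<le> r" "r < 1" unfolding r_def using \<epsilon> by (auto simp: power_less_one_iff abs_square_less_1)
  have "avg E (\<lambda>\<omega>. (noise_op E \<epsilon> f \<omega> - avg E f)\<^sup>2) = (\<Sum>S\<in>Pow E - {{}}. r ^ card S * (coef E f S)\<^sup>2)"
    unfolding noise_variance_fourier[OF fin] r_def ..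
  also have "\<dots> = (\<Sum>k\<in>{1..card E}. \<Sum>S\<in>{S \<in> Pow E - {{}}. card S = k}. r ^ card S * (coef E f S)\<^sup>2)"
    by (rule sum.group[symmetric])
      (use fin in \<open>auto intro!: card_mono simp: Suc_le_eq card_gt_0_iff dest: finite_subset\<close>)
  also have "\<dots> = (\<Sum>k\<in>{1..card E}. r ^ k * (\<Sum>S\<in>{S. S \<subseteq> E \<and> card S = k}. (coef E f S)\<^sup>2))"
  proof (intro sum.cong refl)
    fix k assume "k \<in> {1..card E}"
    then have "{S \<in> Pow E - {{}}. card S = k} = {S. S \<subseteq> E \<and> card S = k}" by auto
    then show "(\<Sum>S\<in>{S \<in> Pow E - {{}}. card S = k}. r ^ card S * (coef E f S)\<^sup>2)
       = r ^ k * (\<Sum>S\<in>{S. S \<subseteq> E \<and> card S = k}. (coef E f S)\<^sup>2)"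
      by (simp add: sum_distrib_left)
  qed
  also have "\<dots> \<le> (\<Sum>k\<in>{1..card E}. r ^ k * (real k * \<delta>))"
    using r lev by (intro sum_mono mult_left_mono) auto
  also have "\<dots> \<le> (\<Sum>k\<in>{1..card E}. \<delta> * (real (Suc k) * r ^ k))"
    using r \<delta> by (intro sum_mono) (simp add: algebra_simps)
  also have "\<dots> = \<delta> * (\<Sum>k\<in>{1..card E}. real (Suc k) * r ^ k)" by (simp add: sum_distrib_left)
  also have "\<dots> \<le> \<delta> * (1 / (1 - r)\<^sup>2)"
  proof (rule mult_left_mono[OF _ \<delta>])
    have s: "(\<lambda>n. real (Suc n) * r ^ n) sums (1 / (1 - r)\<^sup>2)"
      using geometric_deriv_sums[of r] r by simp
    show "(\<Sum>k\<in>{1..card E}. real (Suc k) * r ^ k) \<le> 1 / (1 - r)\<^sup>2"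
      using sum_le_suminf[OF sums_summable[OF s], of "{1..card E}"] sums_unique[OF s] r by simp
  qed
  finally show ?thesis unfolding r_def by simp
qed

section \<open>Connections in the grid\<close>

definition edges :: "vertex set \<Rightarrow> vertex set set" where
  "edges V = {{u, v} | u v. u \<in> V \<and> v \<in> V \<and> grid_adj u v}"

definition step :: "vertex set set \<Rightarrow> vertex set \<Rightarrow> (vertex \<times> vertex) set" where
  "step \<omega> V = {(u, v). u \<in> V \<and> v \<in> V \<and> grid_adj u v \<and> {u, v} \<in> \<omega>}"

text \<open>The clause \<open>u \<in> V\<close> keeps even the trivial connection inside
  \<open>V\<close>. For \<open>\<omega> = UNIV\<close> this is mere lattice connectedness, the form
  in which paths enter the geometric lemmas.\<close>

definition conn :: "vertex set set \<Rightarrow> vertex set \<Rightarrow> vertex \<Rightarrow> vertex \<Rightarrow> bool" where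
  "conn \<omega> V u v \<longleftrightarrow> u \<in> V \<and> (u, v) \<in> (step \<omega> V)\<^sup>*"

lemma grid_adj_sym: "grid_adj u v \<longleftrightarrow> grid_adj v u"
  unfolding grid_adj_def by (auto simp: abs_minus_commute)

lemma grid_adj_cases:
  assumes "grid_adj (a, b) (c, d)"
  obtains "c = a + 1" "d = b" | "a = c + 1" "d = b" | "c = a" "d = b + 1" | "c = a" "b = d + 1"
  using assms unfolding grid_adj_def by simp linarith

lemma edges_mono: "V \<subseteq> W \<Longrightarrow> edges V \<subseteq> edges W"
  unfolding edges_def by blast

lemma finite_edges: "finite V \<Longrightarrow> finite (edges V)"
proof -
  assume "finite V"
  moreover have "edges V \<subseteq> (\<lambda>(u, v). {u, v}) ` (V \<times> V)" unfolding edges_def by auto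
  ultimately show ?thesis by (meson finite_SigmaI finite_imageI finite_subset)
qed

lemma edges_cases:
  assumes "e \<in> edges V"
  obtains x y where "e = {(x, y), (x + 1, y)}" "(x, y) \<in> V" "(x + 1, y) \<in> V"
  | x y where "e = {(x, y), (x, y + 1)}" "(x, y) \<in> V" "(x, y + 1) \<in> V"
proof -
  from assms obtain a b c d where e: "e = {(a, b), (c, d)}" "(a, b) \<in> V" "(c, d) \<in> V" "grid_adj (a, b) (c, d)"
    unfolding edges_def by auto
  from e(4) show ?thesis by (cases rule: grid_adj_cases) (use e that in \<open>auto simp: insert_commute\<close>)
qed

lemma edges_subset: "e \<in> edges V \<Longrightarrow> e \<subseteq> V \<and> e \<noteq> {}"
  by (erule edges_cases) auto

lemma step_sym: "(u, v) \<in> step \<omega> V \<Longrightarrow> (v, u) \<in> step \<omega> V"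
  unfolding step_def by (auto simp: insert_commute grid_adj_sym[of u])

lemma conn_refl: "u \<in> V \<Longrightarrow> conn \<omega> V u u" unfolding conn_def by simp

lemma conn_in1: "conn \<omega> V u v \<Longrightarrow> u \<in> V" unfolding conn_def by simp

lemma conn_in2: "conn \<omega> V u v \<Longrightarrow> v \<in> V"
  unfolding conn_def by (auto elim!: rtranclE simp: step_def)

lemma conn_trans: "conn \<omega> V u v \<Longrightarrow> conn \<omega> V v w \<Longrightarrow> conn \<omega> V u w"
  unfolding conn_def by auto

lemma conn_sym: "conn \<omega> V u v \<Longrightarrow> conn \<omega> V v u"
proof -
  assume a: "conn \<omega> V u v"
  have "sym (step \<omega> V)" using step_sym by (auto intro: symI)
  then have "sym ((step \<omega> V)\<^sup>*)" by (rule sym_rtrancl)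
  then show ?thesis using a conn_in2[OF a] unfolding conn_def by (auto dest: symD)
qed

lemma conn_edge: "u \<in> V \<Longrightarrow> v \<in> V \<Longrightarrow> grid_adj u v \<Longrightarrow> {u, v} \<in> \<omega> \<Longrightarrow> conn \<omega> V u v"
  unfolding conn_def step_def by auto

lemma conn_mono: "conn \<omega> V u v \<Longrightarrow> \<omega> \<subseteq> \<omega>' \<Longrightarrow> V \<subseteq> V' \<Longrightarrow> conn \<omega>' V' u v"
  unfolding conn_def using rtrancl_mono[of "step \<omega> V" "step \<omega>' V'"] by (auto simp: step_def)

lemma conn_induct [consumes 1, case_names base step]:
  assumes "conn \<omega> V u w" "u \<in> V \<Longrightarrow> P u"
    and "\<And>v w. conn \<omega> V u v \<Longrightarrow> P v \<Longrightarrow> v \<in> V \<Longrightarrow> w \<in> V \<Longrightarrow> grid_adj v w \<Longrightarrow> {v, w} \<in> \<omega> \<Longrightarrow> P w"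
  shows "P w"
proof -
  have u: "u \<in> V" "(u, w) \<in> (step \<omega> V)\<^sup>*" using assms(1) unfolding conn_def by auto
  from u(2) show ?thesis
  proof (induction rule: rtrancl_induct)
    case base then show ?case using assms(2) u by simp
  next
    case (step y z)
    then show ?case using assms(3)[of y z] u unfolding conn_def step_def by auto
  qed
qed

lemma conn_restrict: "conn (\<omega> \<inter> edges V) V = conn \<omega> V"
proof -
  have "step (\<omega> \<inter> edges V) V = step \<omega> V" unfolding step_def edges_def by auto
  then show ?thesis unfolding conn_def by auto
qed

lemma conn_restrict_superset:
  assumes "edges V \<subseteq> F"
  shows "conn (\<omega> \<inter> F) V u v = conn \<omega> V u v"
  using conn_restrict[of "\<omega> \<inter> F" V] conn_restrict[of \<omega> V] assms
  by (metis Int_assoc inf.absorb_iff2)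

lemma conn_image:
  assumes "conn \<omega> V u v" "\<And>u v. grid_adj u v \<Longrightarrow> grid_adj (f u) (f v)"
  shows "conn ((`) f ` \<omega>) (f ` V) (f u) (f v)"
  using assms(1)
proof (induction rule: conn_induct)
  case base
  then show ?case by (auto intro: conn_refl)
next
  case (step v w)
  from \<open>{v, w} \<in> \<omega>\<close> have "f ` {v, w} \<in> (`) f ` \<omega>" by (rule imageI)
  then have "conn ((`) f ` \<omega>) (f ` V) (f v) (f w)" using step assms(2) by (intro conn_edge) auto
  with step.IH show ?case by (rule conn_trans)
qed

section \<open>Symmetries of the lattice\<close>

definition grid_iso :: "(vertex \<Rightarrow> vertex) \<Rightarrow> bool" where
  "grid_iso f \<longleftrightarrow> bij f \<and> (\<forall>u v. grid_adj (f u) (f v) \<longleftrightarrow> grid_adj u v)"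

lemma grid_iso_conn:
  assumes f: "grid_iso f"
  shows "conn ((`) f ` \<omega>) (f ` V) (f u) (f v) \<longleftrightarrow> conn \<omega> V u v"
proof
  assume *: "conn ((`) f ` \<omega>) (f ` V) (f u) (f v)"
  have b: "bij f" and a: "\<And>u v. grid_adj (f u) (f v) \<longleftrightarrow> grid_adj u v" using f unfolding grid_iso_def by auto
  have inv: "inv f (f x) = x" "f (inv f x) = x" for x using b by (auto simp: bij_is_inj bij_is_surj surj_f_inv_f)
  have "grid_adj (inv f u) (inv f v)" if "grid_adj u v" for u v
    using a[of "inv f u" "inv f v"] that unfolding inv by simp
  from conn_image[OF * this]
  have "conn ((`) (inv f) ` (`) f ` \<omega>) (inv f ` f ` V) (inv f (f u)) (inv f (f v))" .
  then show "conn \<omega> V u v" by (simp add: image_image inv)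
next
  assume "conn \<omega> V u v"
  then show "conn ((`) f ` \<omega>) (f ` V) (f u) (f v)"
    using f unfolding grid_iso_def by (intro conn_image) auto
qed

lemma grid_iso_bij_edges:
  assumes f: "grid_iso f"
  shows "bij_betw ((`) f) (edges V) (edges (f ` V))"
proof -
  have i: "inj f" and a: "\<And>u v. grid_adj (f u) (f v) \<longleftrightarrow> grid_adj u v"
    using f unfolding grid_iso_def by (auto simp: bij_is_inj)
  have "inj_on ((`) f) (edges V)" using i by (auto simp: inj_on_def inj_image_eq_iff)
  moreover have "(`) f ` edges V = edges (f ` V)"
  proof
    show "(`) f ` edges V \<subseteq> edges (f ` V)"
    proof
      fix e assume "e \<in> (`) f ` edges V"
      then obtain u v where "e = {f u, f v}" "u \<in> V" "v \<in> V" "grid_adj u v" unfolding edges_def by auto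
      then show "e \<in> edges (f ` V)" using a[of u v] unfolding edges_def by blast
    qed
    show "edges (f ` V) \<subseteq> (`) f ` edges V"
    proof
      fix e assume "e \<in> edges (f ` V)"
      then obtain u v where "e = {f u, f v}" "u \<in> V" "v \<in> V" "grid_adj (f u) (f v)" unfolding edges_def by auto
      then have "e = f ` {u, v}" "u \<in> V" "v \<in> V" "grid_adj u v" using a[of u v] by auto
      then show "e \<in> (`) f ` edges V" unfolding edges_def by blast
    qed
  qed
  ultimately show ?thesis unfolding bij_betw_def by simp
qed

lemma Pr_grid_iso:
  assumes f: "grid_iso f"
  shows "Pr (edges (f ` V)) A = Pr (edges V) (\<lambda>\<omega>. A ((`) f ` \<omega>))"
  by (rule Pr_bij[OF grid_iso_bij_edges[OF f]])

section \<open>Crossing paths in a rectangle intersect\<close>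

definition pt :: "vertex \<Rightarrow> real ^ 2" where
  "pt u = (\<chi> i. if i = 1 then of_int (fst u) else of_int (snd u))"

lemma pt_nth [simp]: "pt u $ 1 = of_int (fst u)" "pt u $ 2 = of_int (snd u)"
  unfolding pt_def by auto

text \<open>The case \<open>a = b\<close> is the degenerate segment of a path with one
  vertex.\<close>

lemma conn_polyline:
  assumes "conn \<omega> A u v"
  shows "\<exists>g. path g \<and> pathstart g = pt u \<and> pathfinish g = pt v \<and>
    path_image g \<subseteq> (\<Union>{closed_segment (pt a) (pt b) | a b. a \<in> A \<and> b \<in> A \<and> (a = b \<or> grid_adj a b)})"
  using assms
proof (induction rule: conn_induct)
  case base
  then have "path_image (linepath (pt u) (pt u)) \<subseteq>
    (\<Union>{closed_segment (pt a) (pt b) | a b. a \<in> A \<and> b \<in> A \<and> (a = b \<or> grid_adj a b)})"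
    unfolding path_image_linepath by (intro Union_upper) blast
  then show ?case
    using path_linepath pathstart_linepath pathfinish_linepath by blast
next
  case (step v w)
  then obtain g where g: "path g" "pathstart g = pt u" "pathfinish g = pt v"
    "path_image g \<subseteq> (\<Union>{closed_segment (pt a) (pt b) | a b. a \<in> A \<and> b \<in> A \<and> (a = b \<or> grid_adj a b)})"
    by auto
  have "path_image (g +++ linepath (pt v) (pt w)) \<subseteq> path_image g \<union> closed_segment (pt v) (pt w)"
    by (metis path_image_join_subset path_image_linepath)
  moreover have "closed_segment (pt v) (pt w) \<subseteq>
    (\<Union>{closed_segment (pt a) (pt b) | a b. a \<in> A \<and> b \<in> A \<and> (a = b \<or> grid_adj a b)})"
    using step.hyps by (intro Union_upper) blast
  ultimately have "path_image (g +++ linepath (pt v) (pt w)) \<subseteq>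
    (\<Union>{closed_segment (pt a) (pt b) | a b. a \<in> A \<and> b \<in> A \<and> (a = b \<or> grid_adj a b)})"
    using g(4) by (meson Un_least order_trans)
  then show ?case using g(1-3)
    by (intro exI[of _ "g +++ linepath (pt v) (pt w)"]) simp
qed

lemma floor_between:
  fixes a b :: int and t :: real
  assumes "\<bar>a - b\<bar> \<le> 1" "0 \<le> t" "t \<le> 1"
  shows "\<lfloor>(1 - t) * of_int a + t * of_int b\<rfloor> \<in> {a, b}"
proof -
  consider "b = a" | "b = a + 1" | "a = b + 1" using assms(1) by linarith
  then show ?thesis
  proof cases
    case 1
    then show ?thesis by (simp add: algebra_simps)
  next
    case 2
    have "(1 - t) * of_int a + t * of_int b = of_int a + t" unfolding 2 by (simp add: algebra_simps)
    then show ?thesis using 2 assms by (cases "t = 1") (auto simp: floor_eq_iff)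
  next
    case 3
    have "(1 - t) * of_int a + t * of_int b = of_int b + (1 - t)" unfolding 3 by (simp add: algebra_simps)
    then show ?thesis using 3 assms by (cases "t = 0") (auto simp: floor_eq_iff)
  qed
qed

text \<open>The lower left lattice point of a point \<open>z\<close> on a lattice edge is an end of that edge, so two
  polylines that meet share a vertex.\<close>

lemma floor_segment:
  assumes z: "z \<in> closed_segment (pt u) (pt v)" and uv: "u = v \<or> grid_adj u v"
  shows "(\<lfloor>z $ 1\<rfloor>, \<lfloor>z $ 2\<rfloor>) \<in> {u, v}"
proof -
  obtain t where t: "0 \<le> t" "t \<le> 1" "z = (1 - t) *\<^sub>R pt u + t *\<^sub>R pt v"
    using z unfolding in_segment by auto
  have c: "z $ 1 = (1 - t) * of_int (fst u) + t * of_int (fst v)" "z $ 2 = (1 - t) * of_int (snd u) + t * of_int (snd v)"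
    using t(3) by simp_all
  have 1: "\<bar>fst u - fst v\<bar> \<le> 1" "\<bar>snd u - snd v\<bar> \<le> 1" "fst u = fst v \<or> snd u = snd v"
    using uv unfolding grid_adj_def by auto
  have f: "\<lfloor>z $ 1\<rfloor> \<in> {fst u, fst v}" "\<lfloor>z $ 2\<rfloor> \<in> {snd u, snd v}"
    unfolding c using floor_between[OF 1(1) t(1,2)] floor_between[OF 1(2) t(1,2)] by blast+
  show ?thesis using f 1(3) by (cases u; cases v) auto
qed

text \<open>Pulled back from the plane theorem \<open>fashoda\<close>: the polylines meet at some
  \<open>z\<close>, and rounding \<open>z\<close> down gives a vertex of either path.\<close>

lemma lattice_crossing:
  assumes sub: "A \<subseteq> {a..b} \<times> {c..d}" "B \<subseteq> {a..b} \<times> {c..d}"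
    and A: "conn \<omega> A p q" "fst p = a" "fst q = b"
    and B: "conn \<omega>' B r s" "snd r = c" "snd s = d"
  shows "A \<inter> B \<noteq> {}"
proof -
  obtain f where f: "path f" "pathstart f = pt p" "pathfinish f = pt q"
    "path_image f \<subseteq> (\<Union>{closed_segment (pt a) (pt b) | a b. a \<in> A \<and> b \<in> A \<and> (a = b \<or> grid_adj a b)})"
    using conn_polyline[OF A(1)] by auto
  obtain g where g: "path g" "pathstart g = pt r" "pathfinish g = pt s"
    "path_image g \<subseteq> (\<Union>{closed_segment (pt a) (pt b) | a b. a \<in> B \<and> b \<in> B \<and> (a = b \<or> grid_adj a b)})"
    using conn_polyline[OF B(1)] by auto
  have ptbox: "pt u \<in> cbox (pt (a, c)) (pt (b, d))" if "u \<in> {a..b} \<times> {c..d}" for u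
    using that by (auto simp: mem_box_cart forall_2)
  have seg: "closed_segment (pt u) (pt v) \<subseteq> cbox (pt (a, c)) (pt (b, d))" if "u \<in> {a..b} \<times> {c..d}" "v \<in> {a..b} \<times> {c..d}" for u v
    using that by (intro closed_segment_subset ptbox convex_box)
  have "path_image f \<subseteq> cbox (pt (a, c)) (pt (b, d))" "path_image g \<subseteq> cbox (pt (a, c)) (pt (b, d))"
    using f(4) g(4) seg sub by blast+
  from fashoda[OF f(1) g(1) this] f g A B obtain z where z: "z \<in> path_image f" "z \<in> path_image g" by auto
  obtain u v where uv: "z \<in> closed_segment (pt u) (pt v)" "u \<in> A" "v \<in> A" "u = v \<or> grid_adj u v" using z f by blast
  obtain u' v' where uv': "z \<in> closed_segment (pt u') (pt v')" "u' \<in> B" "v' \<in> B" "u' = v' \<or> grid_adj u' v'" using z g by blast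
  have "(\<lfloor>z $ 1\<rfloor>, \<lfloor>z $ 2\<rfloor>) \<in> A" "(\<lfloor>z $ 1\<rfloor>, \<lfloor>z $ 2\<rfloor>) \<in> B"
    using floor_segment[OF uv(1,4)] floor_segment[OF uv'(1,4)] uv uv' by auto
  then show ?thesis by blast
qed

lemma conn_horizontal:
  assumes "x \<le> x'" "{x..x'} \<times> {y} \<subseteq> V"
  shows "conn UNIV V (x, y) (x', y)"
  using assms
proof (induction x' rule: int_ge_induct)
  case base
  then show ?case by (intro conn_refl) auto
next
  case (step i)
  have "conn UNIV V (i, y) (i + 1, y)" using step by (intro conn_edge) (auto simp: grid_adj_def)
  moreover have "conn UNIV V (x, y) (i, y)" using step by (intro step.IH) auto
  ultimately show ?case by (rule conn_trans[rotated])
qed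

lemma conn_vertical:
  assumes "y \<le> y'" "{x} \<times> {y..y'} \<subseteq> V"
  shows "conn UNIV V (x, y) (x, y')"
  using assms
proof (induction y' rule: int_ge_induct)
  case base
  then show ?case by (intro conn_refl) auto
next
  case (step i)
  have "conn UNIV V (x, i) (x, i + 1)" using step by (intro conn_edge) (auto simp: grid_adj_def)
  moreover have "conn UNIV V (x, y) (x, i)" using step by (intro step.IH) auto
  ultimately show ?case by (rule conn_trans[rotated])
qed

text \<open>Seen from the left side, \<open>A\<close> starts above \<open>B\<close> but ends at the
  bottom, while \<open>B\<close> ends at the top.\<close>

lemma lattice_corner_crossing:
  assumes sub: "A \<subseteq> {a..b} \<times> {c..d}" "B \<subseteq> {a..b} \<times> {c..d}"
    and A: "conn UNIV A (a, y1) (x1, c)" and B: "conn UNIV B (a, y2) (x2, d)" and y: "y2 < y1"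
  shows "A \<inter> B \<noteq> {}"
proof -
  \<comment> \<open>Prolonged outside the box, \<open>A'\<close> becomes a left-right and
    \<open>B'\<close> a bottom-top crossing of a box enlarged by two on the left and below. As
    \<open>y2 < y1\<close>, the added column stops below the added row at height \<open>y1\<close>,
    so the prolongations create no common vertex.\<close>
  define A' where "A' = A \<union> {a - 2..a - 1} \<times> {y1} \<union> {x1..b} \<times> {c - 1}"
  define B' where "B' = B \<union> {a - 1} \<times> {c - 2..y2}"
  have i: "(a, y1) \<in> A" "(x1, c) \<in> A" "(a, y2) \<in> B" "(x2, d) \<in> B"
    using A B by (auto dest: conn_in1 conn_in2)
  have r: "a \<le> x1" "x1 \<le> b" "c \<le> y1" "y1 \<le> d" "c \<le> y2" "y2 \<le> d" "a \<le> x2" "x2 \<le> b" using i sub by auto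
  have "conn UNIV A' (a - 2, y1) (a - 1, y1)" by (intro conn_horizontal) (auto simp: A'_def)
  moreover have "conn UNIV A' (a - 1, y1) (a, y1)"
    using i by (intro conn_edge) (auto simp: A'_def grid_adj_def)
  moreover have "conn UNIV A' (a, y1) (x1, c)" by (rule conn_mono[OF A]) (auto simp: A'_def)
  moreover have "conn UNIV A' (x1, c) (x1, c - 1)"
    using i r by (intro conn_edge) (auto simp: A'_def grid_adj_def)
  moreover have "conn UNIV A' (x1, c - 1) (b, c - 1)" using r by (intro conn_horizontal) (auto simp: A'_def)
  ultimately have cA: "conn UNIV A' (a - 2, y1) (b, c - 1)" by (meson conn_trans)
  have "conn UNIV B' (a - 1, c - 2) (a - 1, y2)" using r by (intro conn_vertical) (auto simp: B'_def)
  moreover have "conn UNIV B' (a - 1, y2) (a, y2)"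
    using i r by (intro conn_edge) (auto simp: B'_def grid_adj_def)
  moreover have "conn UNIV B' (a, y2) (x2, d)" by (rule conn_mono[OF B]) (auto simp: B'_def)
  ultimately have cB: "conn UNIV B' (a - 1, c - 2) (x2, d)" by (meson conn_trans)
  have "A' \<subseteq> {a - 2..b} \<times> {c - 2..d}" "B' \<subseteq> {a - 2..b} \<times> {c - 2..d}"
    using sub r unfolding A'_def B'_def by fastforce+
  from lattice_crossing[OF this cA _ _ cB] have "A' \<inter> B' \<noteq> {}" by simp
  moreover have "A' \<inter> B' \<subseteq> A \<inter> B"
    using sub r y unfolding A'_def B'_def by fastforce
  ultimately show ?thesis by blast
qed

section \<open>Crossings of rectangles and duality\<close>

definition left_right :: "int \<Rightarrow> int \<Rightarrow> int \<Rightarrow> int \<Rightarrow> vertex set set \<Rightarrow> bool" where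
  "left_right a b c d \<omega> \<longleftrightarrow> (\<exists>p q. fst p = a \<and> fst q = b \<and> conn \<omega> ({a..b} \<times> {c..d}) p q)"

definition top_bottom :: "int \<Rightarrow> int \<Rightarrow> int \<Rightarrow> int \<Rightarrow> vertex set set \<Rightarrow> bool" where
  "top_bottom a b c d \<omega> \<longleftrightarrow> (\<exists>p q. snd p = c \<and> snd q = d \<and> conn \<omega> ({a..b} \<times> {c..d}) p q)"

lemma left_right_mono: "left_right a b c d \<omega> \<Longrightarrow> \<omega> \<subseteq> \<omega>' \<Longrightarrow> left_right a b c d \<omega>'"
  unfolding left_right_def using conn_mono by blast

lemma top_bottom_mono: "top_bottom a b c d \<omega> \<Longrightarrow> \<omega> \<subseteq> \<omega>' \<Longrightarrow> top_bottom a b c d \<omega>'"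
  unfolding top_bottom_def using conn_mono by blast

lemma left_right_restrict: "edges ({a..b} \<times> {c..d}) \<subseteq> F \<Longrightarrow> left_right a b c d (\<omega> \<inter> F) = left_right a b c d \<omega>"
  unfolding left_right_def by (simp add: conn_restrict_superset)

lemma top_bottom_restrict: "edges ({a..b} \<times> {c..d}) \<subseteq> F \<Longrightarrow> top_bottom a b c d (\<omega> \<inter> F) = top_bottom a b c d \<omega>"
  unfolding top_bottom_def by (simp add: conn_restrict_superset)

text \<open>Coordinates are doubled: \<open>mid e\<close> is twice the midpoint of the edge \<open>e\<close>, and \<open>dual\<close> maps the
  doubled primal lattice to the doubled dual lattice by a reflection.\<close>

definition mid :: "vertex set \<Rightarrow> vertex" where
  "mid e = (\<Sum>u\<in>e. fst u, \<Sum>u\<in>e. snd u)"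

definition dual :: "vertex \<Rightarrow> vertex" where
  "dual u = (snd u - 1, fst u + 1)"

lemma mid_pair: "u \<noteq> v \<Longrightarrow> mid {u, v} = (fst u + fst v, snd u + snd v)"
  unfolding mid_def by simp

text \<open>The parities of the doubled midpoint tell horizontal edges (odd, even) from vertical
  ones (even, odd).\<close>

lemma mid_inj:
  assumes "e \<in> edges V" "f \<in> edges V" "mid e = mid f"
  shows "e = f"
  using assms(1)
proof (cases rule: edges_cases)
  case (1 x y)
  note e = 1
  from assms(2) show ?thesis
  proof (cases rule: edges_cases)
    case (1 x' y')
    then show ?thesis using e assms(3) by (simp add: mid_pair)
  next
    case (2 x' y')
    then show ?thesis using e assms(3) by (simp add: mid_pair) presburger
  qed
next
  case (2 x y)
  note e = 2
  from assms(2) show ?thesis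
  proof (cases rule: edges_cases)
    case (1 x' y')
    then show ?thesis using e assms(3) by (simp add: mid_pair) presburger
  next
    case (2 x' y')
    then show ?thesis using e assms(3) by (simp add: mid_pair)
  qed
qed

lemma dual_dual: "dual (dual u) = u"
  unfolding dual_def by simp

lemma dual_adj: "grid_adj u v \<Longrightarrow> grid_adj (dual u) (dual v)"
  unfolding dual_def grid_adj_def by simp

text \<open>The path is refined through the midpoints of its open edges, so that the edges it uses
  can be read off its vertices.\<close>

lemma conn_doubled:
  assumes "conn \<omega> V u v"
  shows "conn UNIV ((\<lambda>u. (2 * fst u, 2 * snd u)) ` V \<union> mid ` (\<omega> \<inter> edges V)) (2 * fst u, 2 * snd u) (2 * fst v, 2 * snd v)"
  using assms
proof (induction rule: conn_induct)
  case base
  then show ?case by (intro conn_refl) auto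
next
  case (step v w)
  define D where "D = (\<lambda>u. (2 * fst u, 2 * snd u)) ` V \<union> mid ` (\<omega> \<inter> edges V)"
  have e: "{v, w} \<in> \<omega> \<inter> edges V" using step.hyps unfolding edges_def by blast
  have "v \<noteq> w" using step.hyps by (auto simp: grid_adj_def)
  then have m: "mid {v, w} = (fst v + fst w, snd v + snd w)" by (rule mid_pair)
  have D: "(2 * fst v, 2 * snd v) \<in> D" "(2 * fst w, 2 * snd w) \<in> D" "mid {v, w} \<in> D"
    using step.hyps e unfolding D_def by auto
  have "conn UNIV D (2 * fst v, 2 * snd v) (mid {v, w})" "conn UNIV D (mid {v, w}) (2 * fst w, 2 * snd w)"
    using D step.hyps unfolding m by (auto intro!: conn_edge simp: grid_adj_def)
  with step.IH show ?case unfolding D_def by (meson conn_trans)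
qed

lemma Pr_left_right_le_half:
  fixes m :: int
  assumes m: "1 \<le> m"
  shows "Pr (edges ({0..m} \<times> {1..m})) (left_right 0 m 1 m) \<le> 1 / 2"
proof -
  define V where "V = {0..m} \<times> {1..m}"
  define E where "E = edges V"
  have finE: "finite E" unfolding E_def V_def by (intro finite_edges) auto
  \<comment> \<open>\<open>s\<close> sends an edge to the one whose doubled midpoint is the
    \<open>dual\<close> image of its own. Vertical edges in the columns \<open>0\<close> and
    \<open>m\<close> have no such partner and are fixed.\<close>
  define s where "s e = (if \<exists>f\<in>E. mid f = dual (mid e) then (THE f. f \<in> E \<and> mid f = dual (mid e)) else e)" for e
  have s1: "s e = f" if "f \<in> E" "mid f = dual (mid e)" for e f
  proof -
    have "(THE f. f \<in> E \<and> mid f = dual (mid e)) = f"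
    proof (rule the_equality)
      show "f \<in> E \<and> mid f = dual (mid e)" using that by simp
      show "g = f" if "g \<in> E \<and> mid g = dual (mid e)" for g
        using mid_inj[of g V f] that \<open>f \<in> E\<close> \<open>mid f = dual (mid e)\<close> unfolding E_def by simp
    qed
    moreover have "\<exists>f\<in>E. mid f = dual (mid e)" using that by blast
    ultimately show ?thesis unfolding s_def by simp
  qed
  have s2: "s e \<in> E \<and> s (s e) = e" if "e \<in> E" for e
  proof (cases "\<exists>f\<in>E. mid f = dual (mid e)")
    case True
    then obtain f where f: "f \<in> E" "mid f = dual (mid e)" by auto
    then have "mid e = dual (mid f)" by (simp add: dual_dual)
    then show ?thesis using s1[OF f] s1[of e f] f that by simp
  next
    case False
    then have "s e = e" unfolding s_def by simp
    then show ?thesis using that by simp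
  qed
  have bij: "bij_betw s E E" by (rule bij_betw_byWitness[of _ s]) (use s2 in auto)
  have disj: "\<not> left_right 0 m 1 m (E - s ` \<omega>)" if \<omega>: "\<omega> \<subseteq> E" and left_right: "left_right 0 m 1 m \<omega>" for \<omega>
  proof
    assume "left_right 0 m 1 m (E - s ` \<omega>)"
    define D where "D \<omega> = (\<lambda>u. (2 * fst u, 2 * snd u)) ` V \<union> mid ` (\<omega> \<inter> E)" for \<omega>
    have "\<exists>y y'. conn UNIV (D \<omega>) (0, 2 * y) (2 * m, 2 * y')" if "left_right 0 m 1 m \<omega>" for \<omega>
      using that conn_doubled[of \<omega> V] unfolding left_right_def D_def V_def E_def by fastforce
    then obtain y1 y1' y2 y2' where c: "conn UNIV (D \<omega>) (0, 2 * y1) (2 * m, 2 * y1')"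
      "conn UNIV (D (E - s ` \<omega>)) (0, 2 * y2) (2 * m, 2 * y2')"
      using left_right \<open>left_right 0 m 1 m (E - s ` \<omega>)\<close> by blast
    have midE: "mid e \<in> {0..2 * m} \<times> {2..2 * m}" if "e \<in> E" for e
      using that unfolding E_def
      by (cases rule: edges_cases) (auto simp: V_def mid_pair)
    have par: "odd (fst (mid e) + snd (mid e))" if "e \<in> E" for e
      using that unfolding E_def by (cases rule: edges_cases) (auto simp: mid_pair)
    have Dsub: "D \<eta> \<subseteq> {0..2 * m} \<times> {2..2 * m}" for \<eta>
    proof -
      have "(\<lambda>u. (2 * fst u, 2 * snd u)) ` V \<subseteq> {0..2 * m} \<times> {2..2 * m}" unfolding V_def by auto
      then show ?thesis unfolding D_def using midE by blast
    qed
    have Dpar: "(even x \<and> even y) \<or> (\<exists>e\<in>\<eta> \<inter> E. (x, y) = mid e)" if "(x, y) \<in> D \<eta>" for x y \<eta>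
      using that unfolding D_def by auto
    have c2: "conn ((`) dual ` UNIV) (dual ` D (E - s ` \<omega>)) (dual (0, 2 * y2)) (dual (2 * m, 2 * y2'))"
      by (intro conn_image[OF c(2)] dual_adj)
    \<comment> \<open>\<open>dual\<close> turns the left-right path of the second configuration into
      a bottom-top path, whose ends have heights \<open>1\<close> and \<open>2 * m + 1\<close>; the
      box is chosen to fit both paths.\<close>
    have sub1: "D \<omega> \<subseteq> {0..2 * m} \<times> {1..2 * m + 1}" using Dsub[of \<omega>] by fastforce
    have sub2: "dual ` D (E - s ` \<omega>) \<subseteq> {0..2 * m} \<times> {1..2 * m + 1}"
      using Dsub[of "E - s ` \<omega>"] by (fastforce simp: dual_def)
    have "D \<omega> \<inter> dual ` D (E - s ` \<omega>) \<noteq> {}"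
      by (rule lattice_crossing[OF sub1 sub2 c(1) _ _ c2]) (auto simp: dual_def)
    then obtain z w where z: "z \<in> D \<omega>" "z = dual w" "w \<in> D (E - s ` \<omega>)" by auto
    have zw: "fst z = snd w - 1" "snd z = fst w + 1" using z unfolding dual_def by auto
    from z(3) Dpar[of "fst w" "snd w" "E - s ` \<omega>"] consider "even (fst w)" "even (snd w)" | e' where "e' \<in> E" "e' \<notin> s ` \<omega>" "w = mid e'" by auto
    then show False
    proof cases
      case 1
      then have "odd (fst z)" "odd (snd z)" using zw by auto
      then show False using z(1) Dpar[of "fst z" "snd z" \<omega>] par by force
    next
      case 2
      have "odd (fst z + snd z)" using par[OF 2(1)] zw 2(3) by simp
      then obtain e where e: "e \<in> \<omega>" "e \<in> E" "z = mid e"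
        using z(1) Dpar[of "fst z" "snd z" \<omega>] by force
      have "mid e = dual (mid e')" using e z 2 by simp
      then have "s e' = e" using s1 e by blast
      then have "e' = s e" using s2[OF 2(1)] by simp
      then show False using 2 e by blast
    qed
  qed
  have "Pr E (left_right 0 m 1 m) \<le> Pr E (\<lambda>\<omega>. \<not> left_right 0 m 1 m (E - s ` \<omega>))"
    by (rule Pr_mono) (use disj in auto)
  also have "\<dots> = 1 - Pr E (\<lambda>\<omega>. left_right 0 m 1 m (E - s ` \<omega>))" by (rule Pr_not[OF finE])
  also have "Pr E (\<lambda>\<omega>. left_right 0 m 1 m (E - s ` \<omega>)) = Pr E (\<lambda>\<omega>. left_right 0 m 1 m (E - \<omega>))"
    using Pr_bij[OF bij, of "\<lambda>\<omega>. left_right 0 m 1 m (E - \<omega>)"] by simp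
  also have "\<dots> = Pr E (left_right 0 m 1 m)" by (rule Pr_compl)
  finally show ?thesis unfolding E_def V_def by simp
qed

text \<open>By planar duality this is the probability of a dual left-right crossing. All the estimates below
  are phrased with missing primal crossings instead, so that no dual path ever has to be constructed.\<close>

definition block_prob :: "int \<Rightarrow> int \<Rightarrow> real" where
  "block_prob w h = Pr (edges ({1..w} \<times> {1..h})) (\<lambda>\<omega>. \<not> top_bottom 1 w 1 h \<omega>)"

lemma grid_isoI:
  assumes "\<And>u. g (f u) = u" "\<And>u. f (g u) = u" "\<And>u v. grid_adj (f u) (f v) \<longleftrightarrow> grid_adj u v"
  shows "grid_iso f"
  unfolding grid_iso_def using assms by (auto intro!: o_bij[of g] simp: fun_eq_iff)

lemma Pr_not_top_bottom:
  assumes "finite E" "edges ({a..b} \<times> {c..d}) \<subseteq> E"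
  shows "Pr E (\<lambda>\<omega>. \<not> top_bottom a b c d \<omega>) = block_prob (b - a + 1) (d - c + 1)"
proof -
  define f :: "vertex \<Rightarrow> vertex" where "f u = (fst u + a - 1, snd u + c - 1)" for u
  have f: "grid_iso f"
    by (rule grid_isoI[where g = "\<lambda>u. (fst u - a + 1, snd u - c + 1)"]) (auto simp: f_def grid_adj_def)
  define V where "V = {1..b - a + 1} \<times> {1..d - c + 1}"
  have im: "f ` V = {a..b} \<times> {c..d}"
  proof -
    have "(x, y) \<in> f ` V" if "x \<in> {a..b}" "y \<in> {c..d}" for x y
      using that by (intro image_eqI[of _ _ "(x - a + 1, y - c + 1)"]) (auto simp: f_def V_def)
    then show ?thesis by (auto simp: f_def V_def)
  qed
  have iff: "top_bottom a b c d ((`) f ` \<omega>) \<longleftrightarrow> top_bottom 1 (b - a + 1) 1 (d - c + 1) \<omega>" for \<omega>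
  proof
    assume "top_bottom a b c d ((`) f ` \<omega>)"
    then obtain p q where pq: "snd p = c" "snd q = d" "conn ((`) f ` \<omega>) (f ` V) p q"
      unfolding top_bottom_def im by auto
    then obtain p' q' where *: "p = f p'" "q = f q'" using conn_in1 conn_in2 by (metis imageE)
    then have "conn \<omega> V p' q'" using pq by (simp add: grid_iso_conn[OF f])
    then show "top_bottom 1 (b - a + 1) 1 (d - c + 1) \<omega>"
      using pq * unfolding top_bottom_def V_def[symmetric]
      by (intro exI[of _ p'] exI[of _ q']) (auto simp: f_def)
  next
    assume "top_bottom 1 (b - a + 1) 1 (d - c + 1) \<omega>"
    then obtain p q where pq: "snd p = 1" "snd q = d - c + 1" "conn \<omega> V p q"
      unfolding top_bottom_def V_def by auto
    then have "conn ((`) f ` \<omega>) (f ` V) (f p) (f q)" by (simp add: grid_iso_conn[OF f])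
    then show "top_bottom a b c d ((`) f ` \<omega>)"
      unfolding top_bottom_def im by (rule_tac exI[of _ "f p"], rule_tac exI[of _ "f q"]) (use pq in \<open>simp add: f_def\<close>)
  qed
  have "Pr E (\<lambda>\<omega>. \<not> top_bottom a b c d \<omega>) = Pr (edges (f ` V)) (\<lambda>\<omega>. \<not> top_bottom a b c d \<omega>)"
    unfolding im by (intro Pr_restrict assms) (auto simp: depends_on_def top_bottom_restrict)
  also have "\<dots> = Pr (edges V) (\<lambda>\<omega>. \<not> top_bottom a b c d ((`) f ` \<omega>))" by (rule Pr_grid_iso[OF f])
  finally show ?thesis unfolding iff block_prob_def V_def .
qed

text \<open>\<open>f\<close> combines a translation with the reflection in the diagonal, so width
  and height trade places.\<close>

lemma Pr_not_left_right:
  assumes "finite E" "edges ({a..b} \<times> {c..d}) \<subseteq> E"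
  shows "Pr E (\<lambda>\<omega>. \<not> left_right a b c d \<omega>) = block_prob (d - c + 1) (b - a + 1)"
proof -
  define f :: "vertex \<Rightarrow> vertex" where "f u = (snd u + a - 1, fst u + c - 1)" for u
  have f: "grid_iso f"
    by (rule grid_isoI[where g = "\<lambda>u. (snd u - c + 1, fst u - a + 1)"]) (auto simp: f_def grid_adj_def)
  define V where "V = {1..d - c + 1} \<times> {1..b - a + 1}"
  have im: "f ` V = {a..b} \<times> {c..d}"
  proof -
    have "(x, y) \<in> f ` V" if "x \<in> {a..b}" "y \<in> {c..d}" for x y
      using that by (intro image_eqI[of _ _ "(y - c + 1, x - a + 1)"]) (auto simp: f_def V_def)
    then show ?thesis by (auto simp: f_def V_def)
  qed
  have iff: "left_right a b c d ((`) f ` \<omega>) \<longleftrightarrow> top_bottom 1 (d - c + 1) 1 (b - a + 1) \<omega>" for \<omega>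
  proof
    assume "left_right a b c d ((`) f ` \<omega>)"
    then obtain p q where pq: "fst p = a" "fst q = b" "conn ((`) f ` \<omega>) (f ` V) p q"
      unfolding left_right_def im by auto
    then obtain p' q' where *: "p = f p'" "q = f q'" using conn_in1 conn_in2 by (metis imageE)
    then have "conn \<omega> V p' q'" using pq by (simp add: grid_iso_conn[OF f])
    then show "top_bottom 1 (d - c + 1) 1 (b - a + 1) \<omega>"
      using pq * unfolding top_bottom_def V_def[symmetric]
      by (intro exI[of _ p'] exI[of _ q']) (auto simp: f_def)
  next
    assume "top_bottom 1 (d - c + 1) 1 (b - a + 1) \<omega>"
    then obtain p q where pq: "snd p = 1" "snd q = b - a + 1" "conn \<omega> V p q"
      unfolding top_bottom_def V_def by auto
    then have "conn ((`) f ` \<omega>) (f ` V) (f p) (f q)" by (simp add: grid_iso_conn[OF f])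
    then show "left_right a b c d ((`) f ` \<omega>)"
      unfolding left_right_def im by (rule_tac exI[of _ "f p"], rule_tac exI[of _ "f q"]) (use pq in \<open>simp add: f_def\<close>)
  qed
  have "Pr E (\<lambda>\<omega>. \<not> left_right a b c d \<omega>) = Pr (edges (f ` V)) (\<lambda>\<omega>. \<not> left_right a b c d \<omega>)"
    unfolding im by (intro Pr_restrict assms) (auto simp: depends_on_def left_right_restrict)
  also have "\<dots> = Pr (edges V) (\<lambda>\<omega>. \<not> left_right a b c d ((`) f ` \<omega>))" by (rule Pr_grid_iso[OF f])
  finally show ?thesis unfolding iff block_prob_def V_def .
qed

lemma block_prob_ge_half:
  assumes "1 \<le> m"
  shows "1 / 2 \<le> block_prob m (m + 1)"
proof -
  have fin: "finite (edges ({0..m} \<times> {1..m}))" by (intro finite_edges) auto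
  have "block_prob m (m + 1) = 1 - Pr (edges ({0..m} \<times> {1..m})) (left_right 0 m 1 m)"
    using Pr_not_left_right[OF fin, of 0 m 1 m] by (simp add: Pr_not[OF fin])
  then show ?thesis using Pr_left_right_le_half[OF assms] by simp
qed

lemma block_prob_antimono:
  assumes "1 \<le> w" "w \<le> w'"
  shows "block_prob w' h \<le> block_prob w h"
proof -
  define E where "E = edges ({1..w'} \<times> {1..h})"
  have fin: "finite E" unfolding E_def by (intro finite_edges) auto
  have sub: "{1..w} \<times> {1..h} \<subseteq> {1..w'} \<times> {1..h}" using assms by auto
  have "block_prob w' h = Pr E (\<lambda>\<omega>. \<not> top_bottom 1 w' 1 h \<omega>)" unfolding block_prob_def E_def ..
  also have "\<dots> \<le> Pr E (\<lambda>\<omega>. \<not> top_bottom 1 w 1 h \<omega>)"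
  proof (rule Pr_mono, erule contrapos_nn)
    show "top_bottom 1 w 1 h \<omega> \<Longrightarrow> top_bottom 1 w' 1 h \<omega>" for \<omega>
      unfolding top_bottom_def using conn_mono[OF _ order_refl sub] by blast
  qed
  also have "\<dots> = block_prob w h" using Pr_not_top_bottom[OF fin, of 1 w 1 h] edges_mono[OF sub] unfolding E_def by simp
  finally show ?thesis .
qed

section \<open>Crossings of longer rectangles\<close>

lemma antimono_boolI: "(\<And>x y. x \<le> y \<Longrightarrow> A y \<Longrightarrow> A x) \<Longrightarrow> antimono A"
  by (intro antimonoI le_boolI)

lemma antimono_not_top_bottom: "antimono (\<lambda>\<omega>. \<not> top_bottom a b c d \<omega>)"
  by (rule antimono_boolI) (use top_bottom_mono in blast)

lemma antimono_not_left_right: "antimono (\<lambda>\<omega>. \<not> left_right a b c d \<omega>)"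
  by (rule antimono_boolI) (use left_right_mono in blast)

lemma antimono_conj: "antimono A \<Longrightarrow> antimono B \<Longrightarrow> antimono (\<lambda>\<omega>. A \<omega> \<and> B \<omega>)"
  for A B :: "'a set \<Rightarrow> bool"
  by (rule antimono_boolI) (metis antimonoD le_boolD)

section \<open>Exploration of open clusters\<close>

definition cluster :: "vertex set set \<Rightarrow> vertex set \<Rightarrow> vertex set \<Rightarrow> vertex set" where
  "cluster \<omega> V L = {w. \<exists>l\<in>L. conn \<omega> V l w}"

lemma cluster_sub: "cluster \<omega> V L \<subseteq> V"
  unfolding cluster_def by (auto dest: conn_in2)

lemma cluster_step:
  assumes "v \<in> cluster \<omega> V L" "w \<in> V" "grid_adj v w" "{v, w} \<in> \<omega>"
  shows "w \<in> cluster \<omega> V L"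
proof -
  obtain l where l: "l \<in> L" "conn \<omega> V l v" using assms(1) unfolding cluster_def by blast
  have "conn \<omega> V v w" using assms conn_in2[OF l(2)] by (intro conn_edge)
  then show ?thesis using l conn_trans unfolding cluster_def by blast
qed

text \<open>The connecting path never leaves the cluster, so the cluster can serve as a vertex set
  in \<open>lattice_corner_crossing\<close>.\<close>

lemma cluster_conn:
  assumes "w \<in> cluster \<omega> V L"
  shows "\<exists>l\<in>L. conn \<omega> (cluster \<omega> V L) l w"
proof -
  obtain l where l: "l \<in> L" "conn \<omega> V l w" using assms unfolding cluster_def by blast
  have "conn \<omega> (cluster \<omega> V L) l w"
    using l(2)
  proof (induction rule: conn_induct)
    case base
    then show ?case using l(1) by (intro conn_refl) (auto simp: cluster_def intro: conn_refl)
  next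
    case (step v w)
    then have "v \<in> cluster \<omega> V L" by (auto dest: conn_in2)
    then have "conn \<omega> (cluster \<omega> V L) v w"
      using step cluster_step by (intro conn_edge) auto
    with step.IH show ?case by (rule conn_trans)
  qed
  then show ?thesis using l(1) by blast
qed

text \<open>The edges that touch the cluster decide it: open ones let it grow, closed ones on its
  boundary stop it. This makes the exploration a stopping set.\<close>

lemma cluster_cong:
  assumes agree: "\<And>e. e \<in> edges V \<Longrightarrow> e \<inter> cluster \<omega> V L \<noteq> {} \<Longrightarrow> e \<in> \<omega> \<longleftrightarrow> e \<in> \<omega>'"
  shows "cluster \<omega>' V L = cluster \<omega> V L"
proof
  show "cluster \<omega>' V L \<subseteq> cluster \<omega> V L"
  proof
    fix x assume "x \<in> cluster \<omega>' V L"
    then obtain l where l: "l \<in> L" "conn \<omega>' V l x" unfolding cluster_def by blast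
    from l(2) show "x \<in> cluster \<omega> V L"
    proof (induction rule: conn_induct)
      case base
      then show ?case using l(1) by (auto simp: cluster_def intro: conn_refl)
    next
      case (step v w)
      then have "{v, w} \<in> edges V" unfolding edges_def by blast
      then have "{v, w} \<in> \<omega>" using agree step by blast
      then show ?case using step cluster_step by blast
    qed
  qed
  show "cluster \<omega> V L \<subseteq> cluster \<omega>' V L"
  proof
    fix x assume "x \<in> cluster \<omega> V L"
    then obtain l where l: "l \<in> L" "conn \<omega> V l x" unfolding cluster_def by blast
    from l(2) show "x \<in> cluster \<omega>' V L"
    proof (induction rule: conn_induct)
      case base
      then show ?case using l(1) by (auto simp: cluster_def intro: conn_refl)
    next
      case (step v w)
      then have "{v, w} \<in> edges V" unfolding edges_def by blast
      moreover have "v \<in> cluster \<omega> V L" using step.hyps l(1) unfolding cluster_def by blast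
      ultimately have "{v, w} \<in> \<omega>'" using agree step by blast
      then show ?case using step cluster_step by blast
    qed
  qed
qed

text \<open>The Bollobas-Riordan form of the Russo-Seymour-Welsh argument. The open cluster \<open>K\<close> of the left
  side of a square is explored and reflected, and \<open>free_region n K\<close> is the rest of the wide rectangle outside \<open>K\<close> and its
  mirror image. \<open>blocked\<close> stands for a dual path from the right boundary of \<open>K\<close> to the right side of the
  wide rectangle.\<close>

definition left_square :: "int \<Rightarrow> vertex set" where "left_square n = {0..n} \<times> {1..n}"

definition wide_rect :: "int \<Rightarrow> vertex set" where "wide_rect n = {0..2 * n - 2} \<times> {1..2 * n}"

definition vflip :: "int \<Rightarrow> vertex \<Rightarrow> vertex" where "vflip n v = (fst v, 2 * n + 1 - snd v)"

definition left_cluster :: "int \<Rightarrow> vertex set set \<Rightarrow> vertex set" where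
  "left_cluster n \<omega> = cluster \<omega> (left_square n) ({0} \<times> UNIV)"

definition free_region :: "int \<Rightarrow> vertex set \<Rightarrow> vertex set" where
  "free_region n K = wide_rect n - K - vflip n ` K"

text \<open>\<open>K\<close> and its mirror image shut off the left side of the wide rectangle. A
  dual path from \<open>K\<close> to the right side would separate the bottom from the top and from
  the mirror image; \<open>lower_link\<close> is the open path that obstructs it.\<close>

definition lower_link :: "int \<Rightarrow> vertex set \<Rightarrow> vertex set set \<Rightarrow> bool" where
  "lower_link n K \<omega> \<longleftrightarrow> (\<exists>v q. (snd v = 2 * n \<or> (\<exists>u\<in>vflip n ` K. grid_adj u v)) \<and> snd q = 1 \<and> conn \<omega> (free_region n K) v q)"

definition upper_link :: "int \<Rightarrow> vertex set \<Rightarrow> vertex set set \<Rightarrow> bool" where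
  "upper_link n K \<omega> \<longleftrightarrow> (\<exists>v q. (snd v = 1 \<or> (\<exists>u\<in>K. grid_adj u v)) \<and> snd q = 2 * n \<and> conn \<omega> (free_region n K) v q)"

definition blocked :: "int \<Rightarrow> vertex set set \<Rightarrow> bool" where
  "blocked n \<omega> \<longleftrightarrow> (\<forall>v\<in>left_cluster n \<omega>. fst v \<noteq> n) \<and> \<not> lower_link n (left_cluster n \<omega>) \<omega>"

lemma vflip_iso: "grid_iso (vflip n)"
  by (rule grid_isoI[where g = "vflip n"]) (auto simp: vflip_def grid_adj_def)

lemma vflip_vflip [simp]: "vflip n (vflip n v) = v"
  unfolding vflip_def by simp

lemma vflip_wide_rect: "vflip n ` wide_rect n = wide_rect n"
proof -
  have "vflip n ` wide_rect n \<subseteq> wide_rect n" by (auto simp: vflip_def wide_rect_def)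
  moreover have "v \<in> vflip n ` wide_rect n" if "v \<in> wide_rect n" for v
    using that by (intro image_eqI[of _ _ "vflip n v"]) (auto simp: vflip_def wide_rect_def)
  ultimately show ?thesis by blast
qed

lemma inj_vflip: "inj (vflip n)"
  by (metis injI vflip_vflip)

lemma vflip_free_region: "vflip n ` free_region n K = free_region n K"
proof -
  have "vflip n ` free_region n K = vflip n ` wide_rect n - vflip n ` K - vflip n ` vflip n ` K"
    unfolding free_region_def using inj_vflip[of n] by (simp add: image_set_diff)
  also have "vflip n ` vflip n ` K = K" by (simp add: image_image)
  finally show ?thesis unfolding vflip_wide_rect free_region_def by blast
qed

lemma lower_link_vflip: "lower_link n K ((`) (vflip n) ` \<omega>) \<longleftrightarrow> upper_link n K \<omega>"
proof -
  have c: "conn ((`) (vflip n) ` \<omega>) (free_region n K) (vflip n v) (vflip n q) \<longleftrightarrow> conn \<omega> (free_region n K) v q" for v q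
    using grid_iso_conn[OF vflip_iso, of n \<omega> "free_region n K"] by (simp add: vflip_free_region)
  have adj: "grid_adj (vflip n u) (vflip n v) \<longleftrightarrow> grid_adj u v" for u v
    using vflip_iso[of n] unfolding grid_iso_def by blast
  have s: "snd (vflip n v) = 2 * n \<longleftrightarrow> snd v = 1" "snd (vflip n v) = 1 \<longleftrightarrow> snd v = 2 * n" for v
    unfolding vflip_def by auto
  have "lower_link n K ((`) (vflip n) ` \<omega>) \<longleftrightarrow> (\<exists>v q. (snd (vflip n v) = 2 * n \<or> (\<exists>u\<in>vflip n ` K. grid_adj u (vflip n v)))
     \<and> snd (vflip n q) = 1 \<and> conn ((`) (vflip n) ` \<omega>) (free_region n K) (vflip n v) (vflip n q))"
    unfolding lower_link_def by (metis vflip_vflip)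
  also have "\<dots> \<longleftrightarrow> upper_link n K \<omega>"
    unfolding upper_link_def c s by (simp add: adj)
  finally show ?thesis .
qed

text \<open>The lower link, continued through the mirror image of \<open>K\<close>, joins the upper
  half of the left side to the bottom; the upper link, continued through \<open>K\<close>, joins the
  lower half to the top. They must cross. Since \<open>K\<close>, its mirror image and the free
  region are disjoint, they cross in the free region, where both links are open, and an open
  bottom-top path results. \<open>K\<close> is the cluster of some other \<open>\<eta>\<close>,
  since after conditioning it is a fixed set.\<close>

lemma not_lower_and_upper_link:
  assumes n: "2 \<le> n" and K: "K = left_cluster n \<eta>" and top_bottom: "\<not> top_bottom 0 (2 * n - 2) 1 (2 * n) \<omega>"
  shows "\<not> (lower_link n K \<omega> \<and> upper_link n K \<omega>)"
proof
  assume "lower_link n K \<omega> \<and> upper_link n K \<omega>"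
  then obtain v q v2 q2 where
    lo: "snd v = 2 * n \<or> (\<exists>u\<in>vflip n ` K. grid_adj u v)" "snd q = 1" "conn \<omega> (free_region n K) v q" and
    up: "snd v2 = 1 \<or> (\<exists>u\<in>K. grid_adj u v2)" "snd q2 = 2 * n" "conn \<omega> (free_region n K) v2 q2"
    unfolding lower_link_def upper_link_def by blast
  have noTB: False if "snd a = 1" "snd b = 2 * n" "conn \<omega> (free_region n K) a b" for a b
  proof -
    have "conn \<omega> (wide_rect n) a b" by (rule conn_mono[OF that(3)]) (auto simp: free_region_def)
    then show False using top_bottom that unfolding top_bottom_def wide_rect_def by blast
  qed
  have Ksub: "K \<subseteq> left_square n" unfolding K left_cluster_def by (rule cluster_sub)
  have anch: "\<exists>y. conn UNIV K (0, y) k \<and> y \<le> n" if kK: "k \<in> K" for k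
  proof -
    obtain y where y: "conn \<eta> K (0, y) k"
      using cluster_conn[OF kK[unfolded K left_cluster_def]] unfolding K left_cluster_def by auto
    have "y \<le> n" using conn_in1[OF y] Ksub by (auto simp: left_square_def)
    then show ?thesis using conn_mono[OF y, of UNIV K] by auto
  qed
  have "snd v \<noteq> 2 * n" using noTB[of q v] lo conn_sym by blast
  then obtain k where k: "k \<in> K" "grid_adj (vflip n k) v" using lo by blast
  have "snd v2 \<noteq> 1" using noTB[of v2 q2] up by blast
  then obtain k2 where k2: "k2 \<in> K" "grid_adj k2 v2" using up by blast
  obtain y where y: "conn UNIV K (0, y) k" "y \<le> n" using anch[OF k(1)] by blast
  obtain y2 where y2: "conn UNIV K (0, y2) k2" "y2 \<le> n" using anch[OF k2(1)] by blast
  define A1 where "A1 = {w. conn \<omega> (free_region n K) v w}"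
  define B1 where "B1 = {w. conn \<omega> (free_region n K) v2 w}"
  define A where "A = A1 \<union> vflip n ` K"
  define B where "B = B1 \<union> K"
  have AB1: "A1 \<subseteq> free_region n K" "B1 \<subseteq> free_region n K" unfolding A1_def B1_def by (auto dest: conn_in2)
  have cl: "conn UNIV (cluster \<omega> (free_region n K) {a}) a b" if "conn \<omega> (free_region n K) a b" for a b
    using cluster_conn[of b \<omega> "free_region n K" "{a}"] that conn_mono[of \<omega> _ a b UNIV] unfolding cluster_def by auto
  have cA1: "conn UNIV A1 v q" and cB1: "conn UNIV B1 v2 q2"
    using cl[OF lo(3)] cl[OF up(3)] unfolding A1_def B1_def cluster_def by auto
  have "conn UNIV (vflip n ` K) (vflip n (0, y)) (vflip n k)"
    using conn_image[OF y(1), of "vflip n"] vflip_iso[of n] conn_mono[of _ _ _ _ UNIV] unfolding grid_iso_def by blast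
  then have "conn UNIV A (vflip n (0, y)) (vflip n k)" by (rule conn_mono) (auto simp: A_def)
  moreover have "conn UNIV A (vflip n k) v"
    using k conn_in1[OF cA1] by (intro conn_edge) (auto simp: A_def)
  moreover have "conn UNIV A v q" by (rule conn_mono[OF cA1]) (auto simp: A_def)
  ultimately have cA: "conn UNIV A (0, 2 * n + 1 - y) (fst q, 1)"
    using lo(2) unfolding vflip_def by (metis conn_trans fst_conv snd_conv prod.collapse)
  have "conn UNIV B (0, y2) k2" by (rule conn_mono[OF y2(1)]) (auto simp: B_def)
  moreover have "conn UNIV B k2 v2"
    using k2 conn_in1[OF cB1] by (intro conn_edge) (auto simp: B_def)
  moreover have "conn UNIV B v2 q2" by (rule conn_mono[OF cB1]) (auto simp: B_def)
  ultimately have cB: "conn UNIV B (0, y2) (fst q2, 2 * n)"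
    using up(2) by (metis conn_trans prod.collapse)
  have sqr: "left_square n \<subseteq> wide_rect n" using n unfolding left_square_def wide_rect_def by auto
  have "A \<subseteq> wide_rect n" "B \<subseteq> wide_rect n"
    using AB1 Ksub sqr vflip_wide_rect[of n] unfolding A_def B_def free_region_def by blast+
  then have "A \<inter> B \<noteq> {}"
    unfolding wide_rect_def by (rule lattice_corner_crossing[OF _ _ cA cB]) (use y y2 in simp)
  moreover have False if "x \<in> K" "vflip n x \<in> K" for x
    using subsetD[OF Ksub that(1)] subsetD[OF Ksub that(2)] by (auto simp: vflip_def left_square_def)
  ultimately obtain w where "w \<in> A1" "w \<in> B1" using AB1 unfolding A_def B_def free_region_def by blast
  then have "conn \<omega> (free_region n K) q q2"
    using lo up unfolding A1_def B1_def by (blast intro: conn_trans conn_sym)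
  then show False using noTB lo up by blast
qed

lemma depends_on_mono: "depends_on A F \<Longrightarrow> F \<subseteq> F' \<Longrightarrow> depends_on A F'"
  unfolding depends_on_def by (metis Int_assoc inf.absorb_iff2)

lemma lower_link_depends: "depends_on (\<lambda>\<omega>. \<not> lower_link n K \<omega>) (edges (free_region n K))"
  unfolding depends_on_def lower_link_def by (simp add: conn_restrict)

text \<open>One of the two links is missing with probability at least \<open>1/2\<close>, and they
  are mirror images of each other, hence \<open>1/4\<close>.\<close>

lemma Pr_not_lower_link:
  assumes n: "2 \<le> n" and K: "K = left_cluster n \<eta>" and E: "finite E" "edges (wide_rect n) \<subseteq> E"
  shows "1 / 4 \<le> Pr E (\<lambda>\<omega>. \<not> lower_link n K \<omega>)"
proof -
  define F where "F = edges (wide_rect n)"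
  have F: "finite F" unfolding F_def wide_rect_def by (intro finite_edges) auto
  have dF: "edges (free_region n K) \<subseteq> F" unfolding F_def by (intro edges_mono) (auto simp: free_region_def)
  \<comment> \<open>The wide rectangle has \<open>2 * n - 1\<close> columns and \<open>2 * n\<close>
    rows precisely to match \<open>block_prob_ge_half\<close>.\<close>
  have "1 / 2 \<le> block_prob (2 * n - 1) (2 * n - 1 + 1)" using n by (intro block_prob_ge_half) simp
  also have "\<dots> = Pr F (\<lambda>\<omega>. \<not> top_bottom 0 (2 * n - 2) 1 (2 * n) \<omega>)"
    using Pr_not_top_bottom[OF F, of 0 "2 * n - 2" 1 "2 * n"] unfolding F_def wide_rect_def by simp
  also have "\<dots> \<le> Pr F (\<lambda>\<omega>. \<not> lower_link n K \<omega> \<or> \<not> upper_link n K \<omega>)"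
    by (rule Pr_mono) (use not_lower_and_upper_link[OF n K] in blast)
  also have "\<dots> \<le> Pr F (\<lambda>\<omega>. \<not> lower_link n K \<omega>) + Pr F (\<lambda>\<omega>. \<not> upper_link n K \<omega>)" by (rule Pr_disj_le)
  also have "Pr F (\<lambda>\<omega>. \<not> upper_link n K \<omega>) = Pr F (\<lambda>\<omega>. \<not> lower_link n K \<omega>)"
    using Pr_grid_iso[OF vflip_iso, of n "wide_rect n" "\<lambda>\<omega>. \<not> lower_link n K \<omega>"]
    unfolding vflip_wide_rect lower_link_vflip F_def by simp
  also have "Pr F (\<lambda>\<omega>. \<not> lower_link n K \<omega>) = Pr E (\<lambda>\<omega>. \<not> lower_link n K \<omega>)"
    using E dF unfolding F_def
    by (intro Pr_restrict[symmetric] depends_on_mono[OF lower_link_depends]) auto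
  finally show ?thesis by simp
qed

lemma left_cluster_depends:
  "depends_on (\<lambda>\<omega>. left_cluster n \<omega> = K) {e \<in> edges (left_square n). e \<inter> K \<noteq> {}}"
  unfolding depends_on_def
proof
  fix \<omega>
  define F where "F = {e \<in> edges (left_square n). e \<inter> K \<noteq> {}}"
  have "left_cluster n (\<omega> \<inter> F) = K" if "left_cluster n \<omega> = K"
    using that cluster_cong[of "left_square n" \<omega> "{0} \<times> UNIV" "\<omega> \<inter> F"] unfolding left_cluster_def F_def by blast
  moreover have "left_cluster n \<omega> = K" if "left_cluster n (\<omega> \<inter> F) = K"
    using that cluster_cong[of "left_square n" "\<omega> \<inter> F" "{0} \<times> UNIV" \<omega>] unfolding left_cluster_def F_def by blast
  ultimately show "(left_cluster n (\<omega> \<inter> {e \<in> edges (left_square n). e \<inter> K \<noteq> {}}) = K) = (left_cluster n \<omega> = K)"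
    unfolding F_def by blast
qed

lemma Pr_blocked:
  assumes n: "2 \<le> n" and E: "finite E" "edges (wide_rect n) \<subseteq> E"
  shows "1 / 8 \<le> Pr E (blocked n)"
proof -
  \<comment> \<open>The first clause says that the square is not crossed, which costs
    \<open>1/2\<close>; the second supplies the \<open>\<eta>\<close> that
    \<open>Pr_not_lower_link\<close> asks for.\<close>
  define G where "G K \<longleftrightarrow> (\<forall>v\<in>K. fst v \<noteq> n) \<and> K \<in> range (left_cluster n)" for K
  have "1 / 4 * Pr E (\<lambda>\<omega>. G (left_cluster n \<omega>)) \<le> Pr E (\<lambda>\<omega>. G (left_cluster n \<omega>) \<and> \<not> lower_link n (left_cluster n \<omega>) \<omega>)"
  proof (rule Pr_partition_ge[OF E(1)])
    fix K assume "G K"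
    then obtain \<eta> where K: "K = left_cluster n \<eta>" unfolding G_def by blast
    have "e \<inter> K = {}" if "e \<in> edges (free_region n K)" for e
      using that by (cases rule: edges_cases) (auto simp: free_region_def)
    then have "{e \<in> edges (left_square n). e \<inter> K \<noteq> {}} \<inter> edges (free_region n K) = {}" by blast
    then have "Pr E (\<lambda>\<omega>. left_cluster n \<omega> = K \<and> \<not> lower_link n K \<omega>) = Pr E (\<lambda>\<omega>. left_cluster n \<omega> = K) * Pr E (\<lambda>\<omega>. \<not> lower_link n K \<omega>)"
      by (rule Pr_indep[OF E(1) left_cluster_depends lower_link_depends])
    moreover have "Pr E (\<lambda>\<omega>. left_cluster n \<omega> = K) * (1 / 4) \<le> Pr E (\<lambda>\<omega>. left_cluster n \<omega> = K) * Pr E (\<lambda>\<omega>. \<not> lower_link n K \<omega>)"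
      by (intro mult_left_mono Pr_not_lower_link[OF n K E] Pr_nonneg)
    ultimately show "1 / 4 * Pr E (\<lambda>\<omega>. left_cluster n \<omega> = K) \<le> Pr E (\<lambda>\<omega>. left_cluster n \<omega> = K \<and> \<not> lower_link n K \<omega>)" by simp
  qed simp
  moreover have "Pr E (\<lambda>\<omega>. G (left_cluster n \<omega>) \<and> \<not> lower_link n (left_cluster n \<omega>) \<omega>) = Pr E (blocked n)"
    unfolding G_def blocked_def by (intro Pr_cong) auto
  moreover have "Pr E (\<lambda>\<omega>. G (left_cluster n \<omega>)) = Pr E (\<lambda>\<omega>. \<not> left_right 0 n 1 n \<omega>)"
    by (intro Pr_cong) (auto simp: G_def left_right_def left_cluster_def cluster_def left_square_def)
  moreover have "\<dots> = block_prob n (n + 1)"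
  proof -
    have "edges ({0..n} \<times> {1..n}) \<subseteq> edges (wide_rect n)" using n by (intro edges_mono) (auto simp: wide_rect_def)
    then show ?thesis using Pr_not_left_right[OF E(1), of 0 n 1 n] E(2) by simp
  qed
  ultimately show ?thesis using block_prob_ge_half[of n] n by simp
qed

text \<open>The event \<open>blocked\<close> is not monotone, because it refers to the explored cluster; Harris' inequality
  is applied to its decreasing closure.\<close>

definition blocked_closure :: "int \<Rightarrow> vertex set set \<Rightarrow> bool" where
  "blocked_closure n \<omega> \<longleftrightarrow> (\<exists>\<omega>'. \<omega> \<subseteq> \<omega>' \<and> blocked n \<omega>')"

text \<open>An open path leaving the bottom side outside the explored cluster \<open>K\<close> is trapped in the free
  region: it cannot enter \<open>K\<close>, which is closed under open edges of the square, except from above, and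
  there it would have met the mirror image of \<open>K\<close> first.\<close>

lemma blocked_bottom:
  assumes n: "1 \<le> n" and b: "blocked n \<omega>" and T: "conn \<omega> ({a..2 * n - 2} \<times> {1..2 * n}) z t"
    and z: "0 \<le> fst z" "snd z = 1" and t: "snd t = 2 * n"
  shows "z \<in> left_cluster n \<omega>"
proof (rule ccontr)
  assume zK: "z \<notin> left_cluster n \<omega>"
  define K where "K = left_cluster n \<omega>"
  have Ksub: "K \<subseteq> left_square n" unfolding K_def left_cluster_def by (rule cluster_sub)
  \<comment> \<open>The left column lies in \<open>K\<close> and its mirror image. The strip may
    extend to the left of \<open>0\<close>, and this is what keeps the path from getting
    there.\<close>
  have K0: "(0, y) \<in> K" if "y \<in> {1..n}" for y
    using that n unfolding K_def left_cluster_def cluster_def left_square_def by (auto intro!: exI[of _ y] conn_refl)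
  have K0': "(0, y) \<in> vflip n ` K" if "y \<in> {n + 1..2 * n}" for y
    using K0[of "2 * n + 1 - y"] that by (intro image_eqI[of _ _ "(0, 2 * n + 1 - y)"]) (auto simp: vflip_def)
  have zT: "z \<in> {a..2 * n - 2} \<times> {1..2 * n}" by (rule conn_in1[OF T])
  have bad: False if "conn \<omega> (free_region n K) z v" "snd v = 2 * n \<or> (\<exists>u\<in>vflip n ` K. grid_adj u v)" for v
    using b that z conn_sym[OF that(1)] unfolding blocked_def lower_link_def K_def by blast
  from T have "conn \<omega> (free_region n K) z t"
  proof (induction rule: conn_induct)
    case base
    have "snd (vflip n k) \<noteq> 1" if "k \<in> K" for k
      using subsetD[OF Ksub that] n by (auto simp: vflip_def left_square_def)
    then have "z \<notin> vflip n ` K" using z by auto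
    then show ?case using zT z zK by (intro conn_refl) (auto simp: free_region_def K_def wide_rect_def mem_Times_iff)
  next
    case (step v w)
    have v: "v \<in> free_region n K" by (rule conn_in2[OF step.IH])
    have wK': "w \<notin> vflip n ` K" using bad[OF step.IH] step.hyps grid_adj_sym by blast
    have wK: "w \<notin> K"
    proof
      assume w: "w \<in> K"
      show False
      proof (cases "v \<in> left_square n")
        case True
        then have "v \<in> K" using w step.hyps cluster_step[of w \<omega> "left_square n" _ v]
          unfolding K_def left_cluster_def by (simp add: grid_adj_sym insert_commute)
        then show False using v unfolding free_region_def by blast
      next
        case False
        obtain x y x' y' where xy: "v = (x, y)" "w = (x', y')" by (cases v; cases w)
        have "x' \<noteq> n" using b w unfolding blocked_def K_def xy by auto
        moreover have "x' \<in> {0..n}" "y' \<in> {1..n}" using w Ksub unfolding xy left_square_def by auto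
        moreover have "x \<in> {0..2 * n - 2}" "y \<in> {1..2 * n}" using v unfolding free_region_def wide_rect_def xy by auto
        moreover have "\<not> (x \<in> {0..n} \<and> y \<in> {1..n})" using False unfolding left_square_def xy by auto
        ultimately have "x = x'" "y = n + 1" "y' = n"
          using \<open>grid_adj v w\<close> unfolding xy grid_adj_def by auto
        then have "v = vflip n w" unfolding xy vflip_def by simp
        then show False using v w unfolding free_region_def by blast
      qed
    qed
    have "w \<in> wide_rect n"
    proof (rule ccontr)
      assume "w \<notin> wide_rect n"
      obtain x y x' y' where xy: "v = (x, y)" "w = (x', y')" by (cases v; cases w)
      have "x \<in> {0..2 * n - 2}" "y \<in> {1..2 * n}" using v unfolding free_region_def wide_rect_def xy by auto
      moreover have "\<not> (0 \<le> x')" using \<open>w \<notin> wide_rect n\<close> step.hyps unfolding wide_rect_def xy by auto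
      ultimately have "x = 0" using \<open>grid_adj v w\<close> unfolding xy grid_adj_def by auto
      moreover have "y \<le> n \<or> n + 1 \<le> y" by linarith
      ultimately show False using v K0[of y] K0'[of y] \<open>y \<in> {1..2 * n}\<close> unfolding free_region_def xy by auto
    qed
    then have "w \<in> free_region n K" using wK wK' unfolding free_region_def by blast
    then have "conn \<omega> (free_region n K) v w" using v step.hyps by (intro conn_edge)
    with step.IH show ?case by (rule conn_trans)
  qed
  then show False using bad t by blast
qed

text \<open>The square and its mirror image overlap in the columns \<open>2..n\<close>, a block with
  \<open>n - 1\<close> columns and \<open>n\<close> rows, again the self-dual shape of
  \<open>block_prob_ge_half\<close>.\<close>

definition hflip :: "int \<Rightarrow> vertex \<Rightarrow> vertex" where "hflip n v = (n + 2 - fst v, snd v)"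

lemma hflip_iso: "grid_iso (hflip n)"
  by (rule grid_isoI[where g = "hflip n"]) (auto simp: hflip_def grid_adj_def)

lemma hflip_rect: "hflip n ` ({4 - n..2 * n - 2} \<times> C) = {4 - n..2 * n - 2} \<times> C"
proof -
  have "v \<in> hflip n ` ({4 - n..2 * n - 2} \<times> C)" if "v \<in> {4 - n..2 * n - 2} \<times> C" for v
    using that by (intro image_eqI[of _ _ "hflip n v"]) (auto simp: hflip_def)
  then show ?thesis by (auto simp: hflip_def)
qed

text \<open>The blocked configurations \<open>\<omega>1\<close> and \<open>\<omega>2\<close> may
  differ, but an open path of \<open>\<omega>\<close> is open in the first and its mirror image in
  the second, so \<open>blocked_bottom\<close> applies to both. The path starts in both clusters and
  can then not get out of the overlap of the two squares.\<close>

lemma blocked_closure_glue: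
  assumes n: "4 \<le> n" and b1: "blocked_closure n \<omega>" and b2: "blocked_closure n ((`) (hflip n) ` \<omega>)" and nt: "\<not> top_bottom 2 n 1 n \<omega>"
  shows "\<not> top_bottom (4 - n) (2 * n - 2) 1 (2 * n) \<omega>"
proof
  define T where "T = {4 - n..2 * n - 2} \<times> {1..2 * n}"
  assume "top_bottom (4 - n) (2 * n - 2) 1 (2 * n) \<omega>"
  then obtain z t where zt: "snd z = 1" "snd t = 2 * n" "conn \<omega> T z t" unfolding top_bottom_def T_def by blast
  obtain \<omega>1 where w1: "\<omega> \<subseteq> \<omega>1" "blocked n \<omega>1" using b1 unfolding blocked_closure_def by blast
  obtain \<omega>2 where w2: "(`) (hflip n) ` \<omega> \<subseteq> \<omega>2" "blocked n \<omega>2" using b2 unfolding blocked_closure_def by blast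
  have c1: "conn \<omega>1 T z t" by (rule conn_mono[OF zt(3) w1(1) order_refl])
  have "conn ((`) (hflip n) ` \<omega>) (hflip n ` T) (hflip n z) (hflip n t)"
    using zt(3) grid_iso_conn[OF hflip_iso] by blast
  then have c2: "conn \<omega>2 T (hflip n z) (hflip n t)"
    unfolding T_def hflip_rect by (rule conn_mono[OF _ w2(1) order_refl])
  have L1: "z \<in> left_cluster n \<omega>1" if "0 \<le> fst z"
    using blocked_bottom[OF _ w1(2) c1[unfolded T_def]] that zt n by simp
  have L2: "hflip n z \<in> left_cluster n \<omega>2" if "fst z \<le> n + 2"
    using blocked_bottom[OF _ w2(2) c2[unfolded T_def]] that zt n by (simp add: hflip_def)
  have sub: "left_cluster n \<eta> \<subseteq> left_square n" for \<eta> unfolding left_cluster_def by (rule cluster_sub)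
  have z: "2 \<le> fst z" "fst z \<le> n"
    using L1 L2 sub[of \<omega>1] sub[of \<omega>2] n unfolding left_square_def hflip_def by fastforce+
  define I where "I = {2..n} \<times> {1..n}"
  from zt(3) have "conn \<omega> I z t \<and> t \<in> left_cluster n \<omega>1 \<and> hflip n t \<in> left_cluster n \<omega>2"
  proof (induction rule: conn_induct)
    case base
    then show ?case using z zt L1 L2 n by (auto intro!: conn_refl simp: I_def mem_Times_iff)
  next
    case (step v w)
    then have c: "conn \<omega> I z v" and v1: "v \<in> left_cluster n \<omega>1" and v2: "hflip n v \<in> left_cluster n \<omega>2" by auto
    have vI: "v \<in> I" by (rule conn_in2[OF c])
    \<comment> \<open>The exits: upwards is excluded by \<open>nt\<close>, to the right because the
      first cluster misses column \<open>n\<close>, to the left because the mirrored second one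
      misses column \<open>2\<close>.\<close>
    have "snd v \<noteq> n" using nt c zt(1) unfolding top_bottom_def I_def by blast
    moreover have "fst v \<noteq> n" using w1(2) v1 unfolding blocked_def by blast
    moreover have "fst v \<noteq> 2" using w2(2) v2 unfolding blocked_def hflip_def by force
    ultimately have wI: "w \<in> I"
      using vI \<open>w \<in> T\<close> \<open>grid_adj v w\<close> unfolding I_def T_def grid_adj_def by (cases v; cases w) auto
    have "conn \<omega> I v w" using vI wI step.hyps by (intro conn_edge)
    moreover have "w \<in> left_cluster n \<omega>1"
      using v1 unfolding left_cluster_def
      by (rule cluster_step) (use step.hyps wI w1(1) in \<open>auto simp: left_square_def I_def\<close>)
    moreover have "hflip n w \<in> left_cluster n \<omega>2"
    proof -
      have e: "hflip n ` {v, w} \<in> \<omega>2" using w2(1) step.hyps by blast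
      show ?thesis
        using v2 unfolding left_cluster_def
      proof (rule cluster_step)
        show "hflip n w \<in> left_square n" using wI by (auto simp: left_square_def I_def hflip_def)
        show "grid_adj (hflip n v) (hflip n w)" using \<open>grid_adj v w\<close> hflip_iso[of n] unfolding grid_iso_def by blast
        show "{hflip n v, hflip n w} \<in> \<omega>2" using e by simp
      qed
    qed
    ultimately show ?case using c conn_trans by blast
  qed
  then have "t \<in> I" by (blast dest: conn_in2)
  then show False using zt n unfolding I_def by auto
qed

lemma block_prob_long:
  assumes n: "4 \<le> n"
  shows "1 / 2 ^ 7 \<le> block_prob (3 * n - 5) (2 * n)"
proof -
  define T where "T = {4 - n..2 * n - 2} \<times> {1..2 * n}"
  define E where "E = edges T"
  have E: "finite E" unfolding E_def T_def by (intro finite_edges) auto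
  have rcE: "edges (wide_rect n) \<subseteq> E" unfolding E_def T_def wide_rect_def using n by (intro edges_mono) auto
  have IE: "edges ({2..n} \<times> {1..n}) \<subseteq> E" unfolding E_def T_def using n by (intro edges_mono) auto
  have dm: "blocked_closure n x" if "x \<subseteq> y" "blocked_closure n y" for x y
    using that unfolding blocked_closure_def by (meson order_trans)
  have am: "antimono (blocked_closure n)" "antimono (\<lambda>\<omega>. blocked_closure n ((`) (hflip n) ` \<omega>))"
    by (rule antimono_boolI, erule (1) dm, rule antimono_boolI, erule dm[OF image_mono])
  have p1: "1 / 8 \<le> Pr E (blocked_closure n)"
    using Pr_blocked[OF _ E rcE] n Pr_mono[of E "blocked n" "blocked_closure n"] unfolding blocked_closure_def by force
  have p2: "Pr E (\<lambda>\<omega>. blocked_closure n ((`) (hflip n) ` \<omega>)) = Pr E (blocked_closure n)"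
    using Pr_grid_iso[OF hflip_iso, of n T "blocked_closure n"] unfolding E_def T_def hflip_rect by simp
  have p3: "1 / 2 \<le> Pr E (\<lambda>\<omega>. \<not> top_bottom 2 n 1 n \<omega>)"
    using block_prob_ge_half[of "n - 1"] Pr_not_top_bottom[OF E IE] n by simp
  \<comment> \<open>Two reflected blocking events at \<open>1/8\<close> each, and the self-dual
    overlap at \<open>1/2\<close>.\<close>
  have "1 / 2 ^ 7 \<le> (1 / 8 * (1 / 8)) * (1 / 2 :: real)" by simp
  also have "\<dots> \<le> (Pr E (blocked_closure n) * Pr E (\<lambda>\<omega>. blocked_closure n ((`) (hflip n) ` \<omega>))) * Pr E (\<lambda>\<omega>. \<not> top_bottom 2 n 1 n \<omega>)"
    using p1 p3 unfolding p2 by (intro mult_mono) auto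
  also have "\<dots> \<le> Pr E (\<lambda>\<omega>. blocked_closure n \<omega> \<and> blocked_closure n ((`) (hflip n) ` \<omega>)) * Pr E (\<lambda>\<omega>. \<not> top_bottom 2 n 1 n \<omega>)"
    by (intro mult_right_mono Harris E am Pr_nonneg)
  also have "\<dots> \<le> Pr E (\<lambda>\<omega>. (blocked_closure n \<omega> \<and> blocked_closure n ((`) (hflip n) ` \<omega>)) \<and> \<not> top_bottom 2 n 1 n \<omega>)"
    by (intro Harris E am antimono_conj antimono_not_top_bottom)
  also have "\<dots> \<le> Pr E (\<lambda>\<omega>. \<not> top_bottom (4 - n) (2 * n - 2) 1 (2 * n) \<omega>)"
    by (rule Pr_mono) (use blocked_closure_glue[OF n] in blast)
  also have "\<dots> = block_prob (3 * n - 5) (2 * n)"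
    using Pr_not_top_bottom[OF E, of "4 - n" "2 * n - 2" 1 "2 * n"] unfolding E_def T_def by simp
  finally show ?thesis .
qed

text \<open>A path with a vertex left of column \<open>a\<close> cannot get beyond column
  \<open>b\<close> without crossing the overlap, so it stays in the left rectangle; likewise on the
  right. A path with neither kind of vertex lies in the overlap, hence in the left rectangle
  too.\<close>

lemma not_top_bottom_glue:
  assumes ab: "a \<le> b"
    and l: "\<not> top_bottom 1 b 1 h \<omega>" and r: "\<not> top_bottom a W 1 h \<omega>" and o: "\<not> left_right a b 1 h \<omega>" and W: "1 \<le> a" "b \<le> W"
  shows "\<not> top_bottom 1 W 1 h \<omega>"
proof
  define V where "V = {1..W} \<times> {1..h}"
  define L where "L = {1..b} \<times> {1..h}"
  define R where "R = {a..W} \<times> {1..h}"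
  define M where "M = {a..b} \<times> {1..h}"
  have c1: "conn \<omega> L v w" if "conn \<omega> V v w" "fst v < a" for v w
  proof -
    \<comment> \<open>The second conjunct remembers the last entry into the overlap; at column
      \<open>b\<close> it would yield a left-right crossing.\<close>
    from that(1) have "conn \<omega> L v w \<and> (a \<le> fst w \<longrightarrow> (\<exists>l. fst l = a \<and> conn \<omega> M l w))"
    proof (induction rule: conn_induct)
      case base
      then show ?case using that(2) ab by (auto intro!: conn_refl simp: V_def L_def)
    next
      case (step u w)
      then have c: "conn \<omega> L v u" and m: "a \<le> fst u \<Longrightarrow> \<exists>l. fst l = a \<and> conn \<omega> M l u" by auto
      have uL: "u \<in> L" by (rule conn_in2[OF c])
      have "fst u \<noteq> b" using m o ab unfolding left_right_def M_def by blast
      then have wL: "w \<in> L"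
        using uL \<open>w \<in> V\<close> \<open>grid_adj u w\<close> unfolding L_def V_def grid_adj_def by (cases u; cases w) auto
      have "conn \<omega> L u w" using uL wL step.hyps by (intro conn_edge)
      moreover have "\<exists>l. fst l = a \<and> conn \<omega> M l w" if w: "a \<le> fst w"
      proof (cases "a \<le> fst u")
        case True
        then obtain l where "fst l = a" "conn \<omega> M l u" using m by blast
        moreover have "conn \<omega> M u w" using uL wL w True step.hyps
          by (intro conn_edge) (auto simp: L_def M_def)
        ultimately show ?thesis using conn_trans by blast
      next
        case False
        then have "fst w = a" using w \<open>grid_adj u w\<close> unfolding grid_adj_def by linarith
        then show ?thesis using wL ab by (intro exI[of _ w]) (auto intro!: conn_refl simp: L_def M_def)
      qed
      ultimately show ?case using c conn_trans by blast
    qed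
    then show ?thesis by blast
  qed
  have c2: "conn \<omega> R v w" if "conn \<omega> V v w" "b < fst v" for v w
  proof -
    from that(1) have "conn \<omega> R v w \<and> (fst w \<le> b \<longrightarrow> (\<exists>l. fst l = b \<and> conn \<omega> M l w))"
    proof (induction rule: conn_induct)
      case base
      then show ?case using that(2) ab by (auto intro!: conn_refl simp: V_def R_def)
    next
      case (step u w)
      then have c: "conn \<omega> R v u" and m: "fst u \<le> b \<Longrightarrow> \<exists>l. fst l = b \<and> conn \<omega> M l u" by auto
      have uR: "u \<in> R" by (rule conn_in2[OF c])
      have "fst u \<noteq> a" using m o ab conn_sym unfolding left_right_def M_def by blast
      then have wR: "w \<in> R"
        using uR \<open>w \<in> V\<close> \<open>grid_adj u w\<close> unfolding R_def V_def grid_adj_def by (cases u; cases w) auto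
      have "conn \<omega> R u w" using uR wR step.hyps by (intro conn_edge)
      moreover have "\<exists>l. fst l = b \<and> conn \<omega> M l w" if w: "fst w \<le> b"
      proof (cases "fst u \<le> b")
        case True
        then obtain l where "fst l = b" "conn \<omega> M l u" using m by blast
        moreover have "conn \<omega> M u w" using uR wR w True step.hyps
          by (intro conn_edge) (auto simp: R_def M_def)
        ultimately show ?thesis using conn_trans by blast
      next
        case False
        then have "fst w = b" using w \<open>grid_adj u w\<close> unfolding grid_adj_def by linarith
        then show ?thesis using wR ab by (intro exI[of _ w]) (auto intro!: conn_refl simp: R_def M_def)
      qed
      ultimately show ?case using c conn_trans by blast
    qed
    then show ?thesis by blast
  qed
  assume "top_bottom 1 W 1 h \<omega>"
  then obtain p q where pq: "snd p = 1" "snd q = h" "conn \<omega> V p q" unfolding top_bottom_def V_def by blast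
  have in_L: False if "conn \<omega> L p q" using l pq that unfolding top_bottom_def L_def by blast
  have noL: "\<not> fst w < a" if "conn \<omega> V p w" for w
  proof
    assume "fst w < a"
    then have "conn \<omega> L w p" "conn \<omega> L w q" using c1 that pq(3) conn_sym conn_trans by blast+
    then show False using in_L conn_sym conn_trans by blast
  qed
  have noR: "\<not> b < fst w" if "conn \<omega> V p w" for w
  proof
    assume "b < fst w"
    then have "conn \<omega> R w p" "conn \<omega> R w q" using c2 that pq(3) conn_sym conn_trans by blast+
    then have "conn \<omega> R p q" using conn_sym conn_trans by blast
    then show False using r pq unfolding top_bottom_def R_def by blast
  qed
  from pq(3) have "conn \<omega> L p q"
  proof (induction rule: conn_induct)
    case base
    then show ?case using noR[OF conn_refl[of p V]] by (intro conn_refl) (auto simp: V_def L_def)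
  next
    case (step u w)
    have "conn \<omega> V p w" using step.hyps conn_trans conn_edge by blast
    then have "w \<in> L" using noR[of w] \<open>w \<in> V\<close> by (auto simp: V_def L_def)
    moreover have "u \<in> L" by (rule conn_in2[OF step.IH])
    ultimately have "conn \<omega> L u w" using step.hyps by (intro conn_edge)
    with step.IH show ?case by (rule conn_trans)
  qed
  then show False by (rule in_L)
qed

lemma block_prob_nonneg: "0 \<le> block_prob w h"
  unfolding block_prob_def by (rule Pr_nonneg)

text \<open>The overlap gets \<open>h + 1\<close> columns and \<open>h\<close> rows, so that it is
  left uncrossed with probability at least \<open>1/2\<close>.\<close>

lemma block_prob_glue:
  assumes h: "1 \<le> h" "h + 1 \<le> w1" "h + 1 \<le> w2"
  shows "block_prob w1 h * block_prob w2 h / 2 \<le> block_prob (w1 + w2 - h - 1) h"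
proof -
  define W where "W = w1 + w2 - h - 1"
  define E where "E = edges ({1..W} \<times> {1..h})"
  have E: "finite E" unfolding E_def by (intro finite_edges) auto
  have sub: "edges ({1..w1} \<times> {1..h}) \<subseteq> E" "edges ({w1 - h..W} \<times> {1..h}) \<subseteq> E" "edges ({w1 - h..w1} \<times> {1..h}) \<subseteq> E"
    unfolding E_def W_def using h by (auto intro!: edges_mono)
  have p: "Pr E (\<lambda>\<omega>. \<not> top_bottom 1 w1 1 h \<omega>) = block_prob w1 h" "Pr E (\<lambda>\<omega>. \<not> top_bottom (w1 - h) W 1 h \<omega>) = block_prob w2 h"
    "Pr E (\<lambda>\<omega>. \<not> left_right (w1 - h) w1 1 h \<omega>) = block_prob h (h + 1)"
    using Pr_not_top_bottom[OF E sub(1)] Pr_not_top_bottom[OF E sub(2)] Pr_not_left_right[OF E sub(3)] by (simp_all add: W_def)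
  have "block_prob w1 h * block_prob w2 h / 2 \<le> (Pr E (\<lambda>\<omega>. \<not> top_bottom 1 w1 1 h \<omega>) * Pr E (\<lambda>\<omega>. \<not> top_bottom (w1 - h) W 1 h \<omega>))
      * Pr E (\<lambda>\<omega>. \<not> left_right (w1 - h) w1 1 h \<omega>)"
    using mult_left_mono[OF block_prob_ge_half[OF h(1)], of "block_prob w1 h * block_prob w2 h"] block_prob_nonneg unfolding p by simp
  also have "\<dots> \<le> Pr E (\<lambda>\<omega>. \<not> top_bottom 1 w1 1 h \<omega> \<and> \<not> top_bottom (w1 - h) W 1 h \<omega>) * Pr E (\<lambda>\<omega>. \<not> left_right (w1 - h) w1 1 h \<omega>)"
    by (intro mult_right_mono Harris E antimono_not_top_bottom Pr_nonneg)
  also have "\<dots> \<le> Pr E (\<lambda>\<omega>. (\<not> top_bottom 1 w1 1 h \<omega> \<and> \<not> top_bottom (w1 - h) W 1 h \<omega>) \<and> \<not> left_right (w1 - h) w1 1 h \<omega>)"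
    by (intro Harris E antimono_not_top_bottom antimono_not_left_right antimono_conj)
  also have "\<dots> \<le> Pr E (\<lambda>\<omega>. \<not> top_bottom 1 W 1 h \<omega>)"
    by (rule Pr_mono) (use not_top_bottom_glue[of "w1 - h" w1 h _ W] h in \<open>auto simp: W_def\<close>)
  also have "\<dots> = block_prob W h" unfolding E_def block_prob_def ..
  finally show ?thesis unfolding W_def .
qed

text \<open>Seven gluing steps, each costing a factor \<open>2 ^ 8\<close>, start from \<open>block_prob_long\<close>.\<close>

lemma block_prob_three:
  assumes n: "12 \<le> n"
  shows "1 / 2 ^ 63 \<le> block_prob (6 * n + 1) (2 * n)"
proof -
  have "1 / 2 ^ (7 + 8 * j) \<le> block_prob (3 * n - 5 + int j * (n - 6)) (2 * n)" for j
  proof (induction j)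
    case 0
    then show ?case using block_prob_long[of n] n by simp
  next
    case (Suc j)
    have "0 \<le> int j * (n - 6)" using n by simp
    then have w: "2 * n + 1 \<le> 3 * n - 5 + int j * (n - 6)" "2 * n + 1 \<le> 3 * n - 5" using n by linarith+
    have "(1 / 2 ^ (7 + 8 * j)) * (1 / 2 ^ 7) / 2 \<le> block_prob (3 * n - 5 + int j * (n - 6)) (2 * n) * block_prob (3 * n - 5) (2 * n) / 2"
      using Suc.IH block_prob_long[of n] n by (intro divide_right_mono mult_mono) (auto simp: block_prob_nonneg)
    also have "\<dots> \<le> block_prob (3 * n - 5 + int j * (n - 6) + (3 * n - 5) - 2 * n - 1) (2 * n)"
      using w n by (intro block_prob_glue) auto
    also have "3 * n - 5 + int j * (n - 6) + (3 * n - 5) - 2 * n - 1 = 3 * n - 5 + int (Suc j) * (n - 6)"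
      by (simp add: algebra_simps)
    finally show ?case by (simp add: power_add)
  qed
  \<comment> \<open>The width \<open>10 * n - 47\<close> reaches \<open>6 * n + 1\<close> exactly
    when \<open>n \<ge> 12\<close>. The target \<open>6 * n + 1\<close> by \<open>2 * n\<close> is
    one side of the annulus between the boxes of radius \<open>n\<close> and
    \<open>3 * n\<close>.\<close>
  from this[of 7] have "1 / 2 ^ 63 \<le> block_prob (3 * n - 5 + 7 * (n - 6)) (2 * n)" by simp
  also have "\<dots> \<le> block_prob (6 * n + 1) (2 * n)" using n by (intro block_prob_antimono) auto
  finally show ?thesis .
qed

section \<open>One-arm events\<close>

definition centred_box :: "int \<Rightarrow> vertex set" where "centred_box r = {-r..r} \<times> {-r..r}"

definition arm_event :: "int \<Rightarrow> vertex set set \<Rightarrow> bool" where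
  "arm_event r \<omega> \<longleftrightarrow> (\<exists>w. (\<bar>fst w\<bar> = r \<or> \<bar>snd w\<bar> = r) \<and> conn \<omega> (centred_box r) (0, 0) w)"

definition arm_prob :: "int \<Rightarrow> real" where "arm_prob r = Pr (edges (centred_box r)) (arm_event r)"

lemma finite_edges_centred_box: "finite (edges (centred_box r))"
  unfolding centred_box_def by (intro finite_edges) auto

lemma arm_prob_nonneg: "0 \<le> arm_prob r"
  unfolding arm_prob_def by (rule Pr_nonneg)

lemma arm_prob_le_1: "arm_prob r \<le> 1"
  unfolding arm_prob_def by (rule Pr_le_1[OF finite_edges_centred_box])

text \<open>The path is cut where it first meets the boundary of the box, before it can
  leave.\<close>

lemma arm_eventI:
  assumes "conn \<omega> V (0, 0) w" "0 \<le> r" "r \<le> \<bar>fst w\<bar> \<or> r \<le> \<bar>snd w\<bar>"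
  shows "arm_event r \<omega>"
proof -
  from assms(1) have "arm_event r \<omega> \<or> conn \<omega> (centred_box r) (0, 0) w"
  proof (induction rule: conn_induct)
    case base
    then show ?case using assms(2) by (auto intro!: conn_refl simp: centred_box_def)
  next
    case (step v w)
    show ?case
    proof (cases "arm_event r \<omega>")
      case False
      then have c: "conn \<omega> (centred_box r) (0, 0) v" using step.IH by blast
      then have v: "v \<in> centred_box r" by (rule conn_in2)
      have "\<bar>fst v\<bar> \<noteq> r" "\<bar>snd v\<bar> \<noteq> r" using False c unfolding arm_event_def by blast+
      then have "w \<in> centred_box r" using v \<open>grid_adj v w\<close> unfolding centred_box_def grid_adj_def mem_Times_iff by auto
      then have "conn \<omega> (centred_box r) v w" using v step.hyps by (intro conn_edge)
      then show ?thesis using c conn_trans by blast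
    qed simp
  qed
  then show ?thesis
  proof
    assume c: "conn \<omega> (centred_box r) (0, 0) w"
    then have "w \<in> centred_box r" by (rule conn_in2)
    then have "\<bar>fst w\<bar> = r \<or> \<bar>snd w\<bar> = r" using assms(3) unfolding centred_box_def mem_Times_iff by auto
    then show ?thesis using c unfolding arm_event_def by blast
  qed
qed

lemma arm_prob_antimono:
  assumes "0 \<le> r" "r \<le> s"
  shows "arm_prob s \<le> arm_prob r"
proof -
  have "arm_prob s \<le> Pr (edges (centred_box s)) (arm_event r)"
    unfolding arm_prob_def
  proof (rule Pr_mono)
    fix \<omega> assume "arm_event s \<omega>"
    then show "arm_event r \<omega>" unfolding arm_event_def[of s] using assms by (auto intro!: arm_eventI)
  qed
  also have "\<dots> = arm_prob r"
    unfolding arm_prob_def using assms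
    by (intro Pr_restrict finite_edges_centred_box edges_mono) (auto simp: centred_box_def depends_on_def arm_event_def conn_restrict)
  finally show ?thesis .
qed

lemma conn_last_entry:
  assumes "conn \<omega> V u w" "u \<notin> C" "w \<in> C"
  shows "\<exists>u' w'. u' \<in> V \<and> u' \<notin> C \<and> w' \<in> C \<and> grid_adj u' w' \<and> conn \<omega> (V \<inter> C) w' w"
proof -
  from assms(1) have "w \<in> C \<longrightarrow> ?thesis"
  proof (induction rule: conn_induct)
    case base
    then show ?case using assms(2) by blast
  next
    case (step v w)
    show ?case
    proof (cases "v \<in> C")
      case True
      show ?thesis
      proof
        assume "w \<in> C"
        obtain u' w' where uw: "u' \<in> V" "u' \<notin> C" "w' \<in> C" "grid_adj u' w'" "conn \<omega> (V \<inter> C) w' v"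
          using step.IH True by blast
        have "conn \<omega> (V \<inter> C) v w" using step.hyps True \<open>w \<in> C\<close> by (intro conn_edge) auto
        then have "conn \<omega> (V \<inter> C) w' w" using uw(5) conn_trans by blast
        then show "\<exists>u' w'. u' \<in> V \<and> u' \<notin> C \<and> w' \<in> C \<and> grid_adj u' w' \<and> conn \<omega> (V \<inter> C) w' w"
          using uw by blast
      qed
    next
      case False
      then show ?thesis using step.hyps by (blast intro: conn_refl)
    qed
  qed
  then show ?thesis using assms(3) by blast
qed

text \<open>The arm ends on one of the four sides of the outer box. From its last entry into the
  half-plane beyond the inner box on that side, it crosses the rectangle there the short
  way.\<close>

lemma arm_event_annulus:
  assumes n: "1 \<le> n" and a: "arm_event (3 * n) \<omega>"
  shows "left_right (n + 1) (3 * n) (- 3 * n) (3 * n) \<omega> \<or> left_right (- 3 * n) (- n - 1) (- 3 * n) (3 * n) \<omega> \<or>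
    top_bottom (- 3 * n) (3 * n) (n + 1) (3 * n) \<omega> \<or> top_bottom (- 3 * n) (3 * n) (- 3 * n) (- n - 1) \<omega>"
proof -
  obtain w where w: "\<bar>fst w\<bar> = 3 * n \<or> \<bar>snd w\<bar> = 3 * n" and c: "conn \<omega> (centred_box (3 * n)) (0, 0) w"
    using a unfolding arm_event_def by blast
  have wb: "w \<in> centred_box (3 * n)" by (rule conn_in2[OF c])
  consider "fst w = 3 * n" | "fst w = - 3 * n" | "snd w = 3 * n" | "snd w = - 3 * n" using w by linarith
  then show ?thesis
  proof cases
    case 1
    then obtain u' w' where *: "u' \<notin> {v. n + 1 \<le> fst v}" "w' \<in> {v. n + 1 \<le> fst v}" "grid_adj u' w'"
      "conn \<omega> (centred_box (3 * n) \<inter> {v. n + 1 \<le> fst v}) w' w"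
      using conn_last_entry[OF c, of "{v. n + 1 \<le> fst v}"] n by auto
    have "centred_box (3 * n) \<inter> {v. n + 1 \<le> fst v} = {n + 1..3 * n} \<times> {- 3 * n..3 * n}" using n by (auto simp: centred_box_def)
    moreover have "fst w' = n + 1" using *(1-3) unfolding grid_adj_def by auto
    ultimately show ?thesis using * 1 unfolding left_right_def by metis
  next
    case 2
    then obtain u' w' where *: "u' \<notin> {v. fst v \<le> - n - 1}" "w' \<in> {v. fst v \<le> - n - 1}" "grid_adj u' w'"
      "conn \<omega> (centred_box (3 * n) \<inter> {v. fst v \<le> - n - 1}) w' w"
      using conn_last_entry[OF c, of "{v. fst v \<le> - n - 1}"] n by auto
    have "centred_box (3 * n) \<inter> {v. fst v \<le> - n - 1} = {- 3 * n..- n - 1} \<times> {- 3 * n..3 * n}" using n by (auto simp: centred_box_def)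
    moreover have "fst w' = - n - 1" using *(1-3) unfolding grid_adj_def by auto
    ultimately show ?thesis using * 2 conn_sym unfolding left_right_def by metis
  next
    case 3
    then obtain u' w' where *: "u' \<notin> {v. n + 1 \<le> snd v}" "w' \<in> {v. n + 1 \<le> snd v}" "grid_adj u' w'"
      "conn \<omega> (centred_box (3 * n) \<inter> {v. n + 1 \<le> snd v}) w' w"
      using conn_last_entry[OF c, of "{v. n + 1 \<le> snd v}"] n by auto
    have "centred_box (3 * n) \<inter> {v. n + 1 \<le> snd v} = {- 3 * n..3 * n} \<times> {n + 1..3 * n}" using n by (auto simp: centred_box_def)
    moreover have "snd w' = n + 1" using *(1-3) unfolding grid_adj_def by auto
    ultimately show ?thesis using * 3 unfolding top_bottom_def by metis
  next
    case 4
    then obtain u' w' where *: "u' \<notin> {v. snd v \<le> - n - 1}" "w' \<in> {v. snd v \<le> - n - 1}" "grid_adj u' w'"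
      "conn \<omega> (centred_box (3 * n) \<inter> {v. snd v \<le> - n - 1}) w' w"
      using conn_last_entry[OF c, of "{v. snd v \<le> - n - 1}"] n by auto
    have "centred_box (3 * n) \<inter> {v. snd v \<le> - n - 1} = {- 3 * n..3 * n} \<times> {- 3 * n..- n - 1}" using n by (auto simp: centred_box_def)
    moreover have "snd w' = - n - 1" using *(1-3) unfolding grid_adj_def by auto
    ultimately show ?thesis using * 4 conn_sym unfolding top_bottom_def by metis
  qed
qed

text \<open>By \<open>block_prob_three\<close> and Harris' inequality, all four sides of the annulus
  are blocked with probability at least the subtracted number.\<close>

definition arm_rate :: real where "arm_rate = 1 - (1 / 2 ^ 63) ^ 4"

text \<open>The inner arm uses edges inside the box of radius \<open>n\<close>, the four rectangles
  only vertices outside it, so the two events are independent.\<close>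

lemma arm_prob_triple:
  assumes n: "12 \<le> n"
  shows "arm_prob (3 * n) \<le> arm_rate * arm_prob n"
proof -
  define E where "E = edges (centred_box (3 * n))"
  define S where "S = [{n + 1..3 * n} \<times> {- 3 * n..3 * n}, {- 3 * n..- n - 1} \<times> {- 3 * n..3 * n},
    {- 3 * n..3 * n} \<times> {n + 1..3 * n}, {- 3 * n..3 * n} \<times> {- 3 * n..- n - 1}]"
  define F where "F = (\<Union>X\<in>set S. edges X)"
  define A where "A \<omega> \<longleftrightarrow> \<not> left_right (n + 1) (3 * n) (- 3 * n) (3 * n) \<omega>" for \<omega>
  define B where "B \<omega> \<longleftrightarrow> \<not> left_right (- 3 * n) (- n - 1) (- 3 * n) (3 * n) \<omega>" for \<omega>
  define C where "C \<omega> \<longleftrightarrow> \<not> top_bottom (- 3 * n) (3 * n) (n + 1) (3 * n) \<omega>" for \<omega>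
  define D where "D \<omega> \<longleftrightarrow> \<not> top_bottom (- 3 * n) (3 * n) (- 3 * n) (- n - 1) \<omega>" for \<omega>
  define q where "q = (1 / 2 ^ 63 :: real)"
  have E: "finite E" unfolding E_def by (rule finite_edges_centred_box)
  have sub: "edges X \<subseteq> E" if "X \<in> set S" for X
    unfolding E_def using that n by (intro edges_mono) (auto simp: S_def centred_box_def)
  have p: "q \<le> Pr E A" "q \<le> Pr E B" "q \<le> Pr E C" "q \<le> Pr E D"
    using block_prob_three[OF n] sub unfolding A_def B_def C_def D_def q_def S_def
    by (simp_all add: Pr_not_left_right[OF E] Pr_not_top_bottom[OF E])
  have am: "antimono A" "antimono B" "antimono C" "antimono D"
    unfolding A_def B_def C_def D_def by (rule antimono_not_left_right antimono_not_top_bottom)+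
  have "q ^ 4 = q * q * q * q" by (simp add: power4_eq_xxxx)
  also have "\<dots> \<le> Pr E A * Pr E B * Pr E C * Pr E D"
    by (intro mult_mono p mult_nonneg_nonneg Pr_nonneg) (auto simp: q_def)
  also have "\<dots> \<le> Pr E (\<lambda>\<omega>. A \<omega> \<and> B \<omega>) * Pr E C * Pr E D"
    by (intro mult_right_mono Harris E am Pr_nonneg)
  also have "\<dots> \<le> Pr E (\<lambda>\<omega>. (A \<omega> \<and> B \<omega>) \<and> C \<omega>) * Pr E D"
    by (intro mult_right_mono Harris E am antimono_conj Pr_nonneg)
  also have "\<dots> \<le> Pr E (\<lambda>\<omega>. ((A \<omega> \<and> B \<omega>) \<and> C \<omega>) \<and> D \<omega>)"
    by (intro Harris E am antimono_conj)
  finally have blocked: "q ^ 4 \<le> Pr E (\<lambda>\<omega>. ((A \<omega> \<and> B \<omega>) \<and> C \<omega>) \<and> D \<omega>)" .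
  have arm_dep: "depends_on (arm_event n) (edges (centred_box n))"
    unfolding depends_on_def arm_event_def by (simp add: conn_restrict)
  have dep: "depends_on (\<lambda>\<omega>. \<not> (((A \<omega> \<and> B \<omega>) \<and> C \<omega>) \<and> D \<omega>)) F"
  proof -
    have "edges X \<subseteq> F" if "X \<in> set S" for X using that unfolding F_def by blast
    then show ?thesis
      unfolding depends_on_def A_def B_def C_def D_def by (simp add: S_def left_right_restrict top_bottom_restrict)
  qed
  have disj: "edges (centred_box n) \<inter> F = {}"
  proof -
    have "v \<notin> centred_box n" if "v \<in> X" "X \<in> set S" for v X
      using that unfolding S_def centred_box_def by auto
    then have "e \<notin> edges X" if "e \<in> edges (centred_box n)" "X \<in> set S" for e X
      using edges_subset[OF that(1)] edges_subset[of e X] that(2) by (metis ex_in_conv in_mono)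
    then show ?thesis unfolding F_def by blast
  qed
  have "arm_prob (3 * n) \<le> Pr E (\<lambda>\<omega>. arm_event n \<omega> \<and> \<not> (((A \<omega> \<and> B \<omega>) \<and> C \<omega>) \<and> D \<omega>))"
    unfolding arm_prob_def E_def[symmetric]
  proof (rule Pr_mono)
    fix \<omega> assume a: "arm_event (3 * n) \<omega>"
    have "arm_event n \<omega>" using a n unfolding arm_event_def[of "3 * n"] by (auto intro!: arm_eventI)
    moreover have "\<not> (((A \<omega> \<and> B \<omega>) \<and> C \<omega>) \<and> D \<omega>)"
      using arm_event_annulus[OF _ a] n unfolding A_def B_def C_def D_def by auto
    ultimately show "arm_event n \<omega> \<and> \<not> (((A \<omega> \<and> B \<omega>) \<and> C \<omega>) \<and> D \<omega>)" by blast
  qed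
  also have "\<dots> = Pr E (arm_event n) * Pr E (\<lambda>\<omega>. \<not> (((A \<omega> \<and> B \<omega>) \<and> C \<omega>) \<and> D \<omega>))"
    by (rule Pr_indep[OF E arm_dep dep disj])
  also have "Pr E (arm_event n) = arm_prob n"
    unfolding arm_prob_def E_def using n
    by (intro Pr_restrict finite_edges_centred_box edges_mono arm_dep) (auto simp: centred_box_def)
  also have "Pr E (\<lambda>\<omega>. \<not> (((A \<omega> \<and> B \<omega>) \<and> C \<omega>) \<and> D \<omega>)) = 1 - Pr E (\<lambda>\<omega>. ((A \<omega> \<and> B \<omega>) \<and> C \<omega>) \<and> D \<omega>)"
    by (rule Pr_not[OF E])
  also have "arm_prob n * (1 - Pr E (\<lambda>\<omega>. ((A \<omega> \<and> B \<omega>) \<and> C \<omega>) \<and> D \<omega>)) \<le> arm_prob n * arm_rate"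
    using blocked arm_prob_nonneg unfolding arm_rate_def q_def by (intro mult_left_mono) auto
  finally show ?thesis by (simp add: mult.commute)
qed

lemma arm_prob_tendsto_0: "(\<lambda>r. arm_prob (int r)) \<longlonglongrightarrow> 0"
proof (rule LIMSEQ_I)
  fix e :: real assume e: "0 < e"
  have rate: "0 \<le> arm_rate" "arm_rate < 1" unfolding arm_rate_def by (auto simp: power_le_one)
  have pow: "arm_prob (12 * 3 ^ j) \<le> arm_rate ^ j" for j
  proof (induction j)
    case 0
    then show ?case by (simp add: arm_prob_le_1)
  next
    case (Suc j)
    have "(1::int) \<le> 3 ^ j" by simp
    then have "arm_prob (3 * (12 * 3 ^ j)) \<le> arm_rate * arm_prob (12 * 3 ^ j)" by (intro arm_prob_triple) linarith
    also have "\<dots> \<le> arm_rate * arm_rate ^ j" using rate Suc.IH by (intro mult_left_mono)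
    finally show ?case by (simp add: mult.left_commute)
  qed
  obtain j where j: "arm_rate ^ j < e" using real_arch_pow_inv[OF e rate(2)] by blast
  show "\<exists>no. \<forall>r\<ge>no. norm (arm_prob (int r) - 0) < e"
  proof (intro exI allI impI)
    fix r assume "nat (12 * 3 ^ j) \<le> r"
    then have "arm_prob (int r) \<le> arm_prob (12 * 3 ^ j)" by (intro arm_prob_antimono) auto
    then show "norm (arm_prob (int r) - 0) < e" using pow[of j] j arm_prob_nonneg[of "int r"] by simp
  qed
qed

text \<open>Translation to the origin. Only horizontal distance is measured, as the targets will be
  vertical lines.\<close>

lemma Pr_conn_far:
  assumes E: "finite E" "edges V \<subseteq> E" and r: "0 \<le> r"
  shows "Pr E (\<lambda>\<omega>. \<exists>w. r \<le> \<bar>fst w - fst u\<bar> \<and> conn \<omega> V u w) \<le> arm_prob r"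
proof -
  define f :: "vertex \<Rightarrow> vertex" where "f v = (fst v - fst u, snd v - snd u)" for v
  define g :: "vertex \<Rightarrow> vertex" where "g v = (fst v + fst u, snd v + snd u)" for v
  have fg: "f (g v) = v" "g (f v) = v" for v unfolding f_def g_def by auto
  have iso: "grid_iso f" by (rule grid_isoI[where g = g]; (rule fg)?) (simp add: f_def grid_adj_def)
  have iso': "grid_iso g" by (rule grid_isoI[where g = f]; (rule fg)?) (simp add: g_def grid_adj_def)
  define A where "A \<omega> \<longleftrightarrow> (\<exists>w. r \<le> \<bar>fst w - fst u\<bar> \<and> conn \<omega> V u w)" for \<omega>
  define B where "B \<omega> \<longleftrightarrow> (\<exists>w. (\<bar>fst w\<bar> = r \<or> \<bar>snd w\<bar> = r) \<and> conn \<omega> (g ` centred_box r) (g (0, 0)) (g w))" for \<omega>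
  \<comment> \<open>The box about \<open>u\<close> may stick out of \<open>V\<close>, so both events
    are compared in a larger edge set.\<close>
  define E' where "E' = E \<union> edges (g ` centred_box r)"
  have E': "finite E'" unfolding E'_def using E by (auto intro!: finite_edges simp: centred_box_def)
  have AB: "B \<omega>" if A: "A \<omega>" for \<omega>
  proof -
    obtain w where w: "r \<le> \<bar>fst w - fst u\<bar>" "conn \<omega> V u w" using A unfolding A_def by blast
    have "conn ((`) f ` \<omega>) (f ` V) (f u) (f w)" using w(2) grid_iso_conn[OF iso] by blast
    moreover have "f u = (0, 0)" unfolding f_def by simp
    ultimately have "arm_event r ((`) f ` \<omega>)" using w(1) r by (intro arm_eventI) (auto simp: f_def)
    then obtain w' where w': "\<bar>fst w'\<bar> = r \<or> \<bar>snd w'\<bar> = r" "conn ((`) f ` \<omega>) (centred_box r) (0, 0) w'"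
      unfolding arm_event_def by blast
    have "conn ((`) g ` (`) f ` \<omega>) (g ` centred_box r) (g (0, 0)) (g w')"
      using w'(2) grid_iso_conn[OF iso'] by blast
    moreover have "(`) g ` (`) f ` \<omega> = \<omega>" by (simp add: image_image fg)
    ultimately show ?thesis using w'(1) unfolding B_def by metis
  qed
  have Adep: "depends_on A (edges V)" unfolding depends_on_def A_def by (simp add: conn_restrict)
  have Bdep: "depends_on B (edges (g ` centred_box r))" unfolding depends_on_def B_def by (simp add: conn_restrict)
  have "Pr E A = Pr E' A"
    using Pr_restrict[OF E' _ Adep] Pr_restrict[OF E Adep] E(2) by (simp add: E'_def le_supI1)
  also have "\<dots> \<le> Pr E' B" by (rule Pr_mono) (use AB in blast)
  also have "\<dots> = Pr (edges (g ` centred_box r)) B"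
    by (rule Pr_restrict[OF E' _ Bdep]) (auto simp: E'_def)
  also have "\<dots> = Pr (edges (centred_box r)) (\<lambda>\<omega>. B ((`) g ` \<omega>))" by (rule Pr_grid_iso[OF iso'])
  also have "\<dots> = arm_prob r"
    unfolding arm_prob_def B_def arm_event_def grid_iso_conn[OF iso'] ..
  finally show ?thesis unfolding A_def .
qed

section \<open>Revealment\<close>

lemma conn_through_column:
  assumes "conn \<omega> V p q" "fst p \<le> a" "a \<le> fst q"
  shows "\<exists>w. fst w = a \<and> conn \<omega> V p w"
proof -
  from assms(1) have "fst q < a \<or> (\<exists>w. fst w = a \<and> conn \<omega> V p w)"
  proof (induction rule: conn_induct)
    case base
    then show ?case using assms(2) conn_refl[of p V \<omega>] by (metis order_le_less)
  next
    case (step v w)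
    then have "conn \<omega> V p w" using conn_trans conn_edge by blast
    moreover have "fst w \<le> fst v + 1" using \<open>grid_adj v w\<close> unfolding grid_adj_def by linarith
    then have "fst w < a \<or> fst w = a \<or> \<not> fst v < a" by linarith
    ultimately show ?case using step.IH by blast
  qed
  then show ?thesis using assms(3) by auto
qed

text \<open>A left-right crossing has to meet the line \<open>x = a\<close>, so exploring the clusters of that line
  decides whether there is one.\<close>

definition explored :: "vertex set \<Rightarrow> int \<Rightarrow> vertex set set \<Rightarrow> vertex set set" where
  "explored V a \<omega> = {e \<in> edges V. e \<inter> cluster \<omega> V ({a} \<times> UNIV) \<noteq> {}}"

lemma explored_cluster:
  assumes "\<omega> \<inter> explored V a \<omega> = \<omega>' \<inter> explored V a \<omega>"
  shows "cluster \<omega>' V ({a} \<times> UNIV) = cluster \<omega> V ({a} \<times> UNIV)"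
  by (rule cluster_cong) (use assms in \<open>auto simp: explored_def\<close>)

lemma determined_explored: "determined E (explored V a) (explored V a)"
proof -
  have "explored V a \<omega>' = explored V a \<omega>" if "\<omega> \<inter> explored V a \<omega> = \<omega>' \<inter> explored V a \<omega>" for \<omega> \<omega>'
    using explored_cluster[OF that] unfolding explored_def by simp
  then show ?thesis unfolding determined_def by blast
qed

text \<open>A crossing path meets column \<open>a\<close>, hence lies in the explored cluster, and
  all its edges are examined.\<close>

lemma left_right_explored:
  assumes a: "0 \<le> a" "a \<le> m" and V: "V = {0..m} \<times> {c..d}"
  shows "left_right 0 m c d (\<omega> \<inter> explored V a \<omega>) \<longleftrightarrow> left_right 0 m c d \<omega>"
proof
  assume "left_right 0 m c d \<omega>"
  then obtain p q where pq: "fst p = 0" "fst q = m" "conn \<omega> V p q" unfolding left_right_def V by blast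
  obtain w where w: "fst w = a" "conn \<omega> V p w"
    using conn_through_column[OF pq(3), of a] pq a by metis
  then have p: "p \<in> cluster \<omega> V ({a} \<times> UNIV)"
    unfolding cluster_def by (auto intro!: exI[of _ "snd w"] simp: conn_sym)
  from pq(3) have "conn (\<omega> \<inter> explored V a \<omega>) V p q \<and> q \<in> cluster \<omega> V ({a} \<times> UNIV)"
  proof (induction rule: conn_induct)
    case base
    then show ?case using p by (auto intro: conn_refl)
  next
    case (step v w)
    then have "{v, w} \<in> \<omega> \<inter> explored V a \<omega>" unfolding explored_def edges_def by blast
    then have "conn (\<omega> \<inter> explored V a \<omega>) V v w" using step.hyps by (intro conn_edge)
    moreover have "w \<in> cluster \<omega> V ({a} \<times> UNIV)" using step cluster_step by blast
    ultimately show ?case using step.IH conn_trans by blast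
  qed
  then show "left_right 0 m c d (\<omega> \<inter> explored V a \<omega>)" using pq unfolding left_right_def V by blast
qed (rule left_right_mono, auto)

lemma determined_left_right:
  assumes "0 \<le> a" "a \<le> m" "V = {0..m} \<times> {c..d}"
  shows "determined E (explored V a) (\<lambda>\<omega>. of_bool (left_right 0 m c d \<omega>) :: real)"
proof -
  have "(of_bool (left_right 0 m c d \<omega>') :: real) = of_bool (left_right 0 m c d \<omega>)"
    if *: "\<omega> \<inter> explored V a \<omega> = \<omega>' \<inter> explored V a \<omega>" for \<omega> \<omega>'
  proof -
    have "explored V a \<omega>' = explored V a \<omega>" using explored_cluster[OF *] unfolding explored_def by simp
    then show ?thesis using left_right_explored[OF assms, of \<omega>] left_right_explored[OF assms, of \<omega>'] * by simp
  qed
  then show ?thesis unfolding determined_def by blast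
qed

lemma Pr_in_cluster:
  assumes "finite E" "edges V \<subseteq> E"
  shows "Pr E (\<lambda>\<omega>. u \<in> cluster \<omega> V ({a} \<times> UNIV)) \<le> arm_prob \<bar>fst u - a\<bar>"
proof -
  have "Pr E (\<lambda>\<omega>. u \<in> cluster \<omega> V ({a} \<times> UNIV)) \<le> Pr E (\<lambda>\<omega>. \<exists>w. \<bar>fst u - a\<bar> \<le> \<bar>fst w - fst u\<bar> \<and> conn \<omega> V u w)"
  proof (rule Pr_mono)
    fix \<omega> assume "u \<in> cluster \<omega> V ({a} \<times> UNIV)"
    then obtain y where "conn \<omega> V (a, y) u" unfolding cluster_def by auto
    then have "\<bar>fst u - a\<bar> \<le> \<bar>fst (a, y) - fst u\<bar> \<and> conn \<omega> V u (a, y)" by (auto dest: conn_sym)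
    then show "\<exists>w. \<bar>fst u - a\<bar> \<le> \<bar>fst w - fst u\<bar> \<and> conn \<omega> V u w" by blast
  qed
  also have "\<dots> \<le> arm_prob \<bar>fst u - a\<bar>" by (rule Pr_conn_far[OF assms]) simp
  finally show ?thesis .
qed

text \<open>Each distance from \<open>x\<close> is attained by at most two columns.\<close>

lemma sum_dist_le:
  fixes g :: "nat \<Rightarrow> real"
  assumes g: "\<And>r. 0 \<le> g r" and x: "x \<le> m"
  shows "(\<Sum>a\<le>m. g (nat \<bar>int x - int a\<bar>)) \<le> 2 * (\<Sum>r\<le>m. g r)"
proof -
  have "(\<Sum>a\<le>m. g (nat \<bar>int x - int a\<bar>)) \<le> (\<Sum>a\<in>{..x} \<union> {x..m}. g (nat \<bar>int x - int a\<bar>))"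
    by (rule sum_mono2) (use g in auto)
  also have "\<dots> \<le> (\<Sum>a\<in>{..x}. g (nat \<bar>int x - int a\<bar>)) + (\<Sum>a\<in>{x..m}. g (nat \<bar>int x - int a\<bar>))"
    using sum.union_inter[of "{..x}" "{x..m}" "\<lambda>a. g (nat \<bar>int x - int a\<bar>)"] g
    by (smt (verit) finite_atLeastAtMost finite_atMost sum_nonneg)
  also have "(\<Sum>a\<in>{..x}. g (nat \<bar>int x - int a\<bar>)) = (\<Sum>r\<in>{..x}. g r)"
    by (rule sum.reindex_bij_witness[of _ "\<lambda>r. x - r" "\<lambda>a. x - a"]) (auto simp: nat_diff_distrib of_nat_diff)
  also have "\<dots> \<le> (\<Sum>r\<le>m. g r)" by (rule sum_mono2) (use g x in auto)
  also have "(\<Sum>a\<in>{x..m}. g (nat \<bar>int x - int a\<bar>)) = (\<Sum>r\<in>{..m - x}. g r)"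
    by (rule sum.reindex_bij_witness[of _ "\<lambda>r. x + r" "\<lambda>a. a - x"])
      (use x in \<open>auto simp: nat_diff_distrib\<close>)
  also have "\<dots> \<le> (\<Sum>r\<le>m. g r)" by (rule sum_mono2) (use g x in auto)
  finally show ?thesis by simp
qed

text \<open>The factor \<open>4\<close> counts two ends of an edge and two columns at each
  distance.\<close>

definition revealment :: "nat \<Rightarrow> real" where
  "revealment m = 4 * (\<Sum>r\<le>m. arm_prob (int r)) / real (Suc m)"

lemma revealment_nonneg: "0 \<le> revealment m"
  unfolding revealment_def by (auto intro!: divide_nonneg_nonneg sum_nonneg simp: arm_prob_nonneg)

lemma revealment_tendsto_0: "revealment \<longlonglongrightarrow> 0"
proof (rule LIMSEQ_I)
  fix e :: real assume e: "0 < e"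
  \<comment> \<open>Terms below \<open>N\<close> are bounded by \<open>1\<close>, the others by
    \<open>e / 8\<close>; after the factor \<open>4\<close> each part stays within
    \<open>e / 2\<close> once \<open>m\<close> is large.\<close>
  obtain N where N: "\<And>r. N \<le> r \<Longrightarrow> arm_prob (int r) < e / 8"
    using LIMSEQ_D[OF arm_prob_tendsto_0, of "e / 8"] e by (auto simp: arm_prob_nonneg)
  obtain M where M: "8 * real N / e < real M" using reals_Archimedean2 by blast
  show "\<exists>no. \<forall>m\<ge>no. norm (revealment m - 0) < e"
  proof (intro exI allI impI)
    fix m assume m: "M \<le> m"
    have "arm_prob (int r) \<le> (if r < N then 1 else 0) + e / 8" for r
      using N[of r] arm_prob_le_1[of "int r"] e by (auto simp: not_less)
    then have "(\<Sum>r\<le>m. arm_prob (int r)) \<le> (\<Sum>r\<le>m. (if r < N then 1 else 0) + e / 8)" by (intro sum_mono)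
    also have "\<dots> = (\<Sum>r\<le>m. if r < N then 1 else 0) + real (Suc m) * (e / 8)" by (simp add: sum.distrib)
    also have "(\<Sum>r\<le>m. if r < N then 1 else (0::real)) \<le> (\<Sum>r<N. 1)"
      unfolding sum.inter_filter[symmetric, OF finite_atMost] by (rule sum_mono2) auto
    finally have s: "(\<Sum>r\<le>m. arm_prob (int r)) \<le> real N + real (Suc m) * (e / 8)" by simp
    have "8 * real N / e < real (Suc m)" using M m by linarith
    then have "8 * real N < e * real (Suc m)" using e by (simp add: field_simps)
    moreover have "real (Suc m) * (e / 8) = e * real (Suc m) / 8" by simp
    ultimately have "4 * (\<Sum>r\<le>m. arm_prob (int r)) < e * real (Suc m)" using s by linarith
    then have "revealment m < e" unfolding revealment_def by (simp add: divide_less_eq)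
    then show "norm (revealment m - 0) < e" using revealment_nonneg[of m] by simp
  qed
qed

lemma rect_edges_eq: "rect_edges m = edges ({0..int m} \<times> {1..int m})"
  unfolding rect_edges_def rect_verts_def edges_def ..

lemma sum_Pr_explored_le:
  assumes "e \<in> rect_edges m"
  shows "(\<Sum>a\<le>m. Pr (rect_edges m) (\<lambda>\<omega>. e \<in> explored ({0..int m} \<times> {1..int m}) (int a) \<omega>))
    \<le> real (Suc m) * revealment m"
proof -
  define V where "V = {0..int m} \<times> {1..int m}"
  define E where "E = edges V"
  have E: "finite E" unfolding E_def V_def by (intro finite_edges) auto
  obtain u v where e: "e = {u, v}" "u \<in> V" "v \<in> V"
    using assms unfolding rect_edges_eq V_def[symmetric] edges_def by blast
  have le: "Pr E (\<lambda>\<omega>. e \<in> explored V (int a) \<omega>) \<le> arm_prob (int (nat \<bar>int (nat (fst u)) - int a\<bar>)) + arm_prob (int (nat \<bar>int (nat (fst v)) - int a\<bar>))" for a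
  proof -
    have "Pr E (\<lambda>\<omega>. e \<in> explored V (int a) \<omega>) \<le> Pr E (\<lambda>\<omega>. u \<in> cluster \<omega> V ({int a} \<times> UNIV) \<or> v \<in> cluster \<omega> V ({int a} \<times> UNIV))"
      by (rule Pr_mono) (auto simp: explored_def e)
    also have "\<dots> \<le> Pr E (\<lambda>\<omega>. u \<in> cluster \<omega> V ({int a} \<times> UNIV)) + Pr E (\<lambda>\<omega>. v \<in> cluster \<omega> V ({int a} \<times> UNIV))"
      by (rule Pr_disj_le)
    also have "\<dots> \<le> arm_prob \<bar>fst u - int a\<bar> + arm_prob \<bar>fst v - int a\<bar>"
      using E by (intro add_mono Pr_in_cluster) (auto simp: E_def)
    finally show ?thesis using e(2,3) unfolding V_def by auto
  qed
  have x: "nat (fst u) \<le> m" "nat (fst v) \<le> m" using e(2,3) unfolding V_def by auto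
  have "(\<Sum>a\<le>m. Pr E (\<lambda>\<omega>. e \<in> explored V (int a) \<omega>))
     \<le> (\<Sum>a\<le>m. arm_prob (int (nat \<bar>int (nat (fst u)) - int a\<bar>)) + arm_prob (int (nat \<bar>int (nat (fst v)) - int a\<bar>)))"
    by (intro sum_mono le)
  also have "\<dots> \<le> 2 * (\<Sum>r\<le>m. arm_prob (int r)) + 2 * (\<Sum>r\<le>m. arm_prob (int r))"
    unfolding sum.distrib
    by (intro add_mono sum_dist_le[where g = "\<lambda>r. arm_prob (int r)"] x arm_prob_nonneg)
  also have "\<dots> = real (Suc m) * revealment m" unfolding revealment_def by simp
  finally show ?thesis unfolding E_def V_def rect_edges_eq .
qed

lemma Pr_meet_le: "finite S \<Longrightarrow> Pr E (\<lambda>\<omega>. S \<inter> J \<omega> \<noteq> {}) \<le> (\<Sum>e\<in>S. Pr E (\<lambda>\<omega>. e \<in> J \<omega>))"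
proof (induction S rule: finite_induct)
  case empty
  then show ?case by (simp add: Pr_def avg_def)
next
  case (insert e S)
  have "Pr E (\<lambda>\<omega>. insert e S \<inter> J \<omega> \<noteq> {}) \<le> Pr E (\<lambda>\<omega>. e \<in> J \<omega> \<or> S \<inter> J \<omega> \<noteq> {})"
    by (rule Pr_mono) auto
  also have "\<dots> \<le> Pr E (\<lambda>\<omega>. e \<in> J \<omega>) + Pr E (\<lambda>\<omega>. S \<inter> J \<omega> \<noteq> {})" by (rule Pr_disj_le)
  finally show ?case using insert by simp
qed

text \<open>\<open>level_weight_le\<close> is summed over the \<open>m + 1\<close> lines. On the
  right each edge then contributes at most \<open>real (Suc m) * revealment m\<close>, a bound that
  holds for an average over lines but for no fixed line. Cancelling \<open>W\<close> comes
  last.\<close>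

lemma crossing_level_weight_le:
  fixes m k :: nat
  assumes k: "1 \<le> k"
  defines "f \<equiv> \<lambda>\<omega>. of_bool (left_right 0 (int m) 1 (int m) \<omega>) :: real"
  shows "(\<Sum>S\<in>{S. S \<subseteq> rect_edges m \<and> card S = k}. (coef (rect_edges m) f S)\<^sup>2) \<le> real k * revealment m"
proof -
  define V where "V = {0..int m} \<times> {1..int m}"
  define E where "E = rect_edges m"
  define L where "L = {S. S \<subseteq> E \<and> card S = k}"
  define c where "c S = (coef E f S)\<^sup>2" for S
  define W where "W = (\<Sum>S\<in>L. c S)"
  define J where "J a = explored V (int a)" for a
  have E: "finite E" unfolding E_def by (rule card_rect_edges)
  have L: "finite S" "S \<subseteq> E" "card S = k" if "S \<in> L" for S
    using that E unfolding L_def by (auto intro: finite_subset)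
  have W0: "0 \<le> W" unfolding W_def c_def by (intro sum_nonneg) simp
  have "W\<^sup>2 \<le> (\<Sum>S\<in>L. c S * Pr E (\<lambda>\<omega>. S \<inter> J a \<omega> \<noteq> {}))" if a: "a \<le> m" for a
    unfolding W_def c_def L_def J_def
  proof (rule level_weight_le[OF E k determined_explored])
    show "determined E (explored V (int a)) f"
      unfolding f_def by (rule determined_left_right) (use a in \<open>auto simp: V_def\<close>)
  qed (simp add: f_def)
  then have "(\<Sum>a\<le>m. W\<^sup>2) \<le> (\<Sum>a\<le>m. \<Sum>S\<in>L. c S * Pr E (\<lambda>\<omega>. S \<inter> J a \<omega> \<noteq> {}))"
    by (intro sum_mono) simp
  also have "\<dots> \<le> (\<Sum>a\<le>m. \<Sum>S\<in>L. c S * (\<Sum>e\<in>S. Pr E (\<lambda>\<omega>. e \<in> J a \<omega>)))"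
    by (intro sum_mono mult_left_mono Pr_meet_le) (auto simp: L c_def)
  also have "\<dots> = (\<Sum>S\<in>L. c S * (\<Sum>e\<in>S. \<Sum>a\<le>m. Pr E (\<lambda>\<omega>. e \<in> J a \<omega>)))"
    by (subst sum.swap, intro sum.cong refl, subst sum_distrib_left[symmetric], subst sum.swap, rule refl)
  also have "\<dots> \<le> (\<Sum>S\<in>L. c S * (\<Sum>e\<in>S. real (Suc m) * revealment m))"
  proof (intro sum_mono mult_left_mono)
    show "(\<Sum>a\<le>m. Pr E (\<lambda>\<omega>. e \<in> J a \<omega>)) \<le> real (Suc m) * revealment m" if "S \<in> L" "e \<in> S" for S e
      unfolding J_def V_def E_def by (rule sum_Pr_explored_le) (use that L in \<open>auto simp: E_def\<close>)
  qed (simp add: c_def)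
  also have "\<dots> = real (Suc m) * (W * (real k * revealment m))"
    by (simp add: L W_def sum_distrib_left sum_distrib_right mult_ac cong: sum.cong)
  finally have "W * W \<le> W * (real k * revealment m)" by (simp add: power2_eq_square del: of_nat_Suc)
  then have "W \<le> real k * revealment m"
    using W0 revealment_nonneg[of m] by (cases "W = 0") (auto simp: mult_le_cancel_left_pos)
  then show ?thesis unfolding W_def c_def L_def E_def .
qed

section \<open>Noise sensitivity\<close>

lemma cube_bij: "bij_betw (\<lambda>\<omega> e. e \<in> \<omega>) (Pow I) (cube I)"
  by (rule bij_betw_byWitness[of _ "\<lambda>x. {e. x e}"]) (auto simp: cube_def PiE_dflt_def)

lemma finite_cube: "finite I \<Longrightarrow> finite (cube I)"
  using bij_betw_finite[OF cube_bij[of I]] by simp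

lemma cube_nonempty: "cube I \<noteq> {}"
  using bij_betw_empty2[of _ "Pow I"] cube_bij[of I] by (auto simp: bij_betw_def)

lemma prob_uniform_cube:
  assumes I: "finite I"
  shows "measure_pmf.prob (uniform_cube I) B = Pr I (\<lambda>\<omega>. (\<lambda>e. e \<in> \<omega>) \<in> B)"
proof -
  have "measure_pmf.prob (uniform_cube I) B = card (cube I \<inter> B) / card (cube I)"
    unfolding uniform_cube_def by (rule measure_pmf_of_set[OF cube_nonempty finite_cube[OF I]])
  also have "card (cube I) = 2 ^ card I"
    using bij_betw_same_card[OF cube_bij[of I]] I by (simp add: card_Pow)
  also have "real (card (cube I \<inter> B)) = (\<Sum>x\<in>cube I. of_bool (x \<in> B))"
    using finite_cube[OF I] by simp
  also have "\<dots> = (\<Sum>\<omega>\<in>Pow I. of_bool ((\<lambda>e. e \<in> \<omega>) \<in> B))"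
    by (rule sum.reindex_bij_betw[OF cube_bij, symmetric])
  finally show ?thesis unfolding Pr_def avg_def by simp
qed

lemma prob_noise:
  assumes I: "finite I" and \<epsilon>: "0 < \<epsilon>" "\<epsilon> < 1"
  shows "measure_pmf.prob (noise I \<epsilon> (\<lambda>e. e \<in> \<omega>)) A = noise_op I \<epsilon> (\<lambda>\<eta>. of_bool ((\<lambda>e. e \<in> \<eta>) \<in> A)) \<omega>"
proof -
  have flip: "pmf (map_pmf (\<lambda>flip. if flip then \<not> b else b) (bernoulli_pmf \<epsilon>)) d = (if b = d then 1 - \<epsilon> else \<epsilon>)" for b d
  proof -
    have inj: "inj (\<lambda>flip. if flip then \<not> b else b)" by (auto simp: inj_on_def)
    show ?thesis
      using pmf_map_inj'[OF inj, of "bernoulli_pmf \<epsilon>" "b \<noteq> d"] \<epsilon> by (cases b; cases d) auto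
  qed
  have supp: "set_pmf (noise I \<epsilon> (\<lambda>e. e \<in> \<omega>)) \<subseteq> cube I"
    using set_Pi_pmf_subset[OF I] unfolding noise_def cube_def PiE_dflt_def by fastforce
  \<comment> \<open>\<open>A\<close> may be infinite; the finite cube carries all the mass.\<close>
  have "measure_pmf.prob (noise I \<epsilon> (\<lambda>e. e \<in> \<omega>)) A = measure_pmf.prob (noise I \<epsilon> (\<lambda>e. e \<in> \<omega>)) (A \<inter> cube I)"
    using supp by (intro measure_prob_cong_0) (auto simp: set_pmf_iff)
  also have "\<dots> = (\<Sum>x\<in>A \<inter> cube I. pmf (noise I \<epsilon> (\<lambda>e. e \<in> \<omega>)) x)"
    by (rule measure_measure_pmf_finite) (simp add: finite_cube[OF I])
  also have "\<dots> = (\<Sum>x\<in>cube I. pmf (noise I \<epsilon> (\<lambda>e. e \<in> \<omega>)) x * of_bool (x \<in> A))"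
    by (rule sum.mono_neutral_cong_left) (auto simp: finite_cube[OF I])
  also have "\<dots> = (\<Sum>\<eta>\<in>Pow I. pmf (noise I \<epsilon> (\<lambda>e. e \<in> \<omega>)) (\<lambda>e. e \<in> \<eta>) * of_bool ((\<lambda>e. e \<in> \<eta>) \<in> A))"
    by (rule sum.reindex_bij_betw[OF cube_bij, symmetric])
  also have "\<dots> = noise_op I \<epsilon> (\<lambda>\<eta>. of_bool ((\<lambda>e. e \<in> \<eta>) \<in> A)) \<omega>"
    unfolding noise_op_def
  proof (intro sum.cong refl arg_cong2[where f = "(*)"])
    fix \<eta> assume "\<eta> \<in> Pow I"
    then show "pmf (noise I \<epsilon> (\<lambda>e. e \<in> \<omega>)) (\<lambda>e. e \<in> \<eta>) = (\<Prod>e\<in>I. if (e \<in> \<omega>) = (e \<in> \<eta>) then 1 - \<epsilon> else \<epsilon>)"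
      unfolding noise_def using I by (subst pmf_Pi') (auto simp: flip)
  qed
  finally show ?thesis .
qed

lemma Pr_Chebyshev:
  assumes "0 < \<delta>"
  shows "Pr E (\<lambda>\<omega>. \<delta> < \<bar>g \<omega>\<bar>) \<le> avg E (\<lambda>\<omega>. (g \<omega>)\<^sup>2) / \<delta>\<^sup>2"
proof -
  have "\<delta>\<^sup>2 * Pr E (\<lambda>\<omega>. \<delta> < \<bar>g \<omega>\<bar>) = avg E (\<lambda>\<omega>. \<delta>\<^sup>2 * of_bool (\<delta> < \<bar>g \<omega>\<bar>))"
    unfolding Pr_def avg_cmult ..
  also have "\<dots> \<le> avg E (\<lambda>\<omega>. (g \<omega>)\<^sup>2)"
  proof (rule avg_mono)
    fix \<omega>
    show "\<delta>\<^sup>2 * of_bool (\<delta> < \<bar>g \<omega>\<bar>) \<le> (g \<omega>)\<^sup>2"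
      using assms power_mono[of \<delta> "\<bar>g \<omega>\<bar>" 2] by (cases "\<delta> < \<bar>g \<omega>\<bar>") auto
  qed
  finally show ?thesis using assms by (simp add: field_simps)
qed

lemma noise_phi_nonneg: "0 \<le> noise_phi I A \<epsilon>"
  unfolding noise_phi_def using noise_phi_set_wf(1)[of I A \<epsilon>]
  by (intro cInf_greatest) (blast, simp)

text \<open>The third power arises because Chebyshev divides the variance by
  \<open>\<delta> ^ 2\<close> and the gauge has to fall below \<open>\<delta>\<close>
  itself.\<close>

lemma noise_phi_le:
  fixes A :: "('i \<Rightarrow> bool) set"
  assumes I: "finite I" and \<epsilon>: "0 < \<epsilon>" "\<epsilon> < 1" and \<delta>: "0 < \<delta>"
  defines "f \<equiv> \<lambda>\<omega>. of_bool ((\<lambda>e. e \<in> \<omega>) \<in> A) :: real"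
  assumes var: "avg I (\<lambda>\<omega>. (noise_op I \<epsilon> f \<omega> - avg I f)\<^sup>2) < \<delta> ^ 3"
  shows "noise_phi I A \<epsilon> \<le> \<delta>"
proof -
  have "sensitivity_gauge I A \<epsilon> \<delta> = Pr I (\<lambda>\<omega>. \<delta> < \<bar>noise_op I \<epsilon> f \<omega> - avg I f\<bar>)"
    unfolding sensitivity_gauge_def prob_uniform_cube[OF I]
  proof (rule Pr_cong)
    fix \<omega> assume "\<omega> \<subseteq> I"
    then have "(\<lambda>e. e \<in> \<omega>) \<in> cube I" by (auto simp: cube_def PiE_dflt_def)
    then show "((\<lambda>e. e \<in> \<omega>) \<in> {x \<in> cube I. \<bar>measure_pmf.prob (noise I \<epsilon> x) A - Pr I (\<lambda>\<omega>. (\<lambda>e. e \<in> \<omega>) \<in> A)\<bar> > \<delta>})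
       = (\<delta> < \<bar>noise_op I \<epsilon> f \<omega> - avg I f\<bar>)"
      using prob_noise[OF I \<epsilon>, of \<omega> A] unfolding f_def Pr_def by simp
  qed
  also have "\<dots> \<le> avg I (\<lambda>\<omega>. (noise_op I \<epsilon> f \<omega> - avg I f)\<^sup>2) / \<delta>\<^sup>2" by (rule Pr_Chebyshev[OF \<delta>])
  also have "\<dots> < \<delta> ^ 3 / \<delta>\<^sup>2" using var \<delta> by (intro divide_strict_right_mono) auto
  also have "\<dots> = \<delta>" using \<delta> by (simp add: power2_eq_square power3_eq_cube)
  finally have "\<delta> \<in> {\<delta>. \<delta> > 0 \<and> sensitivity_gauge I A \<epsilon> \<delta> < \<delta>}" using \<delta> by simp
  then show ?thesis unfolding noise_phi_def by (rule cInf_lower[OF _ noise_phi_set_wf(2)])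
qed

section \<open>Vertex lists and connections\<close>

lemma conn_imp_path:
  assumes "conn \<omega> V p q"
  shows "\<exists>l. l \<noteq> [] \<and> distinct l \<and> set l \<subseteq> V \<and> hd l = p \<and> last l = q \<and>
    successively (\<lambda>u v. {u, v} \<in> \<omega> \<inter> edges V) l"
  using assms
proof (induction rule: conn_induct)
  case base
  then show ?case by (intro exI[of _ "[p]"]) auto
next
  case (step v w)
  then obtain l where l: "l \<noteq> []" "distinct l" "set l \<subseteq> V" "hd l = p" "last l = v"
    "successively (\<lambda>u v. {u, v} \<in> \<omega> \<inter> edges V) l" by blast
  show ?case
  proof (cases "w \<in> set l")
    case True
    \<comment> \<open>A revisit of \<open>w\<close> cuts the list back to \<open>w\<close>; this
      keeps the list distinct, as \<open>rect_path\<close> demands.\<close>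
    then obtain xs ys where xy: "l = xs @ w # ys" by (meson split_list)
    have "hd (xs @ [w]) = p" using l(4) unfolding xy by (cases xs) auto
    then show ?thesis
      using l unfolding xy by (intro exI[of _ "xs @ [w]"]) (auto simp: successively_append_iff)
  next
    case False
    have "{v, w} \<in> \<omega> \<inter> edges V" using step.hyps unfolding edges_def by blast
    then show ?thesis
      using l False \<open>w \<in> V\<close> by (intro exI[of _ "l @ [w]"]) (auto simp: successively_append_iff)
  qed
qed

lemma path_imp_conn:
  assumes "l \<noteq> []" "set l \<subseteq> V" "successively (\<lambda>u v. {u, v} \<in> edges V) l" "successively (\<lambda>u v. {u, v} \<in> \<omega>) l"
  shows "conn \<omega> V (hd l) (last l)"
  using assms
proof (induction l rule: induct_list012)
  case (3 x y zs)
  then have "{x, y} \<in> edges V" "{x, y} \<in> \<omega>" by auto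
  then have "grid_adj x y" unfolding edges_def using grid_adj_sym by (auto simp: doubleton_eq_iff)
  then have "conn \<omega> V x y" using 3 by (intro conn_edge) auto
  moreover have "conn \<omega> V y (last (y # zs))" using 3 by auto
  ultimately have "conn \<omega> V x (last (y # zs))" by (rule conn_trans)
  then show ?case by simp
qed (auto intro: conn_refl)

lemma crossing_event_iff:
  assumes "\<omega> \<subseteq> rect_edges m"
  shows "(\<lambda>e. e \<in> \<omega>) \<in> crossing_event m \<longleftrightarrow> left_right 0 (int m) 1 (int m) \<omega>"
proof -
  define V where "V = {0..int m} \<times> {1..int m}"
  have c: "(\<lambda>e. e \<in> \<omega>) \<in> cube (rect_edges m)" using assms by (auto simp: cube_def PiE_dflt_def)
  have V: "rect_verts m = V" "rect_edges m = edges V" unfolding V_def rect_verts_def rect_edges_eq by auto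
  show ?thesis
  proof
    assume "(\<lambda>e. e \<in> \<omega>) \<in> crossing_event m"
    then obtain l where "l \<noteq> []" "set l \<subseteq> V" "successively (\<lambda>u v. {u, v} \<in> edges V) l"
      "fst (hd l) = 0" "fst (last l) = int m" "successively (\<lambda>u v. {u, v} \<in> \<omega>) l"
      unfolding crossing_event_def rect_path_def V by auto
    then show "left_right 0 (int m) 1 (int m) \<omega>"
      using path_imp_conn unfolding left_right_def V_def by blast
  next
    assume "left_right 0 (int m) 1 (int m) \<omega>"
    then obtain p q where pq: "fst p = 0" "fst q = int m" "conn \<omega> V p q" unfolding left_right_def V_def by blast
    then obtain l where l: "l \<noteq> []" "distinct l" "set l \<subseteq> V" "hd l = p" "last l = q"
      "successively (\<lambda>u v. {u, v} \<in> \<omega> \<inter> edges V) l" using conn_imp_path by blast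
    have "successively (\<lambda>u v. {u, v} \<in> edges V) l" "successively (\<lambda>u v. {u, v} \<in> \<omega>) l"
      by (rule successively_mono[OF l(6)], simp)+
    then show "(\<lambda>e. e \<in> \<omega>) \<in> crossing_event m"
      using c l pq unfolding crossing_event_def rect_path_def V by auto
  qed
qed

lemma crossing_variance_le:
  assumes \<epsilon>: "0 < \<epsilon>" "\<epsilon> < 1 / 2"
  defines "f \<equiv> \<lambda>m \<omega>. of_bool ((\<lambda>e. e \<in> \<omega>) \<in> crossing_event m) :: real"
  shows "avg (rect_edges m) (\<lambda>\<omega>. (noise_op (rect_edges m) \<epsilon> (f m) \<omega> - avg (rect_edges m) (f m))\<^sup>2)
    \<le> revealment m / (1 - (1 - 2 * \<epsilon>)\<^sup>2)\<^sup>2"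
proof (rule noise_variance_le[OF card_rect_edges(1) \<epsilon> revealment_nonneg])
  fix k :: nat assume k: "1 \<le> k"
  have "coef (rect_edges m) (f m) S = coef (rect_edges m) (\<lambda>\<omega>. of_bool (left_right 0 (int m) 1 (int m) \<omega>)) S" for S
    unfolding coef_def f_def by (rule avg_cong) (simp add: crossing_event_iff)
  then show "(\<Sum>S\<in>{S. S \<subseteq> rect_edges m \<and> card S = k}. (coef (rect_edges m) (f m) S)\<^sup>2) \<le> real k * revealment m"
    using crossing_level_weight_le[OF k, of m] by simp
qed

theorem theorem1p2:
  shows "asymptotically_noise_sensitive rect_edges crossing_event"
  unfolding asymptotically_noise_sensitive_def
proof (intro allI impI)
  fix \<epsilon> :: real assume "0 < \<epsilon> \<and> \<epsilon> < 1 / 2"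
  then have \<epsilon>: "0 < \<epsilon>" "\<epsilon> < 1 / 2" by auto
  define C where "C = (1 - (1 - 2 * \<epsilon>)\<^sup>2)\<^sup>2"
  have "(\<lambda>m. revealment m / C) \<longlonglongrightarrow> 0"
    using tendsto_mult_right[OF revealment_tendsto_0, of "inverse C"] by (simp add: divide_inverse)
  note lim = this
  show "(\<lambda>m. noise_phi (rect_edges m) (crossing_event m) \<epsilon>) \<longlonglongrightarrow> 0"
  proof (rule LIMSEQ_I)
    fix e :: real assume e: "0 < e"
    \<comment> \<open>The cube fits \<open>noise_phi_le\<close>; halving \<open>e\<close> turns its
      weak bound into a strict one.\<close>
    then have "0 < (e / 2) ^ 3" by simp
    from LIMSEQ_D[OF lim this] obtain M where "\<And>m. M \<le> m \<Longrightarrow> norm (revealment m / C - 0) < (e / 2) ^ 3"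
      by blast
    then have M: "revealment m / C < (e / 2) ^ 3" if "M \<le> m" for m
      using that by (simp only: real_norm_def diff_zero) (meson abs_le_D1 abs_ge_self order_le_less_trans)
    show "\<exists>M. \<forall>m\<ge>M. norm (noise_phi (rect_edges m) (crossing_event m) \<epsilon> - 0) < e"
    proof (intro exI allI impI)
      fix m assume "M \<le> m"
      from M[OF this] have "noise_phi (rect_edges m) (crossing_event m) \<epsilon> \<le> e / 2"
        using crossing_variance_le[OF \<epsilon>, of m] \<epsilon> e unfolding C_def
        by (intro noise_phi_le card_rect_edges) auto
      then show "norm (noise_phi (rect_edges m) (crossing_event m) \<epsilon> - 0) < e"
        using e noise_phi_nonneg[of "rect_edges m" "crossing_event m" \<epsilon>] by simp
    qed
  qed
qed

end
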